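(* Let $N$ be a paraquaternionic CR-submanifold of a paraquaternionic K\"ahler manifold $(M,\sigma,g)$, with paraquaternionic distribution $\mathcal{D}$ and totally real distribution $\mathcal{D}^\perp$. Then the distribution $\mathcal{D}^\perp$ is integrable.
   Context: Everything is smooth. Put $\epsilon_1=1$, $\epsilon_2=\epsilon_3=-1$; indices $\alpha\in\{1,2,3\}$ are taken modulo 3. An almost paraquaternionic structure on $M$ is a rank-3 subbundle $\sigma\subset \mathrm{End}(TM)$ admitting on coordinate neighborhoods $U$ a canonical local basis $\{J_1,J_2,J_3\}$ with $J_\alpha^2=-\epsilon_\alpha \mathrm{Id}$ and $J_\alpha J_{\alpha+1}=-J_{\alpha+1}J_\alpha=\epsilon_{\alpha+2}J_{\alpha+2}$; on overlaps two canonical local bases are related by an $SO(2,1)$-valued matrix of functions. $(M,\sigma,g)$ is almost paraquaternionic hermitian if $g$ is a semi-Riemannian metric with $g(J_\alpha X,J_\alpha Y)=\epsilon_\alpha g(X,Y)$ for all $\alpha$ and all canonical local bases. It is paraquaternionic K\"ahler if moreover $\sigma$ is parallel with respect to the Levi-Civita connection $\overline\nabla$ of $g$; equivalently there are local 1-forms $\omega_1,\omega_2,\omega_3$ with $\overline\nabla_XJ_\alpha=-\epsilon_\alpha[\omega_{\alpha+2}(X)J_{\alpha+1}-\omega_{\alpha+1}(X)J_{\alpha+2}]$. A non-degenerate (immersed) submanifold $N$ of $M$ is one on which the induced metric, again denoted $g$, is non-degenerate. It is a paraquaternionic CR-submanifold if there is a non-degenerate distribution $\mathcal{D}\subset TN$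 such that, for every canonical local basis on $U$ and $x\in U\cap N$, $J_\alpha\mathcal{D}_x=\mathcal{D}_x$ and $J_\alpha\mathcal{D}^\perp_x\subset T_x^\perp N$ for $\alpha\in\{1,2,3\}$, where $\mathcal{D}^\perp$ is the orthogonal complement of $\mathcal{D}$ in $TN$. *)

theory Defs
  imports "HOL-Analysis.Analysis"
begin

section \<open>Smooth maps between Euclidean spaces\<close>

text \<open>Only used for open \<open>S\<close>; the value of \<open>f\<close> outside \<open>S\<close> is irrelevant.\<close>

primrec Ck_on :: "nat \<Rightarrow> 'a::euclidean_space set \<Rightarrow> ('a \<Rightarrow> 'b::real_normed_vector) \<Rightarrow> bool" where
  "Ck_on 0 S f \<longleftrightarrow> continuous_on S f"
| "Ck_on (Suc k) S f \<longleftrightarrow>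
     (\<forall>x\<in>S. f differentiable (at x)) \<and> (\<forall>v. Ck_on k S (\<lambda>x. frechet_derivative f (at x) v))"

definition smooth_on :: "'a::euclidean_space set \<Rightarrow> ('a \<Rightarrow> 'b::real_normed_vector) \<Rightarrow> bool" where
  "smooth_on S f \<longleftrightarrow> (\<forall>k. Ck_on k S f)"


section \<open>Smooth manifolds\<close>

text \<open>The points of a manifold are all the elements of a topological type \<open>'m\<close>. A chart is a
  domain together with a coordinate map into the model space \<open>'a\<close>.\<close>

type_synonym ('m, 'a) chart = "'m set \<times> ('m \<Rightarrow> 'a)"

abbreviation cinv :: "('m, 'a) chart \<Rightarrow> 'a \<Rightarrow> 'm" where
  "cinv c \<equiv> inv_into (fst c) (snd c)"

definition is_chart :: "('m::topological_space, 'a::euclidean_space) chart \<Rightarrow> bool" where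
  "is_chart c \<longleftrightarrow> open (fst c) \<and> open (snd c ` fst c) \<and>
     homeomorphism (fst c) (snd c ` fst c) (snd c) (cinv c)"

definition smooth_transition ::
    "('m::topological_space, 'a::euclidean_space) chart \<Rightarrow> ('m, 'a) chart \<Rightarrow> bool" where
  "smooth_transition c d \<longleftrightarrow> smooth_on (snd c ` (fst c \<inter> fst d)) (snd d \<circ> cinv c)"

definition smooth_manifold ::
    "('m::{t2_space,second_countable_topology}, 'a::euclidean_space) chart set \<Rightarrow> bool" where
  "smooth_manifold A \<longleftrightarrow>
     (\<forall>c\<in>A. is_chart c) \<and> (\<Union>c\<in>A. fst c) = UNIV \<and>
     (\<forall>c\<in>A. \<forall>d\<in>A. smooth_transition c d) \<and>
     (\<forall>c. is_chart c \<and> (\<forall>d\<in>A. smooth_transition c d \<and> smooth_transition d c) \<longrightarrow> c \<in> A)"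

text \<open>The tangent space at \<open>p\<close> is the model space \<open>'a\<close>: a vector \<open>u :: 'a\<close> at \<open>p\<close> stands for the
  tangent vector whose components in the preferred chart \<open>pref_chart A p\<close> are \<open>u\<close>. Its
  components in any other chart \<open>c\<close> around \<open>p\<close> are \<open>chart_diff A c p u\<close>. The preferred chart
  need not depend continuously on \<open>p\<close>, so smoothness of fields is always expressed through
  \<open>chart_diff\<close>.\<close>

definition pref_chart :: "('m, 'a) chart set \<Rightarrow> 'm \<Rightarrow> ('m, 'a) chart" where
  "pref_chart A p = (SOME c. c \<in> A \<and> p \<in> fst c)"

definition chart_diff ::
    "('m, 'a::euclidean_space) chart set \<Rightarrow> ('m, 'a) chart \<Rightarrow> 'm \<Rightarrow> 'a \<Rightarrow> 'a" where
  "chart_diff A c p =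
     frechet_derivative (snd c \<circ> cinv (pref_chart A p)) (at (snd (pref_chart A p) p))"

text \<open>The tangent vector at \<open>p\<close> with components \<open>v\<close> in the chart \<open>c\<close>.\<close>

definition coord_vec ::
    "('m, 'a::euclidean_space) chart set \<Rightarrow> ('m, 'a) chart \<Rightarrow> 'a \<Rightarrow> 'm \<Rightarrow> 'a" where
  "coord_vec A c v p = inv (chart_diff A c p) v"

definition smooth_fun ::
    "('m, 'a::euclidean_space) chart set \<Rightarrow> 'm set \<Rightarrow> ('m \<Rightarrow> real) \<Rightarrow> bool" where
  "smooth_fun A U h \<longleftrightarrow> (\<forall>c\<in>A. smooth_on (snd c ` (U \<inter> fst c)) (h \<circ> cinv c))"

definition fun_diff ::
    "('m, 'a::euclidean_space) chart set \<Rightarrow> ('m \<Rightarrow> real) \<Rightarrow> 'm \<Rightarrow> 'a \<Rightarrow> real" where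
  "fun_diff A h p =
     frechet_derivative (h \<circ> cinv (pref_chart A p)) (at (snd (pref_chart A p) p))"

definition smooth_map ::
    "('n::topological_space, 'b::euclidean_space) chart set \<Rightarrow>
     ('m::topological_space, 'a::euclidean_space) chart set \<Rightarrow> ('n \<Rightarrow> 'm) \<Rightarrow> bool" where
  "smooth_map B A f \<longleftrightarrow> continuous_on UNIV f \<and>
     (\<forall>c\<in>B. \<forall>d\<in>A. smooth_on (snd c ` (fst c \<inter> f -` fst d)) (snd d \<circ> f \<circ> cinv c))"

definition tangent_map ::
    "('n, 'b::euclidean_space) chart set \<Rightarrow> ('m, 'a::euclidean_space) chart set \<Rightarrow>
     ('n \<Rightarrow> 'm) \<Rightarrow> 'n \<Rightarrow> 'b \<Rightarrow> 'a" where
  "tangent_map B A f x =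
     frechet_derivative (snd (pref_chart A (f x)) \<circ> f \<circ> cinv (pref_chart B x))
       (at (snd (pref_chart B x) x))"

definition immersion ::
    "('n::topological_space, 'b::euclidean_space) chart set \<Rightarrow>
     ('m::topological_space, 'a::euclidean_space) chart set \<Rightarrow> ('n \<Rightarrow> 'm) \<Rightarrow> bool" where
  "immersion B A f \<longleftrightarrow> smooth_map B A f \<and> (\<forall>x. inj (tangent_map B A f x))"


section \<open>Tensor fields\<close>

definition vf_rep ::
    "('m, 'a::euclidean_space) chart set \<Rightarrow> ('m, 'a) chart \<Rightarrow> ('m \<Rightarrow> 'a) \<Rightarrow> 'a \<Rightarrow> 'a" where
  "vf_rep A c X y = chart_diff A c (cinv c y) (X (cinv c y))"

definition smooth_vf ::
    "('m, 'a::euclidean_space) chart set \<Rightarrow> 'm set \<Rightarrow> ('m \<Rightarrow> 'a) \<Rightarrow> bool" where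
  "smooth_vf A U X \<longleftrightarrow> (\<forall>c\<in>A. smooth_on (snd c ` (U \<inter> fst c)) (vf_rep A c X))"

definition lie_bracket ::
    "('m, 'a::euclidean_space) chart set \<Rightarrow> ('m \<Rightarrow> 'a) \<Rightarrow> ('m \<Rightarrow> 'a) \<Rightarrow> 'm \<Rightarrow> 'a" where
  "lie_bracket A X Y p =
     (let c = pref_chart A p
      in frechet_derivative (vf_rep A c Y) (at (snd c p)) (X p)
         - frechet_derivative (vf_rep A c X) (at (snd c p)) (Y p))"

definition smooth_endo ::
    "('m, 'a::euclidean_space) chart set \<Rightarrow> 'm set \<Rightarrow> ('m \<Rightarrow> 'a \<Rightarrow>\<^sub>L 'a) \<Rightarrow> bool" where
  "smooth_endo A U s \<longleftrightarrow> (\<forall>c\<in>A. \<forall>v.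
     smooth_on (snd c ` (U \<inter> fst c))
       (\<lambda>y. chart_diff A c (cinv c y) (s (cinv c y) (coord_vec A c v (cinv c y)))))"

definition nondegenerate_on :: "'a::real_vector set \<Rightarrow> ('a \<Rightarrow> 'a \<Rightarrow> real) \<Rightarrow> bool" where
  "nondegenerate_on W b \<longleftrightarrow> (\<forall>v\<in>W. (\<forall>w\<in>W. b v w = 0) \<longrightarrow> v = 0)"

definition form_index :: "('a::euclidean_space \<Rightarrow> 'a \<Rightarrow> real) \<Rightarrow> nat" where
  "form_index b = Max (dim ` {W. subspace W \<and> (\<forall>w\<in>W. w \<noteq> 0 \<longrightarrow> b w w < 0)})"

definition semi_riemannian_metric ::
    "('m, 'a::euclidean_space) chart set \<Rightarrow> ('m \<Rightarrow> 'a \<Rightarrow> 'a \<Rightarrow> real) \<Rightarrow> bool" where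
  "semi_riemannian_metric A g \<longleftrightarrow>
     (\<forall>p. bilinear (g p) \<and> (\<forall>u v. g p u v = g p v u) \<and> nondegenerate_on UNIV (g p)) \<and>
     (\<forall>u v. \<forall>c\<in>A. smooth_on (snd c ` fst c)
        (\<lambda>y. g (cinv c y) (coord_vec A c u (cinv c y)) (coord_vec A c v (cinv c y)))) \<and>
     (\<exists>k. \<forall>p. form_index (g p) = k)"


section \<open>The Levi-Civita connection\<close>

text \<open>\<open>nab Y p v\<close> is the derivative of \<open>Y\<close> at \<open>p\<close> in the direction \<open>v\<close>. The connection acts on
  vector fields that are smooth on an open set (the sheaf version), since the canonical bases
  below are only local sections.\<close>

definition affine_connection ::
    "('m::topological_space, 'a::euclidean_space) chart set \<Rightarrow>
     (('m \<Rightarrow> 'a) \<Rightarrow> 'm \<Rightarrow> 'a \<Rightarrow> 'a) \<Rightarrow> bool" where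
  "affine_connection A nab \<longleftrightarrow>
     (\<forall>U Y. open U \<and> smooth_vf A U Y \<longrightarrow>
        (\<forall>p\<in>U. linear (nab Y p)) \<and>
        (\<forall>X. smooth_vf A U X \<longrightarrow> smooth_vf A U (\<lambda>p. nab Y p (X p))) \<and>
        (\<forall>Z. smooth_vf A U Z \<and> (\<forall>q\<in>U. Y q = Z q) \<longrightarrow> (\<forall>p\<in>U. nab Y p = nab Z p)) \<and>
        (\<forall>Z. smooth_vf A U Z \<longrightarrow>
           (\<forall>p\<in>U. \<forall>v. nab (\<lambda>q. Y q + Z q) p v = nab Y p v + nab Z p v)) \<and>
        (\<forall>h. smooth_fun A U h \<longrightarrow>
           (\<forall>p\<in>U. \<forall>v. nab (\<lambda>q. h q *\<^sub>R Y q) p v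
                        = fun_diff A h p v *\<^sub>R Y p + h p *\<^sub>R nab Y p v)))"

definition levi_civita ::
    "('m::topological_space, 'a::euclidean_space) chart set \<Rightarrow> ('m \<Rightarrow> 'a \<Rightarrow> 'a \<Rightarrow> real) \<Rightarrow>
     (('m \<Rightarrow> 'a) \<Rightarrow> 'm \<Rightarrow> 'a \<Rightarrow> 'a) \<Rightarrow> bool" where
  "levi_civita A g nab \<longleftrightarrow> affine_connection A nab \<and>
     (\<forall>U X Y. open U \<and> smooth_vf A U X \<and> smooth_vf A U Y \<longrightarrow>
        (\<forall>p\<in>U. nab Y p (X p) - nab X p (Y p) = lie_bracket A X Y p) \<and>
        (\<forall>p\<in>U. \<forall>v. fun_diff A (\<lambda>q. g q (X q) (Y q)) p v
                      = g p (nab X p v) (Y p) + g p (X p) (nab Y p v)))"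

text \<open>\<open>L\<close> is the value at \<open>p\<close> of the induced derivative of the endomorphism field \<open>s\<close> in the
  direction \<open>v\<close>, i.e. the derivative of \<open>s Y\<close> minus \<open>s\<close> applied to the derivative of \<open>Y\<close>, for
  every vector field \<open>Y\<close> defined near \<open>p\<close>.\<close>

definition has_endo_deriv ::
    "('m::topological_space, 'a::euclidean_space) chart set \<Rightarrow>
     (('m \<Rightarrow> 'a) \<Rightarrow> 'm \<Rightarrow> 'a \<Rightarrow> 'a) \<Rightarrow> ('m \<Rightarrow> 'a \<Rightarrow>\<^sub>L 'a) \<Rightarrow> 'm \<Rightarrow> 'a \<Rightarrow> ('a \<Rightarrow>\<^sub>L 'a) \<Rightarrow> bool" where
  "has_endo_deriv A nab s p v L \<longleftrightarrow>
     (\<forall>V Y. open V \<and> p \<in> V \<and> smooth_vf A V Y \<longrightarrow>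
        L (Y p) = nab (\<lambda>q. s q (Y q)) p v - s p (nab Y p v))"

text \<open>The subbundle \<open>\<sigma>\<close> of the endomorphism bundle is given by its fibres; it is parallel if
  derivatives of its local sections are again sections.\<close>

definition parallel_subbundle ::
    "('m::topological_space, 'a::euclidean_space) chart set \<Rightarrow>
     (('m \<Rightarrow> 'a) \<Rightarrow> 'm \<Rightarrow> 'a \<Rightarrow> 'a) \<Rightarrow> ('m \<Rightarrow> ('a \<Rightarrow>\<^sub>L 'a) set) \<Rightarrow> bool" where
  "parallel_subbundle A nab \<sigma> \<longleftrightarrow>
     (\<forall>U s. open U \<and> smooth_endo A U s \<and> (\<forall>q\<in>U. s q \<in> \<sigma> q) \<longrightarrow>
        (\<forall>p\<in>U. \<forall>v. \<exists>L\<in>\<sigma> p. has_endo_deriv A nab s p v L))"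


section \<open>Paraquaternionic Kaehler manifolds\<close>

text \<open>Indices live in the type \<open>3\<close> of integers modulo 3, so that \<open>\<alpha> + 1\<close> and \<open>\<alpha> + 2\<close> are the
  cyclic successors (and \<open>3 = 0\<close>).\<close>

definition pq_sign :: "3 \<Rightarrow> real" where
  "pq_sign \<alpha> = (if \<alpha> = 1 then 1 else - 1)"

definition canonical_local_basis ::
    "('m::topological_space, 'a::euclidean_space) chart set \<Rightarrow> ('m \<Rightarrow> ('a \<Rightarrow>\<^sub>L 'a) set) \<Rightarrow>
     'm set \<Rightarrow> (3 \<Rightarrow> 'm \<Rightarrow> 'a \<Rightarrow>\<^sub>L 'a) \<Rightarrow> bool" where
  "canonical_local_basis A \<sigma> U J \<longleftrightarrow> open U \<and>
     (\<forall>\<alpha>. smooth_endo A U (J \<alpha>)) \<and>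
     (\<forall>p\<in>U. \<sigma> p = span (range (\<lambda>\<alpha>. J \<alpha> p)) \<and>
       (\<forall>\<alpha>. J \<alpha> p o\<^sub>L J \<alpha> p = - pq_sign \<alpha> *\<^sub>R id_blinfun \<and>
            J \<alpha> p o\<^sub>L J (\<alpha> + 1) p = pq_sign (\<alpha> + 2) *\<^sub>R J (\<alpha> + 2) p \<and>
            J (\<alpha> + 1) p o\<^sub>L J \<alpha> p = - (pq_sign (\<alpha> + 2) *\<^sub>R J (\<alpha> + 2) p)))"

text \<open>No condition on overlaps is needed: two canonical bases of the same fibre are
  related by a matrix in \<open>SO(2,1)\<close>, because the square of a linear combination is minus the
  identity times the quadratic form \<open>a\<^sub>1\<^sup>2 - a\<^sub>2\<^sup>2 - a\<^sub>3\<^sup>2\<close> of its coefficients, and because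
  \<open>J\<^sub>1 J\<^sub>2 J\<^sub>3 = - Id\<close> for each of them.\<close>

definition almost_paraquaternionic_structure ::
    "('m::topological_space, 'a::euclidean_space) chart set \<Rightarrow>
     ('m \<Rightarrow> ('a \<Rightarrow>\<^sub>L 'a) set) \<Rightarrow> bool" where
  "almost_paraquaternionic_structure A \<sigma> \<longleftrightarrow>
     (\<forall>p. subspace (\<sigma> p) \<and> dim (\<sigma> p) = 3) \<and>
     (\<forall>p. \<exists>c\<in>A. p \<in> fst c \<and> (\<exists>J. canonical_local_basis A \<sigma> (fst c) J))"

definition almost_paraquaternionic_hermitian ::
    "('m::topological_space, 'a::euclidean_space) chart set \<Rightarrow>
     ('m \<Rightarrow> ('a \<Rightarrow>\<^sub>L 'a) set) \<Rightarrow> ('m \<Rightarrow> 'a \<Rightarrow> 'a \<Rightarrow> real) \<Rightarrow> bool" where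
  "almost_paraquaternionic_hermitian A \<sigma> g \<longleftrightarrow>
     almost_paraquaternionic_structure A \<sigma> \<and> semi_riemannian_metric A g \<and>
     (\<forall>U J. canonical_local_basis A \<sigma> U J \<longrightarrow>
        (\<forall>p\<in>U. \<forall>\<alpha> u v. g p (J \<alpha> p u) (J \<alpha> p v) = pq_sign \<alpha> * g p u v))"

text \<open>The Levi-Civita connection is unique, so the existential quantifier only names it.\<close>

definition paraquaternionic_kaehler ::
    "('m::topological_space, 'a::euclidean_space) chart set \<Rightarrow>
     ('m \<Rightarrow> ('a \<Rightarrow>\<^sub>L 'a) set) \<Rightarrow> ('m \<Rightarrow> 'a \<Rightarrow> 'a \<Rightarrow> real) \<Rightarrow> bool" where
  "paraquaternionic_kaehler A \<sigma> g \<longleftrightarrow>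
     almost_paraquaternionic_hermitian A \<sigma> g \<and>
     (\<exists>nab. levi_civita A g nab \<and> parallel_subbundle A nab \<sigma>)"


section \<open>Distributions and integrability\<close>

definition distribution ::
    "('n::topological_space, 'b::euclidean_space) chart set \<Rightarrow> ('n \<Rightarrow> 'b set) \<Rightarrow> bool" where
  "distribution B D \<longleftrightarrow> (\<exists>k::nat.
     (\<forall>x. subspace (D x) \<and> dim (D x) = k) \<and>
     (\<forall>x. \<exists>U X. open U \<and> x \<in> U \<and> (\<forall>i<k. smooth_vf B U (X i)) \<and>
        (\<forall>y\<in>U. D y = span ((\<lambda>i. X i y) ` {..<k}))))"

text \<open>A chart in which \<open>S\<close> is the linear slice \<open>V\<close>; the tangent space of \<open>S\<close> at a point of the
  chart domain then consists of the vectors with components in \<open>V\<close>.\<close>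

definition slice_chart ::
    "('n, 'b::euclidean_space) chart set \<Rightarrow> 'n set \<Rightarrow> ('n, 'b) chart \<Rightarrow> 'b set \<Rightarrow> bool" where
  "slice_chart B S c V \<longleftrightarrow>
     c \<in> B \<and> subspace V \<and> snd c ` (S \<inter> fst c) = snd c ` fst c \<inter> V"

definition integral_manifold ::
    "('n, 'b::euclidean_space) chart set \<Rightarrow> ('n \<Rightarrow> 'b set) \<Rightarrow> 'n set \<Rightarrow> bool" where
  "integral_manifold B E S \<longleftrightarrow>
     (\<forall>q\<in>S. \<exists>c V. slice_chart B S c V \<and> q \<in> fst c \<and> E q = {v. chart_diff B c q v \<in> V})"

text \<open>Embedded integral manifolds suffice: an immersed one is locally embedded.\<close>

definition integrable_distribution ::
    "('n::topological_space, 'b::euclidean_space) chart set \<Rightarrow> ('n \<Rightarrow> 'b set) \<Rightarrow> bool" where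
  "integrable_distribution B E \<longleftrightarrow>
     distribution B E \<and> (\<forall>x. \<exists>S. x \<in> S \<and> integral_manifold B E S)"


section \<open>Paraquaternionic CR-submanifolds\<close>

text \<open>A submanifold of the manifold with atlas \<open>A\<close> is a manifold with atlas \<open>B\<close> and an immersion
  \<open>f\<close>, which for a subset is the inclusion. Tangent vectors of the submanifold are identified
  with their images under the tangent map of \<open>f\<close>.\<close>

definition induced_metric ::
    "('n, 'b::euclidean_space) chart set \<Rightarrow> ('m, 'a::euclidean_space) chart set \<Rightarrow> ('n \<Rightarrow> 'm) \<Rightarrow>
     ('m \<Rightarrow> 'a \<Rightarrow> 'a \<Rightarrow> real) \<Rightarrow> 'n \<Rightarrow> 'b \<Rightarrow> 'b \<Rightarrow> real" where
  "induced_metric B A f g x u v = g (f x) (tangent_map B A f x u) (tangent_map B A f x v)"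

definition normal_space ::
    "('n, 'b::euclidean_space) chart set \<Rightarrow> ('m, 'a::euclidean_space) chart set \<Rightarrow> ('n \<Rightarrow> 'm) \<Rightarrow>
     ('m \<Rightarrow> 'a \<Rightarrow> 'a \<Rightarrow> real) \<Rightarrow> 'n \<Rightarrow> 'a set" where
  "normal_space B A f g x = {w. \<forall>u. g (f x) w (tangent_map B A f x u) = 0}"

definition nondegenerate_submanifold ::
    "('n::topological_space, 'b::euclidean_space) chart set \<Rightarrow>
     ('m::topological_space, 'a::euclidean_space) chart set \<Rightarrow> ('n \<Rightarrow> 'm) \<Rightarrow>
     ('m \<Rightarrow> 'a \<Rightarrow> 'a \<Rightarrow> real) \<Rightarrow> bool" where
  "nondegenerate_submanifold B A f g \<longleftrightarrow>
     immersion B A f \<and> (\<forall>x. nondegenerate_on UNIV (induced_metric B A f g x))"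

definition orth_distribution ::
    "('n \<Rightarrow> 'b \<Rightarrow> 'b \<Rightarrow> real) \<Rightarrow> ('n \<Rightarrow> 'b set) \<Rightarrow> 'n \<Rightarrow> 'b set" where
  "orth_distribution h D x = {v. \<forall>w\<in>D x. h x v w = 0}"

definition paraquaternionic_CR_submanifold ::
    "('n::topological_space, 'b::euclidean_space) chart set \<Rightarrow>
     ('m::topological_space, 'a::euclidean_space) chart set \<Rightarrow> ('n \<Rightarrow> 'm) \<Rightarrow>
     ('m \<Rightarrow> ('a \<Rightarrow>\<^sub>L 'a) set) \<Rightarrow> ('m \<Rightarrow> 'a \<Rightarrow> 'a \<Rightarrow> real) \<Rightarrow> ('n \<Rightarrow> 'b set) \<Rightarrow> bool" where
  "paraquaternionic_CR_submanifold B A f \<sigma> g D \<longleftrightarrow>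
     nondegenerate_submanifold B A f g \<and> distribution B D \<and>
     (\<forall>x. nondegenerate_on (D x) (induced_metric B A f g x)) \<and>
     (\<forall>U J. canonical_local_basis A \<sigma> U J \<longrightarrow> (\<forall>x. f x \<in> U \<longrightarrow> (\<forall>\<alpha>.
        J \<alpha> (f x) ` tangent_map B A f x ` D x = tangent_map B A f x ` D x \<and>
        J \<alpha> (f x) ` tangent_map B A f x ` orth_distribution (induced_metric B A f g) D x
          \<subseteq> normal_space B A f g x)))"

end

(* The fundamental forms g(u, J v), J in a canonical local basis of sigma, have exterior derivatives
   g(u, (nabla_w J) v) + cyclic permutations, and nabla_w J is again a section of sigma because
   sigma is parallel. Along N the orthogonal complement E of D is exactly the kernel of the
   pull-back theta of each such form, and d theta vanishes as soon as two arguments lie in E, since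
   sigma maps E into the normal bundle. Hence theta([Y,Z], W) = 0 for sections Y, Z of E, so E is
   involutive. Near a point, E is the graph of a map K -> D_x over K = E_x, and the vector fields in
   E with constant K-component commute. Commutation is the integrability condition of the total
   differential equation of the leaf, whose solution is integrated along rays; the leaf is thus a
   graph over K, which is straightened by an explicit chart. *)
theory Submission
  imports Defs
begin

section \<open>Calculus of smooth maps\<close>

text \<open>The fundamental forms of a paraquaternionic Kaehler manifold are in general not closed,
  so the classical argument from a closed Kaehler form does not apply as it stands. What survives:
  in the cyclic sum for the differential every term pairs two of the three arguments through an
  element of \<open>\<sigma>\<close>. If two arguments lie in E, each pairing contains a vector of
  E, and such pairings vanish on tangent vectors of N. The frame commutes because the bracket of two
  of its fields lies in E and has as K-component a derivative of constants, that is 0; in a graph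
  over K only the zero vector has K-component 0. The metric is indefinite, so the splitting of TN
  into D and E and the constant rank of E rest on non-degeneracy on D. Tangent vectors are encoded
  by components in a preferred chart that may jump from point to point; derivatives are therefore
  taken in one fixed chart, and the preferred chart of a point serves where only that point matters,
  since there vectors and components agree.\<close>

lemma Ck_on_SucD: "Ck_on (Suc k) S f \<Longrightarrow> Ck_on k S f"
proof (induction k arbitrary: f)
  case 0
  then show ?case
    by (auto intro!: continuous_at_imp_continuous_on differentiable_imp_continuous_within)
next
  case (Suc k)
  then show ?case
    using Ck_on.simps(2) by blast
qed

lemma Ck_on_imp_continuous_on: "Ck_on k S f \<Longrightarrow> continuous_on S f"
  by (induction k) (auto dest: Ck_on_SucD simp del: Ck_on.simps(2))

lemma Ck_on_subset: "Ck_on k S f \<Longrightarrow> T \<subseteq> S \<Longrightarrow> Ck_on k T f"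
  by (induction k arbitrary: f) (auto intro: continuous_on_subset)

lemma frechet_derivative_eqI:
  "(f has_derivative f') (at x) \<Longrightarrow> frechet_derivative f (at x) = f'"
  using frechet_derivative_at[symmetric] .

lemma Ck_on_cong:
  assumes "open S" "\<And>x. x \<in> S \<Longrightarrow> f x = g x" "Ck_on k S g"
  shows "Ck_on k S f"
  using assms(2,3)
proof (induction k arbitrary: f g)
  case 0
  then show ?case using continuous_on_cong by (metis Ck_on.simps(1))
next
  case (Suc k)
  have *: "(f has_derivative frechet_derivative g (at x)) (at x)" if "x \<in> S" for x
    using Suc.prems frechet_derivative_works[of g "at x"] that assms(1)
      has_derivative_transform_within_open[of g _ x UNIV S f] by auto
  moreover have "Ck_on k S (\<lambda>x. frechet_derivative f (at x) v)" for v
    by (rule Suc.IH[where g = "\<lambda>x. frechet_derivative g (at x) v"])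
      (use Suc.prems in \<open>simp_all add: frechet_derivative_eqI[OF *]\<close>)
  ultimately show ?case by (auto simp: differentiable_def)
qed

text \<open>Lets an explicit derivative formula replace the one selected by
  \<open>frechet_derivative\<close>; all inductions on the order of differentiability go through
  this rule.\<close>

lemma Ck_onI:
  assumes "open S" "\<And>x. x \<in> S \<Longrightarrow> (f has_derivative f' x) (at x)"
    and "\<And>v. Ck_on k S (\<lambda>x. f' x v)"
  shows "Ck_on (Suc k) S f"
proof -
  have "Ck_on k S (\<lambda>x. frechet_derivative f (at x) v)" for v
    by (rule Ck_on_cong[OF assms(1) _ assms(3)]) (simp add: frechet_derivative_eqI[OF assms(2)])
  then show ?thesis
    using assms(2) by (auto simp: differentiable_def)
qed

lemma Ck_onD:
  assumes "Ck_on (Suc k) S f" "x \<in> S"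
  shows "(f has_derivative frechet_derivative f (at x)) (at x)"
  using assms frechet_derivative_works by auto

lemma Ck_on_const: "Ck_on k S (\<lambda>x. c)"
  by (induction k arbitrary: c) (auto simp: frechet_derivative_const)

lemma Ck_on_bounded_linear:
  assumes "bounded_linear h" "open S" "Ck_on k S f"
  shows "Ck_on k S (\<lambda>x. h (f x))"
  using assms(3)
proof (induction k arbitrary: f)
  case 0
  then show ?case
    using bounded_linear.continuous_on[OF assms(1)] by auto
next
  case (Suc k)
  show ?case
  proof (rule Ck_onI[where f' = "\<lambda>x v. h (frechet_derivative f (at x) v)"])
    show "((\<lambda>x. h (f x)) has_derivative (\<lambda>v. h (frechet_derivative f (at x) v))) (at x)"
      if "x \<in> S" for x
      using bounded_linear.has_derivative[OF assms(1) Ck_onD[OF Suc.prems that]] .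
  qed (use Suc assms(2) in auto)
qed

lemma Ck_on_id: "open S \<Longrightarrow> Ck_on k S (\<lambda>x. x)"
  by (cases k) (auto intro!: Ck_onI[where f' = "\<lambda>x v. v"] Ck_on_const)

lemma Ck_on_add:
  assumes "open S" "Ck_on k S f" "Ck_on k S g"
  shows "Ck_on k S (\<lambda>x. f x + g x)"
  using assms(2,3)
proof (induction k arbitrary: f g)
  case 0
  then show ?case by (auto intro: continuous_on_add)
next
  case (Suc k)
  show ?case
  proof (rule Ck_onI[where f' = "\<lambda>x v. frechet_derivative f (at x) v + frechet_derivative g (at x) v"])
    show "((\<lambda>x. f x + g x) has_derivative
        (\<lambda>v. frechet_derivative f (at x) v + frechet_derivative g (at x) v)) (at x)"
      if "x \<in> S" for x
      using has_derivative_add[OF Ck_onD[OF Suc.prems(1) that] Ck_onD[OF Suc.prems(2) that]] .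
  qed (use Suc assms(1) in auto)
qed

lemma Ck_on_sum:
  assumes "open S" "\<And>i. i \<in> I \<Longrightarrow> Ck_on k S (f i)"
  shows "Ck_on k S (\<lambda>x. \<Sum>i\<in>I. f i x)"
  using assms(2)
  by (induction I rule: infinite_finite_induct) (auto intro!: Ck_on_const Ck_on_add assms(1))

lemma Ck_on_bilinear:
  assumes h: "bounded_bilinear h" and S: "open S" and "Ck_on k S f" "Ck_on k S g"
  shows "Ck_on k S (\<lambda>x. h (f x) (g x))"
  using assms(3,4)
proof (induction k arbitrary: f g)
  case 0
  then show ?case
    using bounded_bilinear.continuous_on[OF h] by auto
next
  case (Suc k)
  let ?d = "\<lambda>x v. h (f x) (frechet_derivative g (at x) v) + h (frechet_derivative f (at x) v) (g x)"
  show ?case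
  proof (rule Ck_onI[where f' = ?d])
    show "((\<lambda>x. h (f x) (g x)) has_derivative ?d x) (at x)" if "x \<in> S" for x
      using bounded_bilinear.FDERIV[OF h Ck_onD[OF Suc.prems(1) that] Ck_onD[OF Suc.prems(2) that]] .
    show "Ck_on k S (\<lambda>x. ?d x v)" for v
      using Suc.prems Ck_on_SucD[OF Suc.prems(1)] Ck_on_SucD[OF Suc.prems(2)]
      by (auto intro!: Ck_on_add S Suc.IH)
  qed (fact S)
qed

text \<open>\<open>Ck_on\<close> controls derivatives in fixed directions only, while the chain rule
  applies the derivative of \<open>g\<close> to a direction that varies with the point. Expanding
  that direction in the basis yields a finite sum of products, to which the induction hypothesis and
  the product rule apply.\<close>

lemma Ck_on_compose:
  fixes f :: "'a::euclidean_space \<Rightarrow> 'b::euclidean_space"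
  assumes S: "open S" and T: "open T" and "f ` S \<subseteq> T" "Ck_on k S f" "Ck_on k T g"
  shows "Ck_on k S (\<lambda>x. g (f x))"
  using assms(4,5)
proof (induction k arbitrary: g)
  case 0
  then show ?case
    using assms(3) by (auto intro: continuous_on_compose2)
next
  case (Suc k)
  let ?d = "\<lambda>x v. \<Sum>b\<in>Basis. (frechet_derivative f (at x) v \<bullet> b) *\<^sub>R frechet_derivative g (at (f x)) b"
  show ?case
  proof (rule Ck_onI[where f' = ?d])
    fix x assume x: "x \<in> S"
    have g: "(g has_derivative frechet_derivative g (at (f x))) (at (f x))"
      using Ck_onD[OF Suc.prems(2)] x assms(3) by blast
    have "frechet_derivative g (at (f x)) (frechet_derivative f (at x) v) = ?d x v" for v
    proof -
      interpret linear "frechet_derivative g (at (f x))"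
        using g has_derivative_linear by blast
      have "frechet_derivative g (at (f x)) (\<Sum>b\<in>Basis. (frechet_derivative f (at x) v \<bullet> b) *\<^sub>R b) = ?d x v"
        by (simp only: sum scaleR)
      then show ?thesis by (simp add: euclidean_representation)
    qed
    then show "((\<lambda>x. g (f x)) has_derivative ?d x) (at x)"
      using has_derivative_compose[OF Ck_onD[OF Suc.prems(1) x] g] by simp
  next
    fix v
    have *: "Ck_on k S f" using Suc.prems(1) Ck_on_SucD by blast
    have "Ck_on k S (\<lambda>x. frechet_derivative g (at (f x)) b)" for b
      using Suc.IH[OF *, of "\<lambda>y. frechet_derivative g (at y) b"] Suc.prems(2) by simp
    moreover have "Ck_on k S (\<lambda>x. frechet_derivative f (at x) v \<bullet> b)" for b
      using Ck_on_bounded_linear[OF bounded_linear_inner_left S] Suc.prems(1) by force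
    ultimately show "Ck_on k S (\<lambda>x. ?d x v)"
      by (intro Ck_on_sum S Ck_on_bilinear[OF bounded_bilinear_scaleR])
  qed (fact S)
qed

lemma smooth_on_imp_continuous_on: "smooth_on S f \<Longrightarrow> continuous_on S f"
  by (auto simp: smooth_on_def intro: Ck_on_imp_continuous_on)

lemma smooth_on_subset: "smooth_on S f \<Longrightarrow> T \<subseteq> S \<Longrightarrow> smooth_on T f"
  by (auto simp: smooth_on_def intro: Ck_on_subset)

lemma smooth_on_cong:
  "open S \<Longrightarrow> (\<And>x. x \<in> S \<Longrightarrow> f x = g x) \<Longrightarrow> smooth_on S g \<Longrightarrow> smooth_on S f"
  unfolding smooth_on_def using Ck_on_cong by blast

lemma smooth_on_has_derivative:
  "smooth_on S f \<Longrightarrow> x \<in> S \<Longrightarrow> (f has_derivative frechet_derivative f (at x)) (at x)"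
  unfolding smooth_on_def using Ck_onD by blast

lemma smooth_on_differentiable: "smooth_on S f \<Longrightarrow> x \<in> S \<Longrightarrow> f differentiable at x"
  using smooth_on_has_derivative by (auto simp: differentiable_def)

lemma smooth_on_frechet_derivative:
  "smooth_on S f \<Longrightarrow> smooth_on S (\<lambda>x. frechet_derivative f (at x) v)"
  unfolding smooth_on_def using Ck_on.simps(2) by blast

lemma smooth_on_const: "smooth_on S (\<lambda>x. c)"
  by (simp add: smooth_on_def Ck_on_const)

lemma smooth_on_id: "open S \<Longrightarrow> smooth_on S (\<lambda>x. x)"
  by (simp add: smooth_on_def Ck_on_id)

lemma smooth_on_bounded_linear:
  "bounded_linear h \<Longrightarrow> open S \<Longrightarrow> smooth_on S f \<Longrightarrow> smooth_on S (\<lambda>x. h (f x))"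
  by (simp add: smooth_on_def Ck_on_bounded_linear)

lemma smooth_on_linear:
  fixes h :: "'b::euclidean_space \<Rightarrow> 'c::real_normed_vector"
  shows "linear h \<Longrightarrow> open S \<Longrightarrow> smooth_on S f \<Longrightarrow> smooth_on S (\<lambda>x. h (f x))"
  by (simp add: smooth_on_bounded_linear linear_conv_bounded_linear)

lemma smooth_on_add:
  "open S \<Longrightarrow> smooth_on S f \<Longrightarrow> smooth_on S g \<Longrightarrow> smooth_on S (\<lambda>x. f x + g x)"
  by (simp add: smooth_on_def Ck_on_add)

lemma smooth_on_diff:
  assumes "open S" "smooth_on S f" "smooth_on S g"
  shows "smooth_on S (\<lambda>x. f x - g x)"
  using smooth_on_add[OF assms(1,2) smooth_on_bounded_linear[OF bounded_linear_minus[OF bounded_linear_ident] assms(1,3)]]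
  by simp

lemma smooth_on_sum:
  "open S \<Longrightarrow> (\<And>i. i \<in> I \<Longrightarrow> smooth_on S (f i)) \<Longrightarrow> smooth_on S (\<lambda>x. \<Sum>i\<in>I. f i x)"
  by (simp add: smooth_on_def Ck_on_sum)

lemma smooth_on_bilinear:
  "bounded_bilinear h \<Longrightarrow> open S \<Longrightarrow> smooth_on S f \<Longrightarrow> smooth_on S g \<Longrightarrow>
    smooth_on S (\<lambda>x. h (f x) (g x))"
  by (simp add: smooth_on_def Ck_on_bilinear)

lemmas smooth_on_scaleR = smooth_on_bilinear[OF bounded_bilinear_scaleR]
  and smooth_on_blinfun_apply = smooth_on_bilinear[OF bounded_bilinear_blinfun_apply]
  and smooth_on_inner = smooth_on_bilinear[OF bounded_bilinear_inner]

lemma smooth_on_compose: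
  fixes f :: "'a::euclidean_space \<Rightarrow> 'b::euclidean_space"
  shows "open S \<Longrightarrow> open T \<Longrightarrow> f ` S \<subseteq> T \<Longrightarrow> smooth_on S f \<Longrightarrow> smooth_on T g \<Longrightarrow>
    smooth_on S (\<lambda>x. g (f x))"
  unfolding smooth_on_def using Ck_on_compose by blast

section \<open>Operator-valued maps and their inverses\<close>

text \<open>In finite dimension an operator is a finite sum of rank-one operators whose coefficients
  are its values on the basis. Pointwise smoothness thus becomes smoothness of the operator itself,
  so that product rules and inversion are available for derivatives and forms.\<close>

lemma smooth_on_linear_fields:
  fixes M :: "'z::euclidean_space \<Rightarrow> 'a::euclidean_space \<Rightarrow> 'c::real_normed_vector"
  assumes "open S" "\<And>z. z \<in> S \<Longrightarrow> linear (M z)" "\<And>v. smooth_on S (\<lambda>z. M z v)"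
  shows "smooth_on S (\<lambda>z. Blinfun (M z))"
proof (rule smooth_on_cong[OF assms(1)])
  show "Blinfun (M z) = (\<Sum>b\<in>Basis. blinfun_scaleR_left (M z b) o\<^sub>L blinfun_inner_left b)"
    if "z \<in> S" for z
  proof (rule blinfun_eqI)
    interpret linear "M z" using assms(2) that .
    fix v
    have "M z v = M z (\<Sum>b\<in>Basis. (v \<bullet> b) *\<^sub>R b)" by (simp add: euclidean_representation)
    also have "\<dots> = (\<Sum>b\<in>Basis. (v \<bullet> b) *\<^sub>R M z b)" by (simp only: sum scaleR)
    finally show "Blinfun (M z) v =
        (\<Sum>b\<in>Basis. blinfun_scaleR_left (M z b) o\<^sub>L blinfun_inner_left b) v"
      using assms(2)[OF that]
      by (simp add: bounded_linear_Blinfun_apply linear_conv_bounded_linear blinfun.sum_left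
          blinfun_inner_left.rep_eq inner_commute)
  qed
  show "smooth_on S (\<lambda>z. \<Sum>b\<in>Basis. blinfun_scaleR_left (M z b) o\<^sub>L blinfun_inner_left b)"
    by (intro smooth_on_sum smooth_on_bilinear[OF bounded_bilinear_blinfun_compose]
        smooth_on_const smooth_on_bounded_linear[OF bounded_linear_blinfun_scaleR_left] assms)
qed

lemma smooth_on_blinfun_derivative:
  fixes f :: "'a::euclidean_space \<Rightarrow> 'b::real_normed_vector"
  assumes "open S" "smooth_on S f"
  shows "smooth_on S (\<lambda>x. Blinfun (frechet_derivative f (at x)))"
  by (intro smooth_on_linear_fields assms smooth_on_frechet_derivative linear_frechet_derivative
      smooth_on_differentiable[OF assms(2)])

lemma blinfun_apply_Blinfun_derivative:
  fixes f :: "'a::euclidean_space \<Rightarrow> 'b::real_normed_vector"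
  assumes "f differentiable at x"
  shows "blinfun_apply (Blinfun (frechet_derivative f (at x))) = frechet_derivative f (at x)"
  using linear_frechet_derivative[OF assms]
  by (simp add: bounded_linear_Blinfun_apply linear_conv_bounded_linear)

text \<open>Bootstrapping: if \<open>s\<close> is of class C^k, so is its derivative
  \<open>\<Psi> (s x)\<close>, hence \<open>s\<close> is of class C^(k+1).\<close>

lemma smooth_on_solution:
  fixes s :: "'a::euclidean_space \<Rightarrow> 'b::euclidean_space"
  assumes "open T" "open S" "s ` T \<subseteq> S" "smooth_on S \<Psi>"
    and "\<And>x. x \<in> T \<Longrightarrow> (s has_derivative blinfun_apply (\<Psi> (s x))) (at x)"
  shows "smooth_on T s"
  unfolding smooth_on_def
proof
  show "Ck_on k T s" for k
  proof (induction k)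
    case 0
    show ?case
      using has_derivative_continuous[OF assms(5)]
      by (simp add: continuous_at_imp_continuous_on)
  next
    case (Suc k)
    show ?case
    proof (rule Ck_onI[OF assms(1,5)])
      have "Ck_on k T (\<lambda>x. \<Psi> (s x))"
        by (rule Ck_on_compose[OF assms(1-3) Suc]) (use assms(4) in \<open>simp add: smooth_on_def\<close>)
      then show "Ck_on k T (\<lambda>x. blinfun_apply (\<Psi> (s x)) v)" for v
        by (rule Ck_on_bilinear[OF bounded_bilinear_blinfun_apply assms(1) _ Ck_on_const])
    qed
  qed
qed

text \<open>The resolvent identity, the source of both continuity and differentiability of inversion
  below.\<close>

lemma blinfun_inverse_diff:
  fixes A :: "'z \<Rightarrow> 'b::real_normed_vector \<Rightarrow>\<^sub>L 'b"
  assumes "A y o\<^sub>L \<Phi> y = id_blinfun" "\<Phi> y o\<^sub>L A y = id_blinfun"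
    and "A x o\<^sub>L \<Phi> x = id_blinfun" "\<Phi> x o\<^sub>L A x = id_blinfun"
  shows "\<Phi> y - \<Phi> x = \<Phi> y o\<^sub>L (A x - A y) o\<^sub>L \<Phi> x"
proof (rule blinfun_eqI)
  fix v
  have "A x (\<Phi> x v) = v" "\<Phi> y (A y (\<Phi> x v)) = \<Phi> x v"
    using assms by (metis blinfun_apply_blinfun_compose blinfun_apply_id_blinfun)+
  then show "(\<Phi> y - \<Phi> x) v = (\<Phi> y o\<^sub>L (A x - A y) o\<^sub>L \<Phi> x) v"
    by (simp add: blinfun.bilinear_simps)
qed

text \<open>\<open>\<Phi>\<close> is given as a pointwise inverse with no regularity. The resolvent
  identity gives continuity, then the derivative \<open>- \<Phi> A' \<Phi>\<close>. This expression
  has the same order of differentiability as \<open>\<Phi>\<close>, because \<open>A\<close> is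
  smooth, so the order rises by induction.\<close>

lemma smooth_on_blinfun_inverse:
  fixes A :: "'z::euclidean_space \<Rightarrow> 'b::euclidean_space \<Rightarrow>\<^sub>L 'b"
  assumes S: "open S" and A: "smooth_on S A"
    and inv: "\<And>y. y \<in> S \<Longrightarrow> A y o\<^sub>L \<Phi> y = id_blinfun" "\<And>y. y \<in> S \<Longrightarrow> \<Phi> y o\<^sub>L A y = id_blinfun"
  shows "smooth_on S \<Phi>"
proof -
  have diff: "\<Phi> y - \<Phi> x = \<Phi> y o\<^sub>L (A x - A y) o\<^sub>L \<Phi> x" if "x \<in> S" "y \<in> S" for x y
    using that by (intro blinfun_inverse_diff inv)
  have cont: "isCont \<Phi> x" if x: "x \<in> S" for x
  proof -
    have "isCont A x"
      using smooth_on_imp_continuous_on[OF A] S x continuous_on_eq_continuous_at by blast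
    then have lim: "((\<lambda>y. norm (A x - A y) * norm (\<Phi> x)) \<longlongrightarrow> norm (A x - A x) * norm (\<Phi> x)) (at x)"
      unfolding isCont_def by (intro tendsto_intros)
    have ev: "eventually (\<lambda>y. norm (A x - A y) * norm (\<Phi> x) < 1/2) (at x)"
      using order_tendstoD(2)[OF lim, of "1/2"] by simp
    have evS: "eventually (\<lambda>y. y \<in> S) (at x)"
      using S x by (simp add: eventually_at_in_open')
    \<comment> \<open>The resolvent bound has \<open>norm (\<Phi> y)\<close> on its right side. Once
      the remaining factor is below 1/2, that term is absorbed and gives
      \<open>norm (\<Phi> y) \<le> 2 * norm (\<Phi> x)\<close>, which makes the bound tend to
      0.\<close>
    have "eventually (\<lambda>y. norm (\<Phi> y - \<Phi> x) \<le> 2 * norm (\<Phi> x) * (norm (A x - A y) * norm (\<Phi> x))) (at x)"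
      using ev evS
    proof eventually_elim
      case (elim y)
      have le: "norm (\<Phi> y - \<Phi> x) \<le> norm (\<Phi> y) * (norm (A x - A y) * norm (\<Phi> x))"
        unfolding diff[OF x elim(2)] mult.assoc[symmetric]
        by (rule order_trans[OF norm_blinfun_compose]) (simp add: mult_right_mono norm_blinfun_compose)
      also have "\<dots> \<le> norm (\<Phi> y) * (1/2)"
        using elim by (intro mult_left_mono) auto
      finally have "norm (\<Phi> y) \<le> norm (\<Phi> x) + norm (\<Phi> y) / 2"
        using norm_triangle_ineq[of "\<Phi> x" "\<Phi> y - \<Phi> x"] by simp
      then have "norm (\<Phi> y) \<le> 2 * norm (\<Phi> x)" by simp
      with le show ?case
        by (elim order_trans) (simp add: mult_right_mono)
    qed
    moreover have "((\<lambda>y. 2 * norm (\<Phi> x) * (norm (A x - A y) * norm (\<Phi> x))) \<longlongrightarrow> 0) (at x)"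
      using tendsto_mult_left[OF lim, of "2 * norm (\<Phi> x)"] by simp
    ultimately have "((\<lambda>y. \<Phi> y - \<Phi> x) \<longlongrightarrow> 0) (at x)"
      by (rule Lim_null_comparison)
    then show ?thesis by (simp add: isCont_def LIM_zero_iff)
  qed
  have deriv: "(\<Phi> has_derivative (\<lambda>v. - (\<Phi> x o\<^sub>L frechet_derivative A (at x) v o\<^sub>L \<Phi> x))) (at x)"
    if x: "x \<in> S" for x
  proof -
    have Ad: "(A has_derivative frechet_derivative A (at x)) (at x)"
      by (rule smooth_on_has_derivative[OF A x])
    have lim: "((\<lambda>y. (1 / norm (y - x)) *\<^sub>R (A y - (A x + frechet_derivative A (at x) (y - x)))) \<longlongrightarrow> 0) (at x)"
      using Ad unfolding has_derivative_within by (simp add: diff_diff_eq)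
    have Abl: "bounded_linear (frechet_derivative A (at x))"
      using Ad has_derivative_bounded_linear by blast
    then obtain K where K: "\<And>v. norm (frechet_derivative A (at x) v) \<le> norm v * K"
      using bounded_linear.bounded by blast
    let ?R = "\<lambda>y. (1 / norm (y - x)) *\<^sub>R (A y - (A x + frechet_derivative A (at x) (y - x)))"
    \<comment> \<open>The remainder quotient of \<open>\<Phi>\<close>, rewritten with the resolvent
      identity and \<open>A y - A x\<close> split into its linear part and the remainder
      \<open>?R\<close>. The first summand is small because \<open>?R\<close> is, the second because
      \<open>\<Phi>\<close> is continuous and the normalized linear part is bounded.\<close>
    let ?e = "\<lambda>y. - (\<Phi> y o\<^sub>L ?R y o\<^sub>L \<Phi> x)
       - ((\<Phi> y - \<Phi> x) o\<^sub>L (1 / norm (y - x)) *\<^sub>R frechet_derivative A (at x) (y - x) o\<^sub>L \<Phi> x)"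
    have lim\<Phi>: "(\<Phi> \<longlongrightarrow> \<Phi> x) (at x)" using cont[OF x] by (simp add: isCont_def)
    have 1: "((\<lambda>y. - (\<Phi> y o\<^sub>L ?R y o\<^sub>L \<Phi> x)) \<longlongrightarrow> 0) (at x)"
      using tendsto_minus[OF bounded_bilinear.tendsto[OF bounded_bilinear_blinfun_compose
          bounded_bilinear.tendsto[OF bounded_bilinear_blinfun_compose lim\<Phi> lim] tendsto_const[of "\<Phi> x"]]]
      by simp
    have 2: "((\<lambda>y. ((\<Phi> y - \<Phi> x) o\<^sub>L (1 / norm (y - x)) *\<^sub>R frechet_derivative A (at x) (y - x) o\<^sub>L \<Phi> x)) \<longlongrightarrow> 0) (at x)"
    proof (rule Lim_null_comparison)
      show "\<forall>\<^sub>F y in at x. norm ((\<Phi> y - \<Phi> x) o\<^sub>L (1 / norm (y - x)) *\<^sub>R frechet_derivative A (at x) (y - x) o\<^sub>L \<Phi> x)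
           \<le> norm (\<Phi> y - \<Phi> x) * K * norm (\<Phi> x)"
        unfolding eventually_at_filter
      proof (rule always_eventually, intro allI impI)
        fix y assume "y \<noteq> x"
        then have "norm ((1 / norm (y - x)) *\<^sub>R frechet_derivative A (at x) (y - x)) \<le> K"
          using K[of "y - x"] by (simp add: field_simps)
        then show "norm ((\<Phi> y - \<Phi> x) o\<^sub>L (1 / norm (y - x)) *\<^sub>R frechet_derivative A (at x) (y - x) o\<^sub>L \<Phi> x)
           \<le> norm (\<Phi> y - \<Phi> x) * K * norm (\<Phi> x)"
          by (intro order_trans[OF norm_blinfun_compose] mult_right_mono norm_ge_zero mult_left_mono)
      qed
      show "((\<lambda>y. norm (\<Phi> y - \<Phi> x) * K * norm (\<Phi> x)) \<longlongrightarrow> 0) (at x)"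
        using tendsto_mult_right[OF tendsto_mult_right[OF tendsto_norm_zero[OF LIM_zero[OF lim\<Phi>]], of K], of "norm (\<Phi> x)"]
        by simp
    qed
    have "(?e \<longlongrightarrow> 0) (at x)"
      using tendsto_diff[OF 1 2] by simp
    moreover have "eventually (\<lambda>y. ?e y = (1 / norm (y - x)) *\<^sub>R
        (\<Phi> y - (\<Phi> x + - (\<Phi> x o\<^sub>L frechet_derivative A (at x) (y - x) o\<^sub>L \<Phi> x)))) (at x)"
      using eventually_at_in_open'[OF S x]
    proof eventually_elim
      case (elim y)
      have "\<Phi> y v = \<Phi> x v + \<Phi> y (A x (\<Phi> x v)) - \<Phi> y (A y (\<Phi> x v))" for v
        using arg_cong[OF diff[OF x elim], of "\<lambda>F. blinfun_apply F v"]
        by (simp add: blinfun.bilinear_simps algebra_simps)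
      note eq = arg_cong[OF this, of "\<lambda>u. (1 / norm (y - x)) *\<^sub>R u"]
      show ?case
      proof (rule blinfun_eqI)
        show "blinfun_apply (?e y) i = blinfun_apply ((1 / norm (y - x)) *\<^sub>R
            (\<Phi> y - (\<Phi> x + - (\<Phi> x o\<^sub>L frechet_derivative A (at x) (y - x) o\<^sub>L \<Phi> x)))) i" for i
          using eq[of i] by (simp add: blinfun.bilinear_simps algebra_simps)
      qed
    qed
    ultimately have "((\<lambda>y. (1 / norm (y - x)) *\<^sub>R
        (\<Phi> y - (\<Phi> x + - (\<Phi> x o\<^sub>L frechet_derivative A (at x) (y - x) o\<^sub>L \<Phi> x)))) \<longlongrightarrow> 0) (at x)"
      using tendsto_cong by force
    moreover have "bounded_linear (\<lambda>v. - (\<Phi> x o\<^sub>L frechet_derivative A (at x) v o\<^sub>L \<Phi> x))"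
      by (intro bounded_linear_minus
          bounded_linear_compose[OF bounded_bilinear.bounded_linear_left[OF bounded_bilinear_blinfun_compose]]
          bounded_linear_compose[OF bounded_bilinear.bounded_linear_right[OF bounded_bilinear_blinfun_compose]] Abl)
    ultimately show ?thesis
      unfolding has_derivative_within by (simp add: diff_diff_eq)
  qed
  show ?thesis
    unfolding smooth_on_def
  proof
    show "Ck_on k S \<Phi>" for k
    proof (induction k)
      case 0
      then show ?case by (simp add: cont continuous_at_imp_continuous_on)
    next
      case (Suc k)
      show ?case
      proof (rule Ck_onI[OF S deriv])
        fix v
        have "Ck_on k S (\<lambda>x. frechet_derivative A (at x) v)"
          using smooth_on_frechet_derivative[OF A] by (simp add: smooth_on_def)
        then show "Ck_on k S (\<lambda>x. - (\<Phi> x o\<^sub>L frechet_derivative A (at x) v o\<^sub>L \<Phi> x))"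
          by (intro Ck_on_bounded_linear[OF bounded_linear_minus[OF bounded_linear_ident]] S
              Ck_on_bilinear[OF bounded_bilinear_blinfun_compose] Suc)
      qed
    qed
  qed
qed

text \<open>An injective operator is bounded below by some \<open>B > 0\<close>, and a perturbation
  of norm less than \<open>B\<close> keeps it injective; in finite dimension injectivity already
  gives a two-sided inverse.\<close>

lemma blinfun_invertible_nhd:
  fixes A :: "'z::topological_space \<Rightarrow> 'b::euclidean_space \<Rightarrow>\<^sub>L 'b"
  assumes "open S" "x \<in> S" "continuous_on S A" and inj: "inj (A x)"
  obtains T \<Phi> where "open T" "x \<in> T" "T \<subseteq> S"
    "\<And>y. y \<in> T \<Longrightarrow> A y o\<^sub>L \<Phi> y = id_blinfun" "\<And>y. y \<in> T \<Longrightarrow> \<Phi> y o\<^sub>L A y = id_blinfun"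
proof -
  obtain B where B: "B > 0" "\<And>v. norm (A x v) \<ge> B * norm v"
    using linear_inj_bounded_below_pos[OF bounded_linear.linear[OF blinfun.bounded_linear_right] inj]
    by (metis mult.commute)
  let ?T = "S \<inter> A -` ball (A x) B"
  have T: "open ?T" "x \<in> ?T" "?T \<subseteq> S"
    using assms B(1) by (auto intro: continuous_open_preimage)
  have injA: "inj (A y)" if "y \<in> ?T" for y
  proof (rule linear_injective_0[THEN iffD2, OF bounded_linear.linear[OF blinfun.bounded_linear_right]], safe)
    fix v assume v: "A y v = 0"
    have "B * norm v \<le> norm ((A x - A y) v)"
      using B(2)[of v] v by (simp add: blinfun.bilinear_simps)
    also have "\<dots> \<le> norm (A x - A y) * norm v" by (rule norm_blinfun)
    finally have "(B - norm (A x - A y)) * norm v \<le> 0" by (simp add: algebra_simps)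
    moreover have "B - norm (A x - A y) > 0" using that by (simp add: dist_norm)
    ultimately have "norm v \<le> 0" by (meson mult_le_0_iff linorder_not_le)
    then show "v = 0" by simp
  qed
  have "\<exists>F. A y o\<^sub>L F = id_blinfun \<and> F o\<^sub>L A y = id_blinfun" if y: "y \<in> ?T" for y
  proof -
    have lin: "linear (A y)" by (rule bounded_linear.linear[OF blinfun.bounded_linear_right])
    obtain g where g: "linear g" "\<And>v. g (A y v) = v" "\<And>v. A y (g v) = v"
      using linear_injective_isomorphism[OF lin injA[OF y]] by blast
    then have "blinfun_apply (Blinfun g) = g"
      by (simp add: bounded_linear_Blinfun_apply linear_conv_bounded_linear)
    then have "A y o\<^sub>L Blinfun g = id_blinfun \<and> Blinfun g o\<^sub>L A y = id_blinfun"
      using g by (auto intro!: blinfun_eqI)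
    then show ?thesis by blast
  qed
  then obtain \<Phi> where "\<And>y. y \<in> ?T \<Longrightarrow> A y o\<^sub>L \<Phi> y = id_blinfun \<and> \<Phi> y o\<^sub>L A y = id_blinfun"
    by metis
  then show ?thesis using that T by blast
qed

section \<open>Symmetry of second derivatives\<close>

text \<open>The mean value theorem is applied in \<open>s\<close> to
  \<open>f (x + s t u + t v) - f (x + s t u)\<close> minus its expected linear part. This uses the
  second derivative at the single point \<open>x\<close> only and asks for no continuity of
  it.\<close>

lemma second_difference_approx:
  fixes f :: "'a::euclidean_space \<Rightarrow> 'b::euclidean_space"
  assumes S: "open S" "x \<in> S" and f: "\<And>y. y \<in> S \<Longrightarrow> (f has_derivative f' y) (at y)"
    and A: "((\<lambda>y. f' y u) has_derivative A) (at x)" and "e > 0"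
  shows "\<exists>d>0. \<forall>t. 0 < t \<and> t < d \<longrightarrow>
    norm (f (x + t *\<^sub>R u + t *\<^sub>R v) - f (x + t *\<^sub>R u) - f (x + t *\<^sub>R v) + f x - t\<^sup>2 *\<^sub>R A v)
      \<le> 2 * e * t\<^sup>2 * (norm u + norm v)"
proof -
  let ?N = "norm u + norm v"
  obtain d1 where d1: "d1 > 0" "\<And>y. norm (y - x) < d1 \<Longrightarrow>
      norm (f' y u - f' x u - A (y - x)) \<le> e * norm (y - x)"
    using A \<open>e > 0\<close> unfolding has_derivative_at_alt by blast
  obtain d2 where d2: "d2 > 0" "ball x d2 \<subseteq> S"
    using S openE by blast
  interpret A: linear A using A has_derivative_linear by blast
  \<comment> \<open>Both segments stay within distance \<open>t * ?N\<close> of \<open>x\<close>, so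
    this choice keeps them inside \<open>S\<close> and inside the range of the first-order estimate.
    The summand 1 keeps the denominator positive when \<open>u = v = 0\<close>.\<close>
  define d where "d = min d1 d2 / (?N + 1)"
  have N: "?N + 1 > 0" by (meson add_nonneg_nonneg add_nonneg_pos norm_ge_zero zero_less_one)
  have "d > 0" using d1 d2 N by (simp add: d_def)
  moreover have "norm (f (x + t *\<^sub>R u + t *\<^sub>R v) - f (x + t *\<^sub>R u) - f (x + t *\<^sub>R v) + f x - t\<^sup>2 *\<^sub>R A v)
      \<le> 2 * e * t\<^sup>2 * ?N" if t: "0 < t" "t < d" for t
  proof -
    have tN: "t * ?N < min d1 d2"
    proof -
      have "t * ?N \<le> t * (?N + 1)" using t by simp
      also have "\<dots> < d * (?N + 1)" using t N by (intro mult_strict_right_mono)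
      also have "\<dots> = min d1 d2" using N by (simp add: d_def)
      finally show ?thesis .
    qed
    have bnd: "norm (s *\<^sub>R t *\<^sub>R u) \<le> t * ?N \<and> norm (s *\<^sub>R t *\<^sub>R u + t *\<^sub>R v) \<le> t * ?N"
      if "0 \<le> s" "s \<le> 1" for s
    proof -
      have "norm (s *\<^sub>R t *\<^sub>R u) \<le> t * norm u"
        using that t mult_right_mono[OF that(2), of "t * norm u"] by simp
      then show ?thesis
        using t norm_triangle_ineq[of "s *\<^sub>R t *\<^sub>R u" "t *\<^sub>R v"]
        by (simp add: distrib_left) (smt (verit) norm_ge_zero mult_nonneg_nonneg)
    qed
    let ?p1 = "\<lambda>s. x + s *\<^sub>R t *\<^sub>R u + t *\<^sub>R v" and ?p2 = "\<lambda>s. x + s *\<^sub>R t *\<^sub>R u"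
    have inS: "?p1 s \<in> S" "?p2 s \<in> S" if "0 \<le> s" "s \<le> 1" for s
      using bnd[OF that] tN d2(2) by (auto simp: dist_norm add.assoc norm_minus_commute subset_iff)
    let ?g = "\<lambda>s. f (?p1 s) - f (?p2 s) - s *\<^sub>R t\<^sup>2 *\<^sub>R A v"
    let ?g' = "\<lambda>s h. f' (?p1 s) (h *\<^sub>R t *\<^sub>R u) - f' (?p2 s) (h *\<^sub>R t *\<^sub>R u) - h *\<^sub>R t\<^sup>2 *\<^sub>R A v"
    have der: "(?g has_derivative ?g' s) (at s)" if "0 \<le> s" "s \<le> 1" for s
    proof -
      have "((\<lambda>s. f (?p1 s)) has_derivative (\<lambda>h. f' (?p1 s) (h *\<^sub>R t *\<^sub>R u))) (at s)"
        by (rule has_derivative_compose[where f = ?p1 and g = f and g' = "f' (?p1 s)", OF _ f[OF inS(1)[OF that]]])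
          (auto intro!: derivative_eq_intros)
      moreover have "((\<lambda>s. f (?p2 s)) has_derivative (\<lambda>h. f' (?p2 s) (h *\<^sub>R t *\<^sub>R u))) (at s)"
        by (rule has_derivative_compose[where f = ?p2 and g = f and g' = "f' (?p2 s)", OF _ f[OF inS(2)[OF that]]])
          (auto intro!: derivative_eq_intros)
      ultimately show ?thesis
        by (auto intro!: derivative_eq_intros)
    qed
    have "\<exists>s\<in>{0<..<1}. norm (?g 1 - ?g 0) \<le> norm (?g' s (1 - 0))"
    proof (rule mvt_general)
      show "continuous_on {0..1} ?g"
        by (intro continuous_at_imp_continuous_on ballI has_derivative_continuous[OF der]) auto
    qed (use der in auto)
    then obtain s where s: "0 < s" "s < 1" and le: "norm (?g 1 - ?g 0) \<le> norm (?g' s 1)"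
      by auto
    have lin: "linear (f' y)" if "y \<in> S" for y using f[OF that] has_derivative_linear by blast
    let ?q1 = "s *\<^sub>R t *\<^sub>R u + t *\<^sub>R v" and ?q2 = "s *\<^sub>R t *\<^sub>R u"
    have e1: "norm (f' (?p1 s) u - f' x u - A ?q1) \<le> e * norm ?q1"
      using d1(2)[of "?p1 s"] bnd[of s] s tN by (simp add: add.assoc)
    have e2: "norm (f' (?p2 s) u - f' x u - A ?q2) \<le> e * norm ?q2"
      using d1(2)[of "?p2 s"] bnd[of s] s tN by simp
    \<comment> \<open>Since \<open>?q1 - ?q2 = t v\<close>, the subtracted term
      \<open>t\<^sup>2 A v\<close> is exactly what turns the difference of the two derivatives into
      a difference of two first-order errors at \<open>x\<close>.\<close>
    have "?g' s 1 = t *\<^sub>R ((f' (?p1 s) u - f' x u - A ?q1) - (f' (?p2 s) u - f' x u - A ?q2))"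
      using lin[OF inS(1)[of s]] lin[OF inS(2)[of s]] s
      by (simp add: linear_scale A.add A.scale algebra_simps power2_eq_square)
    also have "norm \<dots> \<le> t * (e * norm ?q1 + e * norm ?q2)"
      using t e1 e2 norm_triangle_ineq4[of "f' (?p1 s) u - f' x u - A ?q1" "f' (?p2 s) u - f' x u - A ?q2"]
      by simp
    also have "\<dots> \<le> t * (e * (t * ?N) + e * (t * ?N))"
      using bnd[of s] s t \<open>e > 0\<close> by (intro mult_left_mono add_mono) auto
    also have "\<dots> = 2 * e * t\<^sup>2 * ?N" by (simp add: power2_eq_square algebra_simps)
    finally have "norm (?g 1 - ?g 0) \<le> 2 * e * t\<^sup>2 * ?N" using le by simp
    then show ?thesis by (simp add: algebra_simps)
  qed
  ultimately show ?thesis by blast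
qed

text \<open>The second difference over the parallelogram spanned by \<open>t u\<close> and
  \<open>t v\<close> is symmetric in \<open>u\<close> and \<open>v\<close>, and it approximates both
  \<open>A v\<close> and \<open>B u\<close> after division by \<open>t\<^sup>2\<close>.\<close>

lemma frechet_derivative_commute:
  fixes f :: "'a::euclidean_space \<Rightarrow> 'b::euclidean_space"
  assumes S: "open S" "x \<in> S" and f: "\<And>y. y \<in> S \<Longrightarrow> (f has_derivative f' y) (at y)"
    and A: "((\<lambda>y. f' y u) has_derivative A) (at x)" and B: "((\<lambda>y. f' y v) has_derivative B) (at x)"
  shows "A v = B u"
proof (rule ccontr)
  assume "A v \<noteq> B u"
  let ?N = "norm u + norm v"
  \<comment> \<open>Two approximation errors of size \<open>2 * e * t\<^sup>2 * ?N\<close> add up to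
    the factor 4; replacing \<open>?N\<close> by \<open>?N + 1\<close> makes the final inequality
    strict.\<close>
  define e where "e = norm (A v - B u) / (4 * (?N + 1))"
  have N: "?N + 1 > 0" by (meson add_nonneg_nonneg add_nonneg_pos norm_ge_zero zero_less_one)
  have e: "e > 0" using \<open>A v \<noteq> B u\<close> N by (simp add: e_def)
  obtain d1 d2 where d: "d1 > 0" "d2 > 0"
    and 1: "\<And>t. 0 < t \<Longrightarrow> t < d1 \<Longrightarrow> norm (f (x + t *\<^sub>R u + t *\<^sub>R v) - f (x + t *\<^sub>R u) - f (x + t *\<^sub>R v) + f x - t\<^sup>2 *\<^sub>R A v)
      \<le> 2 * e * t\<^sup>2 * (norm u + norm v)"
    and 2: "\<And>t. 0 < t \<Longrightarrow> t < d2 \<Longrightarrow> norm (f (x + t *\<^sub>R v + t *\<^sub>R u) - f (x + t *\<^sub>R v) - f (x + t *\<^sub>R u) + f x - t\<^sup>2 *\<^sub>R B u)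
      \<le> 2 * e * t\<^sup>2 * (norm v + norm u)"
    using second_difference_approx[OF S f A e, of v] second_difference_approx[OF S f B e, of u] by metis
  define t where "t = min d1 d2 / 2"
  have t: "0 < t" "t < d1" "t < d2" using d by (auto simp: t_def)
  let ?F = "f (x + t *\<^sub>R u + t *\<^sub>R v) - f (x + t *\<^sub>R u) - f (x + t *\<^sub>R v) + f x"
  have F: "f (x + t *\<^sub>R v + t *\<^sub>R u) - f (x + t *\<^sub>R v) - f (x + t *\<^sub>R u) + f x = ?F"
    by (simp add: algebra_simps)
  have "t\<^sup>2 *\<^sub>R (A v - B u) = (?F - t\<^sup>2 *\<^sub>R B u) - (?F - t\<^sup>2 *\<^sub>R A v)"
    by (simp add: algebra_simps)
  then have "norm (t\<^sup>2 *\<^sub>R (A v - B u)) \<le> norm (?F - t\<^sup>2 *\<^sub>R B u) + norm (?F - t\<^sup>2 *\<^sub>R A v)"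
    by (metis norm_triangle_ineq4)
  also have "\<dots> \<le> 2 * e * t\<^sup>2 * ?N + 2 * e * t\<^sup>2 * ?N"
    using 1[OF t(1,2)] 2[OF t(1,3)] by (simp only: F add.commute[of "norm v"])
  also have "\<dots> = t\<^sup>2 * (4 * e * ?N)" by simp
  finally have "norm (A v - B u) \<le> 4 * e * ?N" using t by simp
  also have "\<dots> < 4 * e * (?N + 1)" using e by simp
  also have "\<dots> = norm (A v - B u)"
  proof -
    have "4 * (n / (4 * M)) * M = n" if "M > 0" for n M :: real using that by simp
    from this[OF N] show ?thesis unfolding e_def .
  qed
  finally show False by simp
qed

section \<open>Total differential equations\<close>

text \<open>On an interval of length 1 a Lipschitz constant below 1 makes the Picard operator a
  contraction in the sup norm, so a single use of the Banach fixed point theorem covers the whole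
  interval.\<close>

lemma autonomous_ode_solution:
  fixes G :: "'b::euclidean_space \<Rightarrow> 'b"
  assumes L: "0 \<le> L" "L < 1" and G: "\<And>x y. norm (G x - G y) \<le> L * norm (x - y)"
  obtains w where "w 0 = x0" "\<And>t. t \<in> {0..1::real} \<Longrightarrow> (w has_vector_derivative G (w t)) (at t within {0..1})"
proof -
  have contG: "continuous_on UNIV G"
    by (rule lipschitz_on_continuous_on[of L]) (auto simp: lipschitz_on_def L G dist_norm)
  \<comment> \<open>Bounded continuous functions are taken on the whole real line; a function on the
    unit interval is represented by its extension that is constant beyond the end points.\<close>
  define clip :: "real \<Rightarrow> real" where "clip t = max 0 (min 1 t)" for t
  have clip: "clip t \<in> {0..1}" "t \<in> {0..1} \<Longrightarrow> clip t = t" for t by (auto simp: clip_def)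
  define J where "J u t = x0 + integral {0..t} (\<lambda>s. G (u s))" for u :: "real \<Rightarrow> 'b" and t
  have contu: "continuous_on T (\<lambda>s. G (apply_bcontfun u s))" for u and T :: "real set"
    by (rule continuous_on_compose2[OF contG]) auto
  have contJ: "continuous_on {0..1} (J u)" for u :: "real \<Rightarrow>\<^sub>C 'b"
    unfolding J_def
    by (intro continuous_intros indefinite_integral_continuous_1 integrable_continuous_real contu)
  have mem: "(\<lambda>t. J u (clip t)) \<in> bcontfun" for u :: "real \<Rightarrow>\<^sub>C 'b"
  proof -
    have "continuous_on UNIV (\<lambda>t. J u (clip t))"
      by (rule continuous_on_compose2[OF contJ]) (auto simp: clip_def intro!: continuous_intros)
    moreover have "bounded (J u ` {0..1})"
      by (intro compact_imp_bounded compact_continuous_image contJ) simp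
    then have "bounded (range (\<lambda>t. J u (clip t)))"
      by (rule bounded_subset) (use clip in auto)
    ultimately show ?thesis by (simp add: bcontfun_def)
  qed
  define T where "T u = Bcontfun (\<lambda>t. J (apply_bcontfun u) (clip t))" for u
  have T: "apply_bcontfun (T u) = (\<lambda>t. J u (clip t))" for u
    unfolding T_def by (rule Bcontfun_inverse[OF mem])
  have "dist (T u) (T v) \<le> L * dist u v" for u v
  proof (rule dist_bound)
    fix t
    let ?c = "clip t"
    have c: "0 \<le> ?c" "?c \<le> 1" using clip(1)[of t] by auto
    have "J u ?c - J v ?c = integral {0..?c} (\<lambda>s. G (u s) - G (v s))"
      unfolding J_def by (simp add: integral_diff integrable_continuous_real contu)
    also have "norm \<dots> \<le> L * dist u v * (?c - 0)"
    proof (rule integral_bound)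
      show "norm (G (u s) - G (v s)) \<le> L * dist u v" for s
        by (rule order_trans[OF G]) (metis L(1) dist_bounded dist_norm mult_left_mono)
    qed (auto intro!: continuous_on_diff contu c)
    also have "\<dots> \<le> L * dist u v"
      using c L mult_left_le[of ?c "L * dist u v"] by simp
    finally show "dist (apply_bcontfun (T u) t) (apply_bcontfun (T v) t) \<le> L * dist u v"
      by (simp add: T dist_norm)
  qed
  then obtain u where u: "T u = u"
    using banach_fix_type[OF L] by blast
  define w where "w = apply_bcontfun u"
  have w: "w t = x0 + integral {0..t} (\<lambda>s. G (w s))" if "t \<in> {0..1}" for t
    using fun_cong[OF T[of u], of t] clip(2)[OF that] by (simp add: u w_def J_def)
  show ?thesis
  proof
    show "w 0 = x0" using w[of 0] by simp
    fix t :: real assume t: "t \<in> {0..1}"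
    have "continuous_on {0..1} (\<lambda>s. G (w s))" unfolding w_def by (rule contu)
    then have "((\<lambda>t. x0 + integral {0..t} (\<lambda>s. G (w s))) has_vector_derivative G (w t)) (at t within {0..1})"
      using has_vector_derivative_add[OF has_vector_derivative_const integral_has_vector_derivative[OF _ t]]
      by fastforce
    then show "(w has_vector_derivative G (w t)) (at t within {0..1})"
      by (rule has_vector_derivative_transform[rotated 2]) (use t w in auto)
  qed
qed

lemma norm_increment_le:
  fixes w :: "real \<Rightarrow> 'b::real_normed_vector"
  assumes "\<And>t. t \<in> {0..1} \<Longrightarrow> (w has_vector_derivative w' t) (at t within {0..1})"
    and "\<And>t. t \<in> {0..1} \<Longrightarrow> norm (w' t) \<le> B" and t: "t \<in> {0..1}"
  shows "norm (w t - w 0) \<le> B * t"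
proof -
  have "norm (w t - w 0) \<le> B * norm (t - 0)"
  proof (rule differentiable_bound[where S = "{0..1}" and f' = "\<lambda>t h. h *\<^sub>R w' t"])
    show "onorm (\<lambda>h. h *\<^sub>R w' s) \<le> B" if "s \<in> {0..1}" for s
      using assms(2)[OF that] onorm_scaleR_left[OF bounded_linear_ident, of "w' s"] by (simp add: onorm_id)
  qed (use assms t in \<open>auto simp: has_vector_derivative_def\<close>)
  then show ?thesis using t by simp
qed

lemma smooth_on_compact_convex_lipschitz:
  fixes f :: "'a::euclidean_space \<Rightarrow> 'b::real_normed_vector"
  assumes "open S" "smooth_on S f" "C \<subseteq> S" "compact C" "convex C"
  obtains B where "B > 0" "\<And>x. x \<in> C \<Longrightarrow> norm (f x) \<le> B"
    "\<And>x v. x \<in> C \<Longrightarrow> norm (frechet_derivative f (at x) v) \<le> B * norm v"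
    "\<And>x y. x \<in> C \<Longrightarrow> y \<in> C \<Longrightarrow> norm (f x - f y) \<le> B * norm (x - y)"
proof -
  define D where "D x = Blinfun (frechet_derivative f (at x))" for x
  have D: "blinfun_apply (D x) = frechet_derivative f (at x)" if "x \<in> S" for x
    unfolding D_def by (rule blinfun_apply_Blinfun_derivative[OF smooth_on_differentiable[OF assms(2) that]])
  have smD: "smooth_on S D"
    unfolding D_def by (rule smooth_on_blinfun_derivative[OF assms(1,2)])
  have "bounded (D ` C)" "bounded (f ` C)"
    by (rule compact_imp_bounded[OF compact_continuous_image[OF
          continuous_on_subset[OF smooth_on_imp_continuous_on assms(3)] assms(4)]], fact)+
  then obtain B1 B2 where B1: "\<And>x. x \<in> C \<Longrightarrow> norm (D x) \<le> B1" and B2: "\<And>x. x \<in> C \<Longrightarrow> norm (f x) \<le> B2"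
    unfolding bounded_iff by auto
  define B where "B = max 1 (max B1 B2)"
  have BD: "norm (D x) \<le> B" if "x \<in> C" for x using B1[OF that] by (simp add: B_def)
  show ?thesis
  proof
    show "B > 0" by (simp add: B_def)
    show "norm (f x) \<le> B" if "x \<in> C" for x using B2[OF that] by (simp add: B_def)
    show "norm (frechet_derivative f (at x) v) \<le> B * norm v" if "x \<in> C" for x v
      using norm_blinfun[of "D x" v] D[of x] BD[OF that] that assms(3)
      by (metis mult_right_mono norm_ge_zero order_trans subsetD)
    show "norm (f x - f y) \<le> B * norm (x - y)" if "x \<in> C" "y \<in> C" for x y
    proof (rule differentiable_bound[where S = C and f' = "\<lambda>x. blinfun_apply (D x)"])
      show "(f has_derivative blinfun_apply (D x)) (at x within C)" if "x \<in> C" for x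
      proof -
        have x: "x \<in> S" using that assms(3) by blast
        show ?thesis
          unfolding D[OF x] by (rule has_derivative_at_withinI[OF smooth_on_has_derivative[OF assms(2) x]])
      qed
      show "onorm (blinfun_apply (D x)) \<le> B" if "x \<in> C" for x
        using BD[OF that] by (simp add: norm_blinfun.rep_eq)
    qed (use that assms in auto)
  qed
qed

text \<open>The derivative is Lipschitz on the compact convex set, and along the segment from
  \<open>x\<close> to \<open>y\<close> it therefore deviates from its value at \<open>x\<close> by
  at most a multiple of \<open>norm (y - x)\<close>.\<close>

lemma smooth_on_compact_convex_taylor:
  fixes f :: "'a::euclidean_space \<Rightarrow> 'b::real_normed_vector"
  assumes "open S" "smooth_on S f" "C \<subseteq> S" "compact C" "convex C"
  obtains B where "B > 0"
    "\<And>x y. x \<in> C \<Longrightarrow> y \<in> C \<Longrightarrow>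
      norm (f y - f x - frechet_derivative f (at x) (y - x)) \<le> B * (norm (y - x))\<^sup>2"
proof -
  define D where "D x = Blinfun (frechet_derivative f (at x))" for x
  have D: "blinfun_apply (D x) = frechet_derivative f (at x)" if "x \<in> S" for x
    unfolding D_def by (rule blinfun_apply_Blinfun_derivative[OF smooth_on_differentiable[OF assms(2) that]])
  have smD: "smooth_on S D"
    unfolding D_def by (rule smooth_on_blinfun_derivative[OF assms(1,2)])
  obtain B where B: "B > 0" "\<And>x y. x \<in> C \<Longrightarrow> y \<in> C \<Longrightarrow> norm (D x - D y) \<le> B * norm (x - y)"
    using smooth_on_compact_convex_lipschitz[OF assms(1) smD assms(3-5)] by metis
  show ?thesis
  proof
    show "B > 0" by fact
    fix x y assume xy: "x \<in> C" "y \<in> C"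
    have seg: "closed_segment x y \<subseteq> C" using xy assms(5) by (simp add: closed_segment_subset)
    have "norm (f y - f x - blinfun_apply (D x) (y - x)) \<le> norm (y - x) * (B * norm (y - x))"
    proof (rule differentiable_bound_linearization[where S = "closed_segment x y"])
      show "x + t *\<^sub>R (y - x) \<in> closed_segment x y" if "t \<in> {0..1}" for t
        using that by (auto simp: closed_segment_def algebra_simps intro!: exI[of _ t])
      show "(f has_derivative blinfun_apply (D z)) (at z within closed_segment x y)"
        if "z \<in> closed_segment x y" for z
      proof -
        have z: "z \<in> S" using that assms(3) seg by blast
        show ?thesis
          unfolding D[OF z] by (rule has_derivative_at_withinI[OF smooth_on_has_derivative[OF assms(2) z]])
      qed
      show "onorm (blinfun_apply (D z) - blinfun_apply (D x)) \<le> B * norm (y - x)"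
        if "z \<in> closed_segment x y" for z
      proof -
        have "onorm (blinfun_apply (D z) - blinfun_apply (D x)) = norm (D z - D x)"
          unfolding norm_blinfun.rep_eq minus_blinfun.rep_eq
          by (rule arg_cong[where f = onorm]) (simp add: fun_eq_iff)
        also have "\<dots> \<le> B * norm (z - x)" using B(2) seg that xy by blast
        also have "\<dots> \<le> B * norm (y - x)"
          using B(1) segment_bound(1)[OF that] by (simp add: norm_minus_commute)
        finally show ?thesis .
      qed
    qed auto
    then show "norm (f y - f x - frechet_derivative f (at x) (y - x)) \<le> B * (norm (y - x))\<^sup>2"
      using D[of x] xy(1) assms(3) by (auto simp: power2_eq_square algebra_simps)
  qed
qed

text \<open>Solutions of \<open>\<sigma>' = \<Psi> \<circ> \<sigma>\<close> are obtained by integrating along the rays \<open>t \<mapsto> t a\<close>.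
  The symmetry condition makes \<open>w t + t \<Psi> (w t) h\<close> an approximate solution along the ray
  through \<open>a + h\<close>, up to an error of order \<open>|h|\<^sup>2\<close>. Comparing it with the exact solution yields
  differentiability in \<open>a\<close> and the value of the derivative at the same time.\<close>

lemma total_differential_equation:
  fixes \<Psi> :: "'b::euclidean_space \<Rightarrow> 'a::euclidean_space \<Rightarrow>\<^sub>L 'b"
  assumes S: "open S" "x0 \<in> S" and \<Psi>: "smooth_on S \<Psi>"
    and symm: "\<And>y a b. y \<in> S \<Longrightarrow>
      blinfun_apply (frechet_derivative \<Psi> (at y) (\<Psi> y a)) b = blinfun_apply (frechet_derivative \<Psi> (at y) (\<Psi> y b)) a"
  obtains d s where "d > 0" "s 0 = x0" "s ` ball 0 d \<subseteq> S"
    "\<And>a. a \<in> ball 0 d \<Longrightarrow> (s has_derivative blinfun_apply (\<Psi> (s a))) (at a)"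
proof -
  obtain r where r: "r > 0" "cball x0 r \<subseteq> S" using S open_contains_cball by blast
  let ?C = "cball x0 r"
  let ?D = "\<lambda>y. frechet_derivative \<Psi> (at y)"
  have C: "compact ?C" "convex ?C" "closed ?C" "?C \<noteq> {}" using r by auto
  obtain M where M: "M > 0" "\<And>x. x \<in> ?C \<Longrightarrow> norm (\<Psi> x) \<le> M"
    "\<And>x v. x \<in> ?C \<Longrightarrow> norm (?D x v) \<le> M * norm v"
    "\<And>x y. x \<in> ?C \<Longrightarrow> y \<in> ?C \<Longrightarrow> norm (\<Psi> x - \<Psi> y) \<le> M * norm (x - y)"
    using smooth_on_compact_convex_lipschitz[OF S(1) \<Psi> r(2) C(1,2)] by blast
  obtain B where B: "B > 0" "\<And>x y. x \<in> ?C \<Longrightarrow> y \<in> ?C \<Longrightarrow>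
      norm (\<Psi> y - \<Psi> x - ?D x (y - x)) \<le> B * (norm (y - x))\<^sup>2"
    using smooth_on_compact_convex_taylor[OF S(1) \<Psi> r(2) C(1,2)] by blast
  \<comment> \<open>The approximate solution \<open>?z\<close> below leaves \<open>x0\<close> by at
    most \<open>M * d\<close> for the exact solution and \<open>M * (2 * d)\<close> for the
    correction along \<open>h\<close>, whence \<open>r / 3\<close>. The bound 1/2 on
    \<open>M * d\<close> makes the Picard operator contract and supplies the factor 1/2 in
    \<open>e'le\<close>.\<close>
  define d where "d = min (r / (3 * M)) (1 / (2 * M))"
  have d: "d > 0" "M * d \<le> r / 3" "M * d \<le> 1/2"
    using M(1) r(1) by (auto simp: d_def min_def field_simps)
  have \<Psi>C: "norm (blinfun_apply (\<Psi> y) a) \<le> M * norm a" if "y \<in> ?C" for y a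
    using norm_blinfun[of "\<Psi> y" a] M(2)[OF that] by (meson mult_right_mono norm_ge_zero order_trans)
  have "\<exists>w. w 0 = x0 \<and> (\<forall>t\<in>{0..1}. w t \<in> ?C \<and> norm (w t - x0) \<le> M * norm a \<and>
      (w has_vector_derivative \<Psi> (w t) a) (at t within {0..1}))" if a: "norm a < d" for a
  proof -
    \<comment> \<open>Composing with the nearest-point retraction onto the ball makes the vector
      field globally Lipschitz. The solution found turns out to stay in the ball, where the
      retraction is the identity.\<close>
    let ?G = "\<lambda>y. blinfun_apply (\<Psi> (closest_point ?C y)) a"
    have cp: "closest_point ?C y \<in> ?C" for y by (rule closest_point_in_set[OF C(3,4)])
    have Ma: "M * norm a \<le> M * d" using a M(1) by simp
    obtain w where w: "w 0 = x0"
      "\<And>t. t \<in> {0..1::real} \<Longrightarrow> (w has_vector_derivative ?G (w t)) (at t within {0..1})"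
    proof (rule autonomous_ode_solution[of "M * norm a" ?G x0])
      show "0 \<le> M * norm a" using M(1) by simp
      show "M * norm a < 1" using Ma d(3) by linarith
      fix x y
      have "norm (?G x - ?G y) \<le> norm (\<Psi> (closest_point ?C x) - \<Psi> (closest_point ?C y)) * norm a"
        unfolding blinfun.diff_left[symmetric] by (rule norm_blinfun)
      also have "\<dots> \<le> (M * dist (closest_point ?C x) (closest_point ?C y)) * norm a"
        by (intro mult_right_mono) (auto simp: dist_norm intro: M(4) cp)
      also have "\<dots> \<le> (M * dist x y) * norm a"
        using M(1) by (intro mult_right_mono mult_left_mono closest_point_lipschitz C) auto
      finally show "norm (?G x - ?G y) \<le> M * norm a * norm (x - y)" by (simp add: dist_norm mult_ac)
    qed blast
    have le: "norm (w t - x0) \<le> M * norm a" if t: "t \<in> {0..1}" for t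
    proof -
      have "norm (w t - w 0) \<le> M * norm a * t"
        by (rule norm_increment_le[OF w(2) _ t]) (auto intro: \<Psi>C cp)
      also have "\<dots> \<le> M * norm a" using t M(1) by (simp add: mult_left_le)
      finally show ?thesis by (simp add: w(1))
    qed
    have wC: "w t \<in> ?C" if "t \<in> {0..1}" for t
      using le[OF that] Ma d r(1) by (simp add: dist_norm norm_minus_commute)
    show ?thesis
    proof (intro exI conjI ballI)
      show "w 0 = x0" by (rule w(1))
      fix t :: real assume t: "t \<in> {0..1}"
      show "w t \<in> ?C" "norm (w t - x0) \<le> M * norm a" using wC le t by auto
      show "(w has_vector_derivative \<Psi> (w t) a) (at t within {0..1})"
        using w(2)[OF t] closest_point_self[OF wC[OF t]] by simp
    qed
  qed
  then obtain W where W0: "\<And>a. norm a < d \<Longrightarrow> W a 0 = x0"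
    and WC: "\<And>a t. norm a < d \<Longrightarrow> t \<in> {0..1} \<Longrightarrow> W a t \<in> ?C"
    and Wle: "\<And>a t. norm a < d \<Longrightarrow> t \<in> {0..1} \<Longrightarrow> norm (W a t - x0) \<le> M * norm a"
    and Wd: "\<And>a t. norm a < d \<Longrightarrow> t \<in> {0..1} \<Longrightarrow>
      (W a has_vector_derivative \<Psi> (W a t) a) (at t within {0..1})"
    by metis
  define s where "s a = W a 1" for a
  \<comment> \<open>\<open>K / 2\<close> collects the two quadratic errors of \<open>e'le\<close>:
    the Taylor remainder of \<open>\<Psi>\<close>, applied to a vector of norm below
    \<open>d\<close>, and the term with \<open>h\<close> in both slots. The factor 2 is the price of
    absorbing half of the error itself.\<close>
  define K where "K = 2 * (B * M\<^sup>2 * d + M * M)"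
  have K2: "K / 2 = B * M\<^sup>2 * d + M * M" by (simp add: K_def)
  have K: "K > 0" using B(1) M(1) d(1) by (auto simp: K_def intro!: add_pos_pos mult_pos_pos)
  have main: "norm (s (a + h) - s a - \<Psi> (s a) h) \<le> K * (norm h)\<^sup>2"
    if a: "norm a < d" and ah: "norm (a + h) < d" for a h
  proof -
    let ?w = "W a" and ?v = "W (a + h)"
    let ?z = "\<lambda>t. ?w t + t *\<^sub>R \<Psi> (?w t) h"
    let ?e = "\<lambda>t. ?z t - ?v t"
    let ?z' = "\<lambda>t. \<Psi> (?w t) a + (\<Psi> (?w t) h + t *\<^sub>R blinfun_apply (?D (?w t) (\<Psi> (?w t) a)) h)"
    let ?e' = "\<lambda>t. ?z' t - \<Psi> (?v t) (a + h)"
    have h: "norm h < 2 * d"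
      using norm_triangle_ineq4[of "a + h" a] a ah by simp
    have ed: "(?e has_vector_derivative ?e' t) (at t within {0..1})" if t: "t \<in> {0..1}" for t
    proof -
      have "?w t \<in> S" using WC[OF a t] r(2) by blast
      then have "((\<lambda>t. \<Psi> (?w t)) has_derivative (\<lambda>k. ?D (?w t) (k *\<^sub>R \<Psi> (?w t) a))) (at t within {0..1})"
        using has_derivative_compose[OF Wd[OF a t, unfolded has_vector_derivative_def]
            smooth_on_has_derivative[OF \<Psi>]] by simp
      moreover have "linear (?D (?w t))"
        using \<open>?w t \<in> S\<close> smooth_on_has_derivative[OF \<Psi>] has_derivative_linear by blast
      ultimately have "((\<lambda>t. \<Psi> (?w t)) has_vector_derivative ?D (?w t) (\<Psi> (?w t) a)) (at t within {0..1})"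
        by (simp add: has_vector_derivative_def linear_scale)
      then have "((\<lambda>t. \<Psi> (?w t) h) has_vector_derivative blinfun_apply (?D (?w t) (\<Psi> (?w t) a)) h) (at t within {0..1})"
        by (rule bounded_linear.has_vector_derivative[OF blinfun.bounded_linear_left])
      from has_vector_derivative_diff[OF has_vector_derivative_add[OF Wd[OF a t]
          has_vector_derivative_scaleR[OF DERIV_ident this]] Wd[OF ah t]]
      show ?thesis by (simp add: add.commute)
    qed
    have zC: "?z t \<in> ?C" if t: "t \<in> {0..1}" for t
    proof -
      have "norm (t *\<^sub>R \<Psi> (?w t) h) \<le> 1 * (M * norm h)"
        unfolding norm_scaleR using t M(1) \<Psi>C[OF WC[OF a t], of h] by (intro mult_mono) auto
      moreover have "M * norm h \<le> 2 * (M * d)" using h M(1) by simp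
      moreover have "norm (?w t - x0) \<le> M * d" using Wle[OF a t] a M(1) by (smt (verit) mult_left_mono)
      ultimately have "norm ((?w t - x0) + t *\<^sub>R \<Psi> (?w t) h) \<le> r"
        using d(2) norm_triangle_ineq[of "?w t - x0" "t *\<^sub>R \<Psi> (?w t) h"] by linarith
      then show ?thesis by (simp add: dist_norm norm_minus_commute algebra_simps)
    qed
    have e'le: "norm (?e' t) \<le> norm (?e t) / 2 + (K / 2) * (norm h)\<^sup>2" if t: "t \<in> {0..1}" for t
    proof -
      have wS: "?w t \<in> S" using WC[OF a t] r(2) by blast
      interpret D: linear "?D (?w t)"
        using wS smooth_on_has_derivative[OF \<Psi>] has_derivative_linear by blast
      let ?p = "t *\<^sub>R \<Psi> (?w t) h"
      let ?R = "\<Psi> (?z t) - \<Psi> (?w t) - ?D (?w t) ?p"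
      have p: "norm ?p \<le> M * norm h"
        using t \<Psi>C[OF WC[OF a t], of h] mult_left_le_one_le[of "norm (\<Psi> (?w t) h)" t] by simp
      \<comment> \<open>The symmetry condition exchanges \<open>a\<close> and \<open>h\<close> in
        the \<open>t\<close>-term of \<open>?z'\<close>, which thereby becomes the first-order
        change of \<open>\<Psi> a\<close> from \<open>?w t\<close> to \<open>?z t\<close>. What is
        left is a Lipschitz term in \<open>?e\<close>, the Taylor remainder and one term quadratic
        in \<open>h\<close>.\<close>
      have eq: "?e' t = blinfun_apply (\<Psi> (?z t) - \<Psi> (?v t)) (a + h) - blinfun_apply ?R (a + h)
          - t *\<^sub>R blinfun_apply (?D (?w t) (\<Psi> (?w t) h)) h"
        using symm[OF wS, of a h] by (simp add: blinfun.bilinear_simps D.scale algebra_simps)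
      have "norm (?e' t) \<le> norm (blinfun_apply (\<Psi> (?z t) - \<Psi> (?v t)) (a + h))
          + norm (blinfun_apply ?R (a + h)) + norm (t *\<^sub>R blinfun_apply (?D (?w t) (\<Psi> (?w t) h)) h)"
        unfolding eq by (rule order_trans[OF norm_triangle_ineq4 add_right_mono[OF norm_triangle_ineq4]])
      also have "\<dots> \<le> norm (?e t) / 2 + B * M\<^sup>2 * d * (norm h)\<^sup>2 + M * M * (norm h)\<^sup>2"
      proof (intro add_mono)
        have "norm (\<Psi> (?z t) - \<Psi> (?v t)) \<le> M * norm (?e t)"
          by (rule M(4)[OF zC[OF t] WC[OF ah t]])
        then have "norm (\<Psi> (?z t) - \<Psi> (?v t)) * norm (a + h) \<le> (M * norm (?e t)) * d"
          using less_imp_le[OF ah] M(1) by (intro mult_mono) simp_all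
        with norm_blinfun have "norm (blinfun_apply (\<Psi> (?z t) - \<Psi> (?v t)) (a + h)) \<le> (M * norm (?e t)) * d"
          by (rule order_trans)
        also have "\<dots> = norm (?e t) * (M * d)" by simp
        also have "\<dots> \<le> norm (?e t) * (1/2)" using d(3) by (intro mult_left_mono) auto
        finally show "norm (blinfun_apply (\<Psi> (?z t) - \<Psi> (?v t)) (a + h)) \<le> norm (?e t) / 2" by simp
        have "norm ?R \<le> B * (norm ?p)\<^sup>2"
          using B(2)[OF WC[OF a t] zC[OF t]] by simp
        also have "\<dots> \<le> B * (M * norm h)\<^sup>2"
          using B(1) p by (intro mult_left_mono power_mono) auto
        finally have "norm (blinfun_apply ?R (a + h)) \<le> (B * (M * norm h)\<^sup>2) * d"
          by (rule order_trans[OF norm_blinfun mult_mono]) (use B(1) ah in auto)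
        then show "norm (blinfun_apply ?R (a + h)) \<le> B * M\<^sup>2 * d * (norm h)\<^sup>2"
          by (simp add: power_mult_distrib mult_ac)
        have "norm (blinfun_apply (?D (?w t) (\<Psi> (?w t) h)) h) \<le> (M * (M * norm h)) * norm h"
          by (rule order_trans[OF norm_blinfun mult_right_mono[OF order_trans[OF M(3)[OF WC[OF a t]]
                mult_left_mono[OF \<Psi>C[OF WC[OF a t]]]]]]) (use M(1) in auto)
        then show "norm (t *\<^sub>R blinfun_apply (?D (?w t) (\<Psi> (?w t) h)) h) \<le> M * M * (norm h)\<^sup>2"
          using t mult_left_le_one_le[of "norm (blinfun_apply (?D (?w t) (\<Psi> (?w t) h)) h)" t]
          by (simp add: power2_eq_square mult_ac)
      qed
      finally show ?thesis unfolding K2 distrib_right add.assoc .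
    qed
    \<comment> \<open>At a maximum \<open>?E\<close> of the error, the increment bound reads
      \<open>?E \<le> ?E / 2 + (K / 2) * (norm h)\<^sup>2\<close>; absorbing \<open>?E / 2\<close>
      takes the place of a Gronwall estimate.\<close>
    have "continuous_on {0..1} ?e"
      using ed by (meson continuous_on_eq_continuous_within has_vector_derivative_continuous)
    then obtain t0 where t0: "t0 \<in> {0..1}" and max: "\<And>t. t \<in> {0..1} \<Longrightarrow> norm (?e t) \<le> norm (?e t0)"
      using continuous_attains_sup[of "{0..1}" "\<lambda>t. norm (?e t)"] continuous_on_norm by force
    let ?E = "norm (?e t0)"
    have "norm (?e t0 - ?e 0) \<le> (?E / 2 + (K / 2) * (norm h)\<^sup>2) * t0"
    proof (rule norm_increment_le[OF ed _ t0])
      show "norm (?e' t) \<le> ?E / 2 + (K / 2) * (norm h)\<^sup>2" if "t \<in> {0..1}" for t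
        using e'le[OF that] max[OF that] by simp
    qed
    moreover have "?e 0 = 0" using W0 a ah by simp
    moreover have "(?E / 2 + (K / 2) * (norm h)\<^sup>2) * t0 \<le> ?E / 2 + (K / 2) * (norm h)\<^sup>2"
      using t0 K by (intro mult_left_le) auto
    ultimately have "?E \<le> K * (norm h)\<^sup>2" by simp
    then have "norm (?e 1) \<le> K * (norm h)\<^sup>2" using max[of 1] by simp
    then show ?thesis
      unfolding s_def by (simp add: norm_minus_commute algebra_simps)
  qed
  show ?thesis
  proof
    show "d > 0" by (rule d(1))
    show "s 0 = x0" using Wle[of 0 1] d(1) by (simp add: s_def)
    show "s ` ball 0 d \<subseteq> S" using WC r(2) by (auto simp: s_def)
    fix a :: 'a assume a: "a \<in> ball 0 d"
    show "(s has_derivative blinfun_apply (\<Psi> (s a))) (at a)"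
      unfolding has_derivative_at_alt
    proof (intro conjI allI impI)
      fix e :: real assume e: "e > 0"
      let ?d = "min (d - norm a) (e / K)"
      have "norm (s y - s a - \<Psi> (s a) (y - a)) \<le> e * norm (y - a)" if y: "norm (y - a) < ?d" for y
      proof -
        have "norm (a + (y - a)) < d" using norm_triangle_ineq[of a "y - a"] y by simp
        then have "norm (s y - s a - \<Psi> (s a) (y - a)) \<le> K * (norm (y - a))\<^sup>2"
          using main[of a "y - a"] a by simp
        also have "\<dots> = (K * norm (y - a)) * norm (y - a)" by (simp add: power2_eq_square)
        also have "\<dots> \<le> e * norm (y - a)"
          using y K by (intro mult_right_mono) (auto simp: field_simps)
        finally show ?thesis .
      qed
      moreover have "?d > 0" using a e K by simp
      ultimately show "\<exists>d>0. \<forall>y. norm (y - a) < d \<longrightarrow> norm (s y - s a - \<Psi> (s a) (y - a)) \<le> e * norm (y - a)"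
        by blast
    qed (rule blinfun.bounded_linear_right)
  qed
qed

section \<open>Charts\<close>

lemma manifold_chart:
  assumes "smooth_manifold A" "c \<in> A"
  shows "open (fst c)" "open (snd c ` fst c)" "inj_on (snd c) (fst c)"
    "continuous_on (fst c) (snd c)" "continuous_on (snd c ` fst c) (cinv c)"
proof -
  have "is_chart c" using assms unfolding smooth_manifold_def by blast
  then have inv: "\<And>x. x \<in> fst c \<Longrightarrow> cinv c (snd c x) = x"
    unfolding is_chart_def homeomorphism_def by auto
  show "inj_on (snd c) (fst c)" by (rule inj_on_inverseI[where g = "cinv c"]) (rule inv)
qed (use assms in \<open>auto simp: smooth_manifold_def is_chart_def homeomorphism_def\<close>)

lemma cinv_chart:
  assumes "smooth_manifold A" "c \<in> A"
  shows "p \<in> fst c \<Longrightarrow> cinv c (snd c p) = p" "y \<in> snd c ` fst c \<Longrightarrow> snd c (cinv c y) = y"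
    "y \<in> snd c ` fst c \<Longrightarrow> cinv c y \<in> fst c"
  using manifold_chart(3)[OF assms] by (auto simp: f_inv_into_f inv_into_into)

lemma image_chart_eq:
  assumes "smooth_manifold A" "c \<in> A" "U \<subseteq> fst c"
  shows "snd c ` U = {y \<in> snd c ` fst c. cinv c y \<in> U}"
  using cinv_chart[OF assms(1,2)] assms(3) by (auto simp: image_iff)

lemma open_image_chart:
  assumes "smooth_manifold A" "c \<in> A" "open U" "U \<subseteq> fst c"
  shows "open (snd c ` U)"
proof -
  have "snd c ` U = snd c ` fst c \<inter> cinv c -` U"
    using image_chart_eq[OF assms(1,2,4)] by blast
  then show ?thesis
    using continuous_open_preimage[OF manifold_chart(5,2)[OF assms(1,2)] assms(3)] by simp
qed

lemma pref_chart:
  assumes "smooth_manifold A"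
  shows "pref_chart A p \<in> A" "p \<in> fst (pref_chart A p)"
proof -
  have "\<exists>c. c \<in> A \<and> p \<in> fst c"
    using assms unfolding smooth_manifold_def by blast
  from someI_ex[OF this] show "pref_chart A p \<in> A" "p \<in> fst (pref_chart A p)"
    unfolding pref_chart_def by auto
qed

lemma smooth_map_id:
  assumes "smooth_manifold A"
  shows "smooth_map A A id"
  using assms unfolding smooth_map_def smooth_manifold_def smooth_transition_def
  by simp

lemma smooth_map_chart:
  assumes "smooth_manifold B" "smooth_manifold A" "smooth_map B A f" "c \<in> B" "d \<in> A"
  shows "smooth_on (snd c ` (fst c \<inter> f -` fst d)) (snd d \<circ> f \<circ> cinv c)"
    "open (snd c ` (fst c \<inter> f -` fst d))"
proof -
  show "smooth_on (snd c ` (fst c \<inter> f -` fst d)) (snd d \<circ> f \<circ> cinv c)"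
    using assms by (auto simp: smooth_map_def)
  have "open (f -` fst d)"
    using assms manifold_chart(1)[OF assms(2,5)] open_vimage by (auto simp: smooth_map_def)
  then show "open (snd c ` (fst c \<inter> f -` fst d))"
    using open_image_chart[OF assms(1,4)] manifold_chart(1)[OF assms(1,4)] by (simp add: open_Int)
qed

text \<open>The common form of \<open>tangent_map\<close> (both charts preferred) and
  \<open>chart_diff\<close> (identity map, source chart preferred), so that one chain rule serves
  changes of charts and tangent maps alike.\<close>

definition rep_diff ::
    "('n \<Rightarrow> 'm) \<Rightarrow> ('n, 'b::euclidean_space) chart \<Rightarrow> ('m, 'a::euclidean_space) chart \<Rightarrow> 'n \<Rightarrow> 'b \<Rightarrow> 'a" where
  "rep_diff f c d x = frechet_derivative (snd d \<circ> f \<circ> cinv c) (at (snd c x))"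

lemma tangent_map_rep_diff:
  "tangent_map B A f x = rep_diff f (pref_chart B x) (pref_chart A (f x)) x"
  by (simp add: tangent_map_def rep_diff_def)

lemma chart_diff_rep_diff: "chart_diff A d p = rep_diff id (pref_chart A p) d p"
  by (simp add: chart_diff_def rep_diff_def)

lemma rep_diff_has_derivative:
  assumes "smooth_manifold B" "smooth_manifold A" "smooth_map B A f" "c \<in> B" "d \<in> A"
    and "x \<in> fst c" "f x \<in> fst d"
  shows "((snd d \<circ> f \<circ> cinv c) has_derivative rep_diff f c d x) (at (snd c x))"
  unfolding rep_diff_def
  by (rule smooth_on_has_derivative[OF smooth_map_chart(1)[OF assms(1-5)]]) (use assms(6,7) in auto)

lemma linear_rep_diff:
  assumes "smooth_manifold B" "smooth_manifold A" "smooth_map B A f" "c \<in> B" "d \<in> A"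
    and "x \<in> fst c" "f x \<in> fst d"
  shows "linear (rep_diff f c d x)"
  using rep_diff_has_derivative[OF assms] has_derivative_linear by blast

lemma rep_diff_compose:
  assumes "smooth_manifold B" "smooth_manifold A" "smooth_manifold A'"
    and "smooth_map B A f" "smooth_map A A' h" "c \<in> B" "d \<in> A" "e \<in> A'"
    and "x \<in> fst c" "f x \<in> fst d" "h (f x) \<in> fst e"
  shows "rep_diff (h \<circ> f) c e x = rep_diff h d e (f x) \<circ> rep_diff f c d x"
proof -
  let ?S = "snd c ` (fst c \<inter> f -` fst d)"
  have "((snd d \<circ> f \<circ> cinv c) has_derivative rep_diff f c d x) (at (snd c x))"
    using assms by (intro rep_diff_has_derivative)
  moreover have "((snd e \<circ> h \<circ> cinv d) has_derivative rep_diff h d e (f x)) (at ((snd d \<circ> f \<circ> cinv c) (snd c x)))"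
    using rep_diff_has_derivative[OF assms(2,3,5,7,8,10,11)] cinv_chart(1)[OF assms(1,6,9)] by simp
  ultimately have "((snd e \<circ> h \<circ> cinv d) \<circ> (snd d \<circ> f \<circ> cinv c) has_derivative rep_diff h d e (f x) \<circ> rep_diff f c d x) (at (snd c x))"
    by (rule diff_chain_at)
  then have "(snd e \<circ> (h \<circ> f) \<circ> cinv c has_derivative rep_diff h d e (f x) \<circ> rep_diff f c d x) (at (snd c x))"
  proof (rule has_derivative_transform_within_open)
    show "open ?S" by (rule smooth_map_chart(2)[OF assms(1,2,4,6,7)])
    show "snd c x \<in> ?S" using assms by auto
    show "((snd e \<circ> h \<circ> cinv d) \<circ> (snd d \<circ> f \<circ> cinv c)) y = (snd e \<circ> (h \<circ> f) \<circ> cinv c) y" if "y \<in> ?S" for y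
      using that cinv_chart(1)[OF assms(1,6)] cinv_chart(1)[OF assms(2,7)] by auto
  qed
  then show ?thesis
    unfolding rep_diff_def[of "h \<circ> f"] by (rule frechet_derivative_eqI)
qed

lemma rep_diff_id_id:
  assumes "smooth_manifold A" "c \<in> A" "p \<in> fst c"
  shows "rep_diff id c c p = id"
proof -
  have "((\<lambda>y. y) has_derivative id) (at (snd c p))" by (simp add: id_def)
  then have "(snd c \<circ> id \<circ> cinv c has_derivative id) (at (snd c p))"
    by (rule has_derivative_transform_within_open[OF _ manifold_chart(2)[OF assms(1,2)]])
      (use assms cinv_chart[OF assms(1,2)] in auto)
  then show ?thesis unfolding rep_diff_def by (rule frechet_derivative_eqI)
qed

lemma chart_diff_change:
  assumes "smooth_manifold A" "c \<in> A" "d \<in> A" "p \<in> fst c" "p \<in> fst d"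
  shows "chart_diff A d p u = rep_diff id c d p (chart_diff A c p u)"
proof -
  note pc = pref_chart[OF assms(1), of p]
  have "rep_diff (id \<circ> id) (pref_chart A p) d p = rep_diff id c d (id p) \<circ> rep_diff id (pref_chart A p) c p"
    by (rule rep_diff_compose[OF assms(1,1,1) smooth_map_id[OF assms(1)] smooth_map_id[OF assms(1)]])
      (use assms pc in auto)
  then show ?thesis by (simp add: chart_diff_rep_diff)
qed

text \<open>This justifies computing at a single point in its own preferred chart, where a tangent
  vector and its component vector coincide.\<close>

lemma chart_diff_pref_chart:
  assumes "smooth_manifold A"
  shows "chart_diff A (pref_chart A p) p = id"
  unfolding chart_diff_rep_diff using rep_diff_id_id[OF assms] pref_chart[OF assms] by blast

lemma linear_chart_diff:
  assumes "smooth_manifold A" "c \<in> A" "p \<in> fst c"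
  shows "linear (chart_diff A c p)"
  unfolding chart_diff_rep_diff
  by (rule linear_rep_diff[OF assms(1,1) smooth_map_id[OF assms(1)]])
    (use assms pref_chart[OF assms(1)] in auto)

lemma bij_chart_diff:
  assumes "smooth_manifold A" "c \<in> A" "p \<in> fst c"
  shows "bij (chart_diff A c p)"
proof (rule o_bij)
  let ?P = "pref_chart A p"
  note pc = pref_chart[OF assms(1), of p]
  have "rep_diff (id \<circ> id) ?P ?P p = rep_diff id c ?P (id p) \<circ> rep_diff id ?P c p"
    by (rule rep_diff_compose[OF assms(1,1,1) smooth_map_id[OF assms(1)] smooth_map_id[OF assms(1)]])
      (use assms pc in auto)
  then show "rep_diff id c ?P p \<circ> chart_diff A c p = id"
    using rep_diff_id_id[OF assms(1) pc] by (simp add: chart_diff_rep_diff)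
  have "rep_diff (id \<circ> id) c c p = rep_diff id ?P c (id p) \<circ> rep_diff id c ?P p"
    by (rule rep_diff_compose[OF assms(1,1,1) smooth_map_id[OF assms(1)] smooth_map_id[OF assms(1)]])
      (use assms pc in auto)
  then show "chart_diff A c p \<circ> rep_diff id c ?P p = id"
    using rep_diff_id_id[OF assms] by (simp add: chart_diff_rep_diff)
qed

lemma chart_diff_coord_vec:
  assumes "smooth_manifold A" "c \<in> A" "p \<in> fst c"
  shows "chart_diff A c p (coord_vec A c v p) = v" "coord_vec A c (chart_diff A c p u) p = u"
    "linear (\<lambda>v. coord_vec A c v p)"
proof -
  note b = bij_chart_diff[OF assms]
  show 1: "chart_diff A c p (coord_vec A c v p) = v" for v
    unfolding coord_vec_def using b by (simp add: bij_is_surj surj_f_inv_f)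
  show 2: "coord_vec A c (chart_diff A c p u) p = u" for u
    unfolding coord_vec_def using b by (simp add: bij_is_inj)
  interpret linear "chart_diff A c p" by (rule linear_chart_diff[OF assms])
  show "linear (\<lambda>v. coord_vec A c v p)"
    by (rule linearI) (metis 1 2 add, metis 1 2 scale)
qed

text \<open>The chain rule for \<open>id \<circ> f\<close> and for \<open>f \<circ> id\<close>,
  compared: preferred charts drop out in favour of arbitrary ones.\<close>

lemma chart_diff_tangent_map:
  assumes "smooth_manifold B" "smooth_manifold A" "smooth_map B A f" "c \<in> B" "d \<in> A"
    and "x \<in> fst c" "f x \<in> fst d"
  shows "chart_diff A d (f x) (tangent_map B A f x u) = rep_diff f c d x (chart_diff B c x u)"
proof -
  note pb = pref_chart[OF assms(1), of x] and pa = pref_chart[OF assms(2), of "f x"]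
  have "rep_diff (id \<circ> f) (pref_chart B x) d x = rep_diff id (pref_chart A (f x)) d (f x) \<circ> rep_diff f (pref_chart B x) (pref_chart A (f x)) x"
    by (rule rep_diff_compose[OF assms(1,2,2,3) smooth_map_id[OF assms(2)]])
      (use assms pb pa in auto)
  moreover have "rep_diff (f \<circ> id) (pref_chart B x) d x = rep_diff f c d (id x) \<circ> rep_diff id (pref_chart B x) c x"
    by (rule rep_diff_compose[OF assms(1,1,2) smooth_map_id[OF assms(1)] assms(3)])
      (use assms pb pa in auto)
  ultimately show ?thesis
    by (simp add: chart_diff_rep_diff tangent_map_rep_diff fun_eq_iff)
qed

lemma tangent_map_coord_vec:
  assumes "smooth_manifold B" "smooth_manifold A" "smooth_map B A f" "c \<in> B" "d \<in> A"
    and "x \<in> fst c" "f x \<in> fst d"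
  shows "tangent_map B A f x (coord_vec B c u x) = coord_vec A d (rep_diff f c d x u) (f x)"
  using chart_diff_tangent_map[OF assms, of "coord_vec B c u x"] chart_diff_coord_vec(1)[OF assms(1,4,6)]
    chart_diff_coord_vec(2)[OF assms(2,5,7)] by metis

lemma linear_tangent_map:
  assumes "smooth_manifold B" "smooth_manifold A" "smooth_map B A f"
  shows "linear (tangent_map B A f x)"
  unfolding tangent_map_rep_diff
  by (rule linear_rep_diff[OF assms]) (use pref_chart assms in auto)

lemma smooth_transition_map:
  assumes "smooth_manifold A" "c \<in> A" "d \<in> A"
  shows "smooth_on (snd c ` (fst c \<inter> fst d)) (\<lambda>y. snd d (cinv c y))"
    "open (snd c ` (fst c \<inter> fst d))"
  using smooth_map_chart[OF assms(1,1) smooth_map_id[OF assms(1)] assms(2,3)] by (simp_all add: o_def)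

section \<open>Smooth fields and new charts obtained from one given chart\<close>

text \<open>The representation in any other chart differs by a transition map and its derivative,
  both smooth, so one chart whose domain contains \<open>U\<close> decides smoothness.\<close>

lemma smooth_vf_chartI:
  assumes A: "smooth_manifold A" and c: "c \<in> A" and U: "open U" "U \<subseteq> fst c"
    and X: "smooth_on (snd c ` U) (vf_rep A c X)"
  shows "smooth_vf A U X"
  unfolding smooth_vf_def
proof
  fix d assume d: "d \<in> A"
  let ?S = "snd d ` (U \<inter> fst d)" and ?T = "snd c ` (U \<inter> fst d)"
  let ?t = "\<lambda>y. snd c (cinv d y)" and ?t' = "\<lambda>y. snd d (cinv c y)"
  have Sub: "?T \<subseteq> snd c ` (fst c \<inter> fst d)" "?S \<subseteq> snd d ` (fst d \<inter> fst c)" using U by auto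
  have oS: "open ?S" and oT: "open ?T"
    using open_image_chart[OF A d, of "U \<inter> fst d"] open_image_chart[OF A c, of "U \<inter> fst d"]
      U manifold_chart(1)[OF A d] by auto
  have tS: "?t ` ?S \<subseteq> ?T" using cinv_chart(1)[OF A d] by auto
  have sm: "smooth_on ?T (\<lambda>z. Blinfun (frechet_derivative ?t' (at z)))"
    by (rule smooth_on_blinfun_derivative[OF oT smooth_on_subset[OF smooth_transition_map(1)[OF A c d] Sub(1)]])
  show "smooth_on ?S (vf_rep A d X)"
  proof (rule smooth_on_cong[OF oS])
    fix y assume y: "y \<in> ?S"
    then obtain q where q: "q \<in> U" "q \<in> fst d" "y = snd d q" by auto
    have qc: "q \<in> fst c" and cy: "cinv d y = q" using q U cinv_chart(1)[OF A d] by auto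
    have dif: "?t' differentiable at (snd c q)"
      by (rule smooth_on_differentiable[OF smooth_transition_map(1)[OF A c d]]) (use q qc in auto)
    show "vf_rep A d X y = blinfun_apply (Blinfun (frechet_derivative ?t' (at (?t y)))) (vf_rep A c X (?t y))"
      using chart_diff_change[OF A c d qc q(2)] cinv_chart(1)[OF A c qc]
      by (simp add: vf_rep_def cy blinfun_apply_Blinfun_derivative[OF dif] rep_diff_def o_def)
  next
    have t: "smooth_on ?S ?t" by (rule smooth_on_subset[OF smooth_transition_map(1)[OF A d c] Sub(2)])
    have X': "smooth_on ?T (vf_rep A c X)" by (rule smooth_on_subset[OF X]) auto
    show "smooth_on ?S (\<lambda>y. blinfun_apply (Blinfun (frechet_derivative ?t' (at (?t y)))) (vf_rep A c X (?t y)))"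
      by (intro smooth_on_blinfun_apply oS smooth_on_compose[OF oS oT tS t sm] smooth_on_compose[OF oS oT tS t X'])
  qed
qed

text \<open>Maximality of the atlas: a chart followed by a diffeomorphism of open sets has smooth
  transitions with every chart in both directions, hence already belongs to the atlas.\<close>

lemma chart_compose_mem:
  assumes A: "smooth_manifold A" and c: "c \<in> A" and S: "open S" "S \<subseteq> snd c ` fst c" and T: "open T"
    and h: "smooth_on S h" "h ` S \<subseteq> T" "\<And>y. y \<in> S \<Longrightarrow> h' (h y) = y"
    and h': "smooth_on T h'" "h' ` T \<subseteq> S" "\<And>z. z \<in> T \<Longrightarrow> h (h' z) = z"
  shows "(cinv c ` S, \<lambda>p. h (snd c p)) \<in> A"
proof -
  define c1 where "c1 = (cinv c ` S, \<lambda>p. h (snd c p))"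
  have f1: "fst c1 = cinv c ` S" and s1: "\<And>p. snd c1 p = h (snd c p)" by (auto simp: c1_def)
  have cS: "snd c (cinv c y) = y" "cinv c y \<in> fst c" if "y \<in> S" for y
    using cinv_chart[OF A c] S that by auto
  have "cinv c ` S = fst c \<inter> snd c -` S"
    using cS cinv_chart(1)[OF A c] by (auto simp: image_iff) metis
  then have of1: "open (fst c1)"
    unfolding f1 using continuous_open_preimage[OF manifold_chart(4,1)[OF A c] S(1)] by simp
  have sub: "fst c1 \<subseteq> fst c" using cS by (auto simp: f1)
  have inj: "inj_on (snd c1) (fst c1)"
    by (rule inj_on_inverseI[where g = "\<lambda>z. cinv c (h' z)"]) (auto simp: f1 s1 cS h(3))
  have im: "snd c1 ` fst c1 = T"
  proof
    show "snd c1 ` fst c1 \<subseteq> T" using h(2) by (auto simp: f1 s1 cS)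
    show "T \<subseteq> snd c1 ` fst c1"
    proof
      fix z assume "z \<in> T"
      then have "snd c1 (cinv c (h' z)) = z" "cinv c (h' z) \<in> fst c1"
        using h'(2,3) cS by (auto simp: s1 f1)
      then show "z \<in> snd c1 ` fst c1" by (metis image_eqI)
    qed
  qed
  have ci: "cinv c1 z = cinv c (h' z)" if "z \<in> T" for z
  proof -
    have "snd c1 (cinv c (h' z)) = z" "cinv c (h' z) \<in> fst c1"
      using h'(2,3) cS that by (auto simp: s1 f1)
    then show ?thesis using inv_into_f_f[OF inj] by metis
  qed
  have "is_chart c1"
    unfolding is_chart_def im homeomorphism_def
  proof (intro conjI ballI)
    show "continuous_on (fst c1) (snd c1)"
      unfolding s1 by (rule continuous_on_compose2[OF smooth_on_imp_continuous_on[OF h(1)]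
            continuous_on_subset[OF manifold_chart(4)[OF A c] sub]]) (auto simp: f1 cS)
    have "continuous_on T (\<lambda>z. cinv c (h' z))"
      by (rule continuous_on_compose2[OF manifold_chart(5)[OF A c] smooth_on_imp_continuous_on[OF h'(1)]])
        (use h'(2) S in auto)
    then show "continuous_on T (cinv c1)" using ci by (simp cong: continuous_on_cong)
    show "cinv c1 ` T = fst c1"
      unfolding im[symmetric] using inj by (auto simp: image_image)
    show "snd c1 (cinv c1 z) = z" if "z \<in> T" for z
      by (rule f_inv_into_f) (simp add: im that)
    show "cinv c1 (snd c1 p) = p" if "p \<in> fst c1" for p
      by (rule inv_into_f_f[OF inj that])
  qed (use of1 T im in auto)
  moreover have "smooth_transition c1 d \<and> smooth_transition d c1" if d: "d \<in> A" for d
  proof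
    note od = manifold_chart(1)[OF A d]
    show "smooth_transition c1 d"
      unfolding smooth_transition_def
    proof (rule smooth_on_cong)
      let ?S = "snd c1 ` (fst c1 \<inter> fst d)"
      have eq: "?S = T \<inter> h' -` (snd c ` (fst c \<inter> fst d))"
      proof (intro equalityI subsetI)
        fix z assume "z \<in> ?S"
        then obtain p where p: "p \<in> fst c1" "p \<in> fst d" "z = h (snd c p)" by (auto simp: s1)
        then have "snd c p \<in> S" using cS by (auto simp: f1)
        then show "z \<in> T \<inter> h' -` (snd c ` (fst c \<inter> fst d))"
          using p sub h(2,3) by auto
      next
        fix z assume z: "z \<in> T \<inter> h' -` (snd c ` (fst c \<inter> fst d))"
        then obtain p where p: "p \<in> fst c" "p \<in> fst d" "h' z = snd c p" by auto
        then have "p = cinv c (h' z)" using cinv_chart(1)[OF A c] by simp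
        then have "p \<in> fst c1" using z h'(2) by (auto simp: f1)
        moreover have "snd c1 p = z" using p z h'(3) s1 by (metis IntD1)
        ultimately show "z \<in> ?S" using p by blast
      qed
      show oS: "open ?S"
        unfolding eq by (rule continuous_open_preimage[OF smooth_on_imp_continuous_on[OF h'(1)] T
              smooth_transition_map(2)[OF A c d]])
      show "(snd d \<circ> cinv c1) z = snd d (cinv c (h' z))" if "z \<in> ?S" for z
        using that ci eq by auto
      show "smooth_on ?S (\<lambda>z. snd d (cinv c (h' z)))"
        by (rule smooth_on_compose[OF oS smooth_transition_map(2)[OF A c d] _ smooth_on_subset[OF h'(1)]
              smooth_transition_map(1)[OF A c d]]) (use eq in auto)
    qed
    show "smooth_transition d c1"
      unfolding smooth_transition_def
    proof (rule smooth_on_cong)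
      let ?S = "snd d ` (fst d \<inter> fst c1)"
      show oS: "open ?S" by (rule open_image_chart[OF A d]) (use od of1 in auto)
      show "(snd c1 \<circ> cinv d) z = h (snd c (cinv d z))" if "z \<in> ?S" for z by (simp add: s1)
      have "smooth_on ?S (\<lambda>y. snd c (cinv d y))"
        by (rule smooth_on_subset[OF smooth_transition_map(1)[OF A d c]]) (use sub in auto)
      moreover have "(\<lambda>y. snd c (cinv d y)) ` ?S \<subseteq> S"
        using cinv_chart(1)[OF A d] cS by (auto simp: f1)
      ultimately show "smooth_on ?S (\<lambda>z. h (snd c (cinv d z)))"
        using smooth_on_compose[OF oS S(1) _ _ h(1)] by blast
    qed
  qed
  ultimately have "c1 \<in> A"
    using A unfolding smooth_manifold_def by blast
  then show ?thesis by (simp add: c1_def)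
qed

section \<open>Involutive distributions in graph form\<close>

text \<open>\<open>comm\<close> is the symmetry condition of
  \<open>total_differential_equation\<close>, so a leaf is parametrized by its solution
  \<open>s\<close>. The projection \<open>P\<close> inverts \<open>\<Phi> y\<close> on K and so
  serves as a coordinate along the leaf; subtracting the resulting graph gives a chart in which the
  leaf is a piece of K.\<close>

lemma integral_manifold_of_commuting_frame:
  fixes B :: "('n::{t2_space,second_countable_topology}, 'b::euclidean_space) chart set"
    and \<Phi> :: "'b \<Rightarrow> 'b \<Rightarrow>\<^sub>L 'b"
  assumes B: "smooth_manifold B" and c: "c \<in> B" and S: "open S" "S \<subseteq> snd c ` fst c"
    and x: "x \<in> fst c" "snd c x \<in> S" and \<Phi>: "smooth_on S \<Phi>"
    and K: "subspace K" and P: "linear P" "\<And>v. P v \<in> K" "\<And>v. v \<in> K \<Longrightarrow> P v = v"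
    and E: "\<And>p. p \<in> fst c \<Longrightarrow> snd c p \<in> S \<Longrightarrow> E p = {v. \<exists>k\<in>K. chart_diff B c p v = \<Phi> (snd c p) k}"
    and P\<Phi>: "\<And>y k. y \<in> S \<Longrightarrow> k \<in> K \<Longrightarrow> P (\<Phi> y k) = k"
    and comm: "\<And>y a b. y \<in> S \<Longrightarrow> a \<in> K \<Longrightarrow> b \<in> K \<Longrightarrow>
      blinfun_apply (frechet_derivative \<Phi> (at y) (\<Phi> y a)) b = blinfun_apply (frechet_derivative \<Phi> (at y) (\<Phi> y b)) a"
  shows "\<exists>Q. x \<in> Q \<and> integral_manifold B E Q"
proof -
  interpret P: linear P by (rule P(1))
  have Pbl: "bounded_linear P" using P(1) by (simp add: linear_conv_bounded_linear)
  \<comment> \<open>The total differential equation wants operators on the whole model space;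
    precomposition with \<open>P\<close> extends \<open>\<Phi> y\<close> from K, and directions in
    the kernel of \<open>P\<close> contribute nothing.\<close>
  define \<Psi> where "\<Psi> y = \<Phi> y o\<^sub>L Blinfun P" for y
  have \<Psi>_apply: "blinfun_apply (\<Psi> y) v = \<Phi> y (P v)" for y v
    by (simp add: \<Psi>_def bounded_linear_Blinfun_apply[OF Pbl])
  have sm\<Psi>: "smooth_on S \<Psi>"
    unfolding \<Psi>_def by (intro smooth_on_bilinear[OF bounded_bilinear_blinfun_compose] S \<Phi> smooth_on_const)
  have d\<Psi>: "blinfun_apply (frechet_derivative \<Psi> (at y) v) b = blinfun_apply (frechet_derivative \<Phi> (at y) v) (P b)"
    if "y \<in> S" for y v b
  proof -
    have "(\<Psi> has_derivative (\<lambda>v. frechet_derivative \<Phi> (at y) v o\<^sub>L Blinfun P)) (at y)"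
      unfolding \<Psi>_def
      by (rule bounded_linear.has_derivative[OF bounded_bilinear.bounded_linear_left[OF bounded_bilinear_blinfun_compose]
            smooth_on_has_derivative[OF \<Phi> that]])
    then show ?thesis by (simp add: frechet_derivative_eqI bounded_linear_Blinfun_apply[OF Pbl])
  qed
  let ?x0 = "snd c x"
  obtain d s where d: "d > 0" "s 0 = ?x0" "s ` ball 0 d \<subseteq> S"
    and ds: "\<And>a. a \<in> ball 0 d \<Longrightarrow> (s has_derivative blinfun_apply (\<Psi> (s a))) (at a)"
  proof (rule total_differential_equation[OF S(1) x(2) sm\<Psi>])
    show "blinfun_apply (frechet_derivative \<Psi> (at y) (\<Psi> y a)) b = blinfun_apply (frechet_derivative \<Psi> (at y) (\<Psi> y b)) a"
      if "y \<in> S" for y a b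
      unfolding d\<Psi>[OF that] \<Psi>_apply by (rule comm[OF that P(2) P(2)])
  qed blast
  have sms: "smooth_on (ball 0 d) s"
    by (rule smooth_on_solution[OF open_ball S(1) d(3) sm\<Psi> ds])
  \<comment> \<open>\<open>P\<close> maps \<open>\<Psi> (s a) v\<close> to \<open>P v\<close>, so
    \<open>P (s a) - P a\<close> has derivative 0 on the convex ball and is constant.\<close>
  have Ps: "P (s a) = P ?x0 + P a" if a: "a \<in> ball 0 d" for a
  proof -
    have "((\<lambda>a. P (s a) - P a) has_derivative (\<lambda>v. 0)) (at a within ball 0 d)" if a: "a \<in> ball 0 d" for a
    proof -
      have "P (blinfun_apply (\<Psi> (s a)) v) - P v = 0" for v
        using P\<Phi>[of "s a" "P v"] d(3) a P(2) by (simp add: \<Psi>_apply image_subset_iff)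
      then show ?thesis
        using has_derivative_diff[OF bounded_linear.has_derivative[OF Pbl ds[OF a]]
            bounded_linear.has_derivative[OF Pbl has_derivative_ident]]
        by (simp add: has_derivative_at_withinI)
    qed
    then obtain C where "\<And>a. a \<in> ball 0 d \<Longrightarrow> P (s a) - P a = C"
      using has_derivative_zero_constant[OF convex_ball, of 0 d "\<lambda>a. P (s a) - P a"] by blast
    from this[OF a] this[of 0] show ?thesis using d by (simp add: P.zero algebra_simps)
  qed
  define S1 where "S1 = S \<inter> (\<lambda>y. P (y - ?x0)) -` ball 0 d"
  \<comment> \<open>\<open>h\<close> is a shear that moves the leaf point
    \<open>s (P (y - ?x0))\<close>, which has the same K-coordinate as \<open>y\<close>, to
    \<open>P (y - ?x0)\<close>. It sends \<open>x\<close> to 0 and satisfies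
    \<open>P (h y) = P (y - ?x0)\<close>, which makes \<open>h'\<close> its inverse; the leaf
    becomes a piece of a linear subspace, as \<open>slice_chart\<close> demands.\<close>
  define h where "h y = y - s (P (y - ?x0)) + P (y - ?x0)" for y
  define h' where "h' z = z + s (P z) - P z" for z
  define T1 where "T1 = (P -` ball 0 d) \<inter> h' -` S"
  have contP: "continuous_on T P" for T using Pbl by (simp add: linear_continuous_on)
  have oPb: "open (P -` ball 0 d)"
    using continuous_open_preimage[OF contP open_UNIV open_ball] by simp
  have linI: "smooth_on T (\<lambda>y. P (y - ?x0))" if "open T" for T
    by (rule smooth_on_linear[OF P(1) that smooth_on_diff[OF that smooth_on_id[OF that] smooth_on_const]])
  have oS1: "open S1"
    unfolding S1_def by (rule continuous_open_preimage[OF smooth_on_imp_continuous_on[OF linI[OF S(1)]] S(1) open_ball])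
  have smh: "smooth_on S1 h"
    unfolding h_def
    by (intro smooth_on_add smooth_on_diff oS1 smooth_on_id linI smooth_on_compose[OF oS1 open_ball _ linI[OF oS1] sms])
      (auto simp: S1_def)
  have smh'0: "smooth_on (P -` ball 0 d) h'"
    unfolding h'_def
    by (intro smooth_on_add smooth_on_diff oPb smooth_on_id smooth_on_linear[OF P(1)]
        smooth_on_compose[OF oPb open_ball _ smooth_on_linear[OF P(1) oPb smooth_on_id[OF oPb]] sms]) auto
  have oT1: "open T1"
    unfolding T1_def by (rule continuous_open_preimage[OF smooth_on_imp_continuous_on[OF smh'0] oPb S(1)])
  have smh': "smooth_on T1 h'" by (rule smooth_on_subset[OF smh'0]) (auto simp: T1_def)
  have Ph: "P (h y) = P (y - ?x0)" if "y \<in> S1" for y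
    using Ps[of "P (y - ?x0)"] that P(3)[OF P(2)] by (auto simp: h_def S1_def P.add P.diff)
  have h'h: "h' (h y) = y" if "y \<in> S1" for y
    unfolding h'_def Ph[OF that] by (simp add: h_def)
  have hS1: "h ` S1 \<subseteq> T1" using Ph h'h by (auto simp: T1_def S1_def)
  have Ph': "P (h' z - ?x0) = P z" if "z \<in> T1" for z
    using Ps[of "P z"] that P(3)[OF P(2)] by (auto simp: h'_def T1_def P.add P.diff)
  have hh': "h (h' z) = z" if "z \<in> T1" for z
    unfolding h_def Ph'[OF that] by (simp add: h'_def)
  have h'T1: "h' ` T1 \<subseteq> S1" using Ph' by (auto simp: T1_def S1_def)
  define c1 where "c1 = (cinv c ` S1, \<lambda>p. h (snd c p))"
  have S1sub: "S1 \<subseteq> snd c ` fst c" using S by (auto simp: S1_def)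
  have c1: "c1 \<in> B"
    unfolding c1_def by (rule chart_compose_mem[OF B c oS1 S1sub oT1 smh hS1 h'h smh' h'T1 hh'])
  have f1: "fst c1 = cinv c ` S1" and s1: "\<And>p. snd c1 p = h (snd c p)" by (auto simp: c1_def)
  have fc: "q \<in> fst c" "snd c q \<in> S1" if "q \<in> fst c1" for q
    using that cinv_chart[OF B c] S1sub by (auto simp: f1)
  define Q where "Q = {q \<in> fst c1. snd c1 q \<in> K}"
  have slice: "slice_chart B Q c1 K"
    using c1 K by (auto simp: slice_chart_def Q_def)
  have Eq: "E q = {v. chart_diff B c1 q v \<in> K}" if q: "q \<in> Q" for q
  proof -
    have q1: "q \<in> fst c1" and hK: "h (snd c q) \<in> K" using q by (auto simp: Q_def s1)
    let ?y = "snd c q" and ?a = "P (snd c q - ?x0)"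
    note qc = fc[OF q1]
    have yS: "?y \<in> S" and a: "?a \<in> ball 0 d" using qc(2) by (auto simp: S1_def)
    \<comment> \<open>A vector of K equals its projection, and with this the definition of
      \<open>h\<close> says that \<open>?y\<close> is the leaf point \<open>s ?a\<close>. There the
      derivative of \<open>s\<close> can be written with \<open>\<Phi> ?y\<close>.\<close>
    have "h ?y = ?a" using Ph[OF qc(2)] P(3)[OF hK] by simp
    then have ya: "s ?a = ?y" by (simp add: h_def)
    have "(h has_derivative (\<lambda>v. v - \<Phi> ?y (P v) + P v)) (at ?y)"
    proof -
      have Pd: "((\<lambda>y. P (y - ?x0)) has_derivative P) (at ?y)"
        using bounded_linear.has_derivative[OF Pbl has_derivative_diff[OF has_derivative_ident has_derivative_const]]
        by simp
      show ?thesis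
        unfolding h_def using has_derivative_add[OF has_derivative_diff[OF has_derivative_ident
            has_derivative_compose[OF Pd ds[OF a]]] Pd] P(3)[OF P(2)]
        by (simp add: ya \<Psi>_apply)
    qed
    then have "(snd c1 \<circ> id \<circ> cinv c has_derivative (\<lambda>v. v - \<Phi> ?y (P v) + P v)) (at ?y)"
      by (rule has_derivative_transform_within_open[OF _ oS1 qc(2)])
        (use cinv_chart(2)[OF B c] S1sub in \<open>auto simp: s1\<close>)
    then have cd: "chart_diff B c1 q v = chart_diff B c q v - \<Phi> ?y (P (chart_diff B c q v)) + P (chart_diff B c q v)" for v
      using chart_diff_change[OF B c c1 qc(1) q1] by (simp add: rep_diff_def frechet_derivative_eqI)
    \<comment> \<open>The defect \<open>w - \<Phi> ?y (P w)\<close> is killed by \<open>P\<close>,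
      whereas vectors of K are fixed by it; hence the image lies in K only if the defect
      vanishes.\<close>
    have "(\<exists>k\<in>K. w = \<Phi> ?y k) \<longleftrightarrow> w - \<Phi> ?y (P w) + P w \<in> K" for w
    proof
      assume "\<exists>k\<in>K. w = \<Phi> ?y k"
      then show "w - \<Phi> ?y (P w) + P w \<in> K" using P\<Phi>[OF yS] by auto
    next
      assume "w - \<Phi> ?y (P w) + P w \<in> K"
      then have "P (w - \<Phi> ?y (P w) + P w) = w - \<Phi> ?y (P w) + P w" by (rule P(3))
      moreover have "P (w - \<Phi> ?y (P w) + P w) = P w"
        using P\<Phi>[OF yS P(2)] P(3)[OF P(2)] by (simp add: P.add P.diff)
      ultimately have "w = \<Phi> ?y (P w)" by simp
      then show "\<exists>k\<in>K. w = \<Phi> ?y k" using P(2) by blast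
    qed
    then show ?thesis using E[OF qc(1) yS] cd by simp
  qed
  have "x \<in> Q"
  proof -
    have "?x0 \<in> S1" using x d(1) by (simp add: S1_def P.zero)
    then have "x \<in> fst c1" using cinv_chart(1)[OF B c x(1)] by (force simp: f1)
    moreover have "h ?x0 = 0" using d(2) by (simp add: h_def P.zero)
    ultimately show ?thesis using K by (simp add: Q_def s1 subspace_0)
  qed
  moreover have "integral_manifold B E Q"
    unfolding integral_manifold_def
  proof (intro ballI exI conjI)
    fix q assume q: "q \<in> Q"
    show "slice_chart B Q c1 K" "q \<in> fst c1" "E q = {v. chart_diff B c1 q v \<in> K}"
      using slice Eq[OF q] q by (auto simp: Q_def)
  qed
  ultimately show ?thesis by blast
qed

text \<open>A fixed basis of K, carried along by \<open>\<Phi>\<close>, is the required smooth local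
  frame.\<close>

lemma distribution_of_local_frame:
  fixes B :: "('n::{t2_space,second_countable_topology}, 'b::euclidean_space) chart set"
    and E :: "'n \<Rightarrow> 'b set"
  assumes B: "smooth_manifold B" and dim: "\<And>x. subspace (E x) \<and> dim (E x) = k"
    and loc: "\<And>x. \<exists>c S (\<Phi> :: 'b \<Rightarrow> 'b \<Rightarrow>\<^sub>L 'b) K. c \<in> B \<and> open S \<and> S \<subseteq> snd c ` fst c \<and> x \<in> fst c \<and> snd c x \<in> S \<and>
      smooth_on S \<Phi> \<and> subspace K \<and> dim K = k \<and>
      (\<forall>p\<in>fst c. snd c p \<in> S \<longrightarrow> E p = {v. \<exists>k\<in>K. chart_diff B c p v = blinfun_apply (\<Phi> (snd c p)) k})"
  shows "distribution B E"
  unfolding distribution_def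
proof (intro exI[of _ k] conjI allI)
  show "subspace (E x)" "dim (E x) = k" for x using dim by auto
  fix x
  obtain c S and \<Phi> :: "'b \<Rightarrow> 'b \<Rightarrow>\<^sub>L 'b" and K where c: "c \<in> B" and S: "open S" "S \<subseteq> snd c ` fst c"
    and x: "x \<in> fst c" "snd c x \<in> S" and \<Phi>: "smooth_on S \<Phi>" and K: "subspace K" "dim K = k"
    and E: "\<And>p. p \<in> fst c \<Longrightarrow> snd c p \<in> S \<Longrightarrow> E p = {v. \<exists>k\<in>K. chart_diff B c p v = blinfun_apply (\<Phi> (snd c p)) k}"
    using loc[of x] by blast
  obtain Bs where Bs: "Bs \<subseteq> K" "independent Bs" "K \<subseteq> span Bs" "card Bs = k"
    using basis_exists[of K] K(2) by metis
  have spanBs: "span Bs = K" using Bs K(1) by (simp add: span_minimal subset_antisym)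
  have "finite Bs" using Bs(2) by (rule independent_imp_finite)
  then obtain e where e: "bij_betw e {..<k} Bs"
    using Bs(4) by (metis ex_bij_betw_nat_finite atLeast0LessThan)
  define U where "U = fst c \<inter> snd c -` S"
  define X where "X i q = coord_vec B c (\<Phi> (snd c q) (e i)) q" for i :: nat and q
  have oU: "open U"
    unfolding U_def by (rule continuous_open_preimage[OF manifold_chart(4,1)[OF B c] S(1)])
  have "smooth_vf B U (X i)" for i
  proof (rule smooth_vf_chartI[OF B c oU])
    show "U \<subseteq> fst c" by (auto simp: U_def)
    have cU: "snd c ` U \<subseteq> S" by (auto simp: U_def)
    have oI: "open (snd c ` U)" by (rule open_image_chart[OF B c oU]) (auto simp: U_def)
    show "smooth_on (snd c ` U) (vf_rep B c (X i))"
    proof (rule smooth_on_cong[OF oI])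
      show "vf_rep B c (X i) y = \<Phi> y (e i)" if "y \<in> snd c ` U" for y
      proof -
        have "y \<in> snd c ` fst c" using that by (auto simp: U_def)
        then show ?thesis
          using chart_diff_coord_vec(1)[OF B c cinv_chart(3)[OF B c]] cinv_chart(2)[OF B c]
          by (simp add: vf_rep_def X_def)
      qed
      show "smooth_on (snd c ` U) (\<lambda>y. blinfun_apply (\<Phi> y) (e i))"
        by (rule smooth_on_blinfun_apply[OF oI smooth_on_subset[OF \<Phi> cU] smooth_on_const])
    qed
  qed
  moreover have "E q = span ((\<lambda>i. X i q) ` {..<k})" if "q \<in> U" for q
  proof -
    have q: "q \<in> fst c" "snd c q \<in> S" using that by (auto simp: U_def)
    let ?F = "\<lambda>v. coord_vec B c (\<Phi> (snd c q) v) q"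
    have lin: "linear ?F"
      using linear_compose[OF bounded_linear.linear[OF blinfun.bounded_linear_right] chart_diff_coord_vec(3)[OF B c q(1)]]
      by (simp add: o_def)
    have "(\<lambda>i. X i q) ` {..<k} = ?F ` Bs"
      using e by (auto simp: X_def bij_betw_def image_image[symmetric])
    then have "span ((\<lambda>i. X i q) ` {..<k}) = ?F ` K"
      using linear_span_image[OF lin, of Bs] spanBs by simp
    also have "\<dots> = E q"
      using E[OF q] chart_diff_coord_vec(1,2)[OF B c q(1)] by (auto simp: image_iff) metis
    finally show ?thesis ..
  qed
  ultimately show "\<exists>U X. open U \<and> x \<in> U \<and> (\<forall>i<k. smooth_vf B U (X i)) \<and> (\<forall>y\<in>U. E y = span ((\<lambda>i. X i y) ` {..<k}))"
    using oU x by (intro exI[of _ U] exI[of _ X]) (auto simp: U_def)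
qed

section \<open>The fundamental two-forms\<close>

text \<open>The sign in the compatibility with \<open>g\<close> and the sign in the square of
  \<open>J\<close> are governed by the same \<open>pq_sign\<close>, so they cancel and all three
  structures are skew, whether complex or product-like.\<close>

lemma canonical_basis_skew:
  assumes herm: "almost_paraquaternionic_hermitian A \<sigma> g" and J: "canonical_local_basis A \<sigma> U J" and p: "p \<in> U"
  shows "g p (J \<alpha> p u) v = - g p u (J \<alpha> p v)"
proof -
  have bil: "bilinear (g p)"
    using herm unfolding almost_paraquaternionic_hermitian_def semi_riemannian_metric_def by blast
  have e: "pq_sign \<alpha> \<noteq> 0" by (simp add: pq_sign_def)
  have "J \<alpha> p o\<^sub>L J \<alpha> p = - pq_sign \<alpha> *\<^sub>R id_blinfun"
    using J p unfolding canonical_local_basis_def by blast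
  then have "J \<alpha> p (J \<alpha> p v) = - pq_sign \<alpha> *\<^sub>R v"
    by (metis blinfun_apply_blinfun_compose blinfun_apply_id_blinfun scaleR_blinfun.rep_eq)
  moreover have "g p (J \<alpha> p u) (J \<alpha> p (J \<alpha> p v)) = pq_sign \<alpha> * g p u (J \<alpha> p v)"
    using herm J p unfolding almost_paraquaternionic_hermitian_def by blast
  ultimately have "- pq_sign \<alpha> * g p (J \<alpha> p u) v = pq_sign \<alpha> * g p u (J \<alpha> p v)"
    using bilinear_rmul[OF bil] by (metis real_scaleR_def)
  then have "pq_sign \<alpha> * (g p (J \<alpha> p u) v + g p u (J \<alpha> p v)) = 0" by (simp add: distrib_left)
  then show ?thesis using e by simp
qed

lemma smooth_vf_coord_vec:
  assumes A: "smooth_manifold A" "c \<in> A" and U: "open U" "U \<subseteq> fst c"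
  shows "smooth_vf A U (coord_vec A c v)"
proof (rule smooth_vf_chartI[OF A U smooth_on_cong[OF open_image_chart[OF A U] _ smooth_on_const]])
  show "vf_rep A c (coord_vec A c v) y = v" if "y \<in> snd c ` U" for y
    using that U cinv_chart[OF A] chart_diff_coord_vec(1)[OF A] by (auto simp: vf_rep_def)
qed

text \<open>Smoothness of the metric is available only on pairs of coordinate fields with constant
  components. The components of \<open>J v\<close> vary, so they are expanded in the basis and
  multiplied with these coefficients.\<close>

lemma fundamental_form_smooth:
  assumes A: "smooth_manifold A" and g: "semi_riemannian_metric A g" and c: "c \<in> A"
    and s: "smooth_endo A U s" "open U"
  shows "smooth_on (snd c ` (U \<inter> fst c))
    (\<lambda>z. g (cinv c z) (coord_vec A c u (cinv c z)) (s (cinv c z) (coord_vec A c v (cinv c z))))"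
proof -
  let ?T = "snd c ` (U \<inter> fst c)"
  have oT: "open ?T"
    by (rule open_image_chart[OF A c]) (use s(2) manifold_chart(1)[OF A c] in auto)
  let ?X = "\<lambda>z. chart_diff A c (cinv c z) (s (cinv c z) (coord_vec A c v (cinv c z)))"
  let ?G = "\<lambda>z b. g (cinv c z) (coord_vec A c u (cinv c z)) (coord_vec A c b (cinv c z))"
  show ?thesis
  proof (rule smooth_on_cong[OF oT])
    fix z assume "z \<in> ?T"
    then have q: "cinv c z \<in> fst c" using cinv_chart[OF A c] by auto
    let ?q = "cinv c z"
    have "bilinear (g ?q)" using g unfolding semi_riemannian_metric_def by blast
    then have "linear (\<lambda>w. g ?q (coord_vec A c u ?q) w)" by (simp add: bilinear_def)
    from linear_compose[OF chart_diff_coord_vec(3)[OF A c q] this]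
    have "linear (?G z)" by (simp add: o_def)
    then interpret linear "?G z" .
    have "g ?q (coord_vec A c u ?q) (s ?q (coord_vec A c v ?q)) = ?G z (?X z)"
      using chart_diff_coord_vec(2)[OF A c q] by simp
    also have "\<dots> = ?G z (\<Sum>b\<in>Basis. (?X z \<bullet> b) *\<^sub>R b)" by (simp only: euclidean_representation)
    also have "\<dots> = (\<Sum>b\<in>Basis. (?X z \<bullet> b) *\<^sub>R ?G z b)" by (simp only: sum scaleR)
    finally show "g ?q (coord_vec A c u ?q) (s ?q (coord_vec A c v ?q)) = (\<Sum>b\<in>Basis. (?X z \<bullet> b) *\<^sub>R ?G z b)" .
  next
    have "smooth_on ?T ?X" using s(1) c unfolding smooth_endo_def by blast
    moreover have "smooth_on ?T (\<lambda>z. ?G z b)" for b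
    proof (rule smooth_on_subset)
      show "smooth_on (snd c ` fst c) (\<lambda>z. ?G z b)"
        using g c unfolding semi_riemannian_metric_def by blast
    qed auto
    ultimately show "smooth_on ?T (\<lambda>z. \<Sum>b\<in>Basis. (?X z \<bullet> b) *\<^sub>R ?G z b)"
      by (intro smooth_on_sum smooth_on_scaleR smooth_on_inner smooth_on_const oT)
  qed
qed

text \<open>The torsion-free connection identifies the exterior derivative of \<open>g(\<cdot>, J \<cdot>)\<close> with the cyclic
  sum of \<open>g(u, (\<nabla>\<^sub>w J) v)\<close>, and \<open>\<nabla>\<^sub>w J\<close> lies in the parallel bundle \<open>\<sigma>\<close>.\<close>

lemma fundamental_form_differential:
  fixes \<alpha> :: 3
  assumes A: "smooth_manifold A" and pk: "paraquaternionic_kaehler A \<sigma> g"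
    and J: "canonical_local_basis A \<sigma> U J" and p: "p \<in> U" and c: "c = pref_chart A p"
  defines "\<Omega> \<equiv> \<lambda>u v z. g (cinv c z) (coord_vec A c u (cinv c z)) (J \<alpha> (cinv c z) (coord_vec A c v (cinv c z)))"
  obtains L where "\<And>w. L w \<in> \<sigma> p"
    "\<And>u v w. frechet_derivative (\<Omega> u v) (at (snd c p)) w + frechet_derivative (\<Omega> v w) (at (snd c p)) u
      + frechet_derivative (\<Omega> w u) (at (snd c p)) v
      = g p u (blinfun_apply (L w) v) + g p v (blinfun_apply (L u) w) + g p w (blinfun_apply (L v) u)"
proof -
  have herm: "almost_paraquaternionic_hermitian A \<sigma> g" using pk unfolding paraquaternionic_kaehler_def by blast
  then have g: "semi_riemannian_metric A g" unfolding almost_paraquaternionic_hermitian_def by blast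
  obtain nab where lc: "levi_civita A g nab" and par: "parallel_subbundle A nab \<sigma>"
    using pk unfolding paraquaternionic_kaehler_def by blast
  have bil: "bilinear (g p)" and sym: "\<And>u v. g p u v = g p v u"
    using g unfolding semi_riemannian_metric_def by blast+
  have cA: "c \<in> A" and pc: "p \<in> fst c" using pref_chart[OF A] by (auto simp: c)
  have oU: "open U" and Jsm: "smooth_endo A U (J \<alpha>)" and J\<sigma>: "\<And>q. q \<in> U \<Longrightarrow> J \<alpha> q \<in> \<sigma> q"
    using J unfolding canonical_local_basis_def by (auto intro: span_base)
  define V where "V = U \<inter> fst c"
  have oV: "open V" and Vc: "V \<subseteq> fst c" and pV: "p \<in> V"
    using oU manifold_chart(1)[OF A cA] p pc by (auto simp: V_def)
  let ?z = "snd c p"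
  let ?dd = "\<lambda>v. coord_vec A c v"
  let ?Jd = "\<lambda>v q. blinfun_apply (J \<alpha> q) (coord_vec A c v q)"
  have ddp: "?dd v p = v" for v
    by (simp add: coord_vec_def c chart_diff_pref_chart[OF A])
  have smd: "smooth_vf A V (?dd v)" for v by (rule smooth_vf_coord_vec[OF A cA oV Vc])
  have smJd: "smooth_vf A V (?Jd v)" for v
    by (rule smooth_vf_chartI[OF A cA oV Vc])
      (use Jsm cA in \<open>simp add: smooth_endo_def vf_rep_def[abs_def] V_def\<close>)
  have "\<exists>L\<in>\<sigma> p. has_endo_deriv A nab (J \<alpha>) p w L" for w
    using par oU Jsm J\<sigma> p unfolding parallel_subbundle_def by blast
  then obtain L where L\<sigma>: "\<And>w. L w \<in> \<sigma> p" and L: "\<And>w. has_endo_deriv A nab (J \<alpha>) p w (L w)"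
    by metis
  \<comment> \<open>The Christoffel symbols in the preferred chart at \<open>p\<close>, read as a
    map of two tangent vectors at \<open>p\<close>.\<close>
  define \<Gamma> where "\<Gamma> w v = nab (?dd v) p w" for w v
  have Lv: "nab (?Jd v) p w = blinfun_apply (L w) v + J \<alpha> p (\<Gamma> w v)" for v w
  proof -
    have "blinfun_apply (L w) (?dd v p) = nab (?Jd v) p w - J \<alpha> p (nab (?dd v) p w)"
      using L[of w] oV pV smd unfolding has_endo_deriv_def by blast
    then show ?thesis by (simp add: ddp \<Gamma>_def)
  qed
  \<comment> \<open>Coordinate fields have constant representation, hence zero bracket, and
    vanishing torsion gives the symmetry.\<close>
  have \<Gamma>sym: "\<Gamma> u v = \<Gamma> v u" for u v
  proof -
    have d0: "frechet_derivative (vf_rep A c (?dd v)) (at ?z) = (\<lambda>w. 0)" for v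
    proof (rule frechet_derivative_eqI, rule has_derivative_transform_within_open)
      show "((\<lambda>_. v) has_derivative (\<lambda>w. 0)) (at ?z)" by (rule has_derivative_const)
      show "open (snd c ` fst c)" by (rule manifold_chart(2)[OF A cA])
      show "?z \<in> snd c ` fst c" using pc by blast
      show "v = vf_rep A c (?dd v) y" if "y \<in> snd c ` fst c" for y
        using that chart_diff_coord_vec(1)[OF A cA] cinv_chart(3)[OF A cA that] by (simp add: vf_rep_def)
    qed
    have "nab (?dd v) p (?dd u p) - nab (?dd u) p (?dd v p) = lie_bracket A (?dd u) (?dd v) p"
      using lc oV pV smd unfolding levi_civita_def by blast
    also have "\<dots> = 0" using d0 by (simp add: lie_bracket_def Let_def c[symmetric])
    finally show ?thesis by (simp add: \<Gamma>_def ddp)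
  qed
  have D: "frechet_derivative (\<Omega> u v) (at ?z) w
      = g p (\<Gamma> w u) (J \<alpha> p v) + g p u (blinfun_apply (L w) v) - g p (J \<alpha> p u) (\<Gamma> w v)" for u v w
  proof -
    have "frechet_derivative (\<Omega> u v) (at ?z) w = fun_diff A (\<lambda>q. g q (?dd u q) (?Jd v q)) p w"
      by (simp add: fun_diff_def \<Omega>_def c[symmetric] o_def)
    also have "\<dots> = g p (nab (?dd u) p w) (?Jd v p) + g p (?dd u p) (nab (?Jd v) p w)"
      using lc oV pV smd smJd unfolding levi_civita_def by blast
    also have "\<dots> = g p (\<Gamma> w u) (J \<alpha> p v) + g p u (blinfun_apply (L w) v + J \<alpha> p (\<Gamma> w v))"
      by (simp add: ddp \<Gamma>_def Lv[unfolded \<Gamma>_def])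
    also have "\<dots> = g p (\<Gamma> w u) (J \<alpha> p v) + g p u (blinfun_apply (L w) v) - g p (J \<alpha> p u) (\<Gamma> w v)"
      using canonical_basis_skew[OF herm J p, of \<alpha> u "\<Gamma> w v"] by (simp add: bilinear_radd[OF bil])
    finally show ?thesis .
  qed
  show ?thesis
  proof (rule that[of L])
    show "L w \<in> \<sigma> p" for w by (rule L\<sigma>)
    fix u v w
    show "frechet_derivative (\<Omega> u v) (at (snd c p)) w + frechet_derivative (\<Omega> v w) (at (snd c p)) u
      + frechet_derivative (\<Omega> w u) (at (snd c p)) v
      = g p u (blinfun_apply (L w) v) + g p v (blinfun_apply (L u) w) + g p w (blinfun_apply (L v) u)"
      \<comment> \<open>The six Christoffel terms cancel in pairs: \<open>\<Gamma> w u\<close> is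
        paired with \<open>J v\<close> in the first summand and, with opposite sign,
        \<open>\<Gamma> u w\<close> in the second, and cyclically.\<close>
      unfolding D using \<Gamma>sym[of w u] \<Gamma>sym[of w v] \<Gamma>sym[of u v]
      by (simp add: sym[of "J \<alpha> p u"] sym[of "J \<alpha> p v"] sym[of "J \<alpha> p w"])
  qed
qed

text \<open>A coordinate form of the identity for the differential of a pulled-back two-form,
  evaluated on \<open>Y\<close>, \<open>Z\<close> and a constant field \<open>w\<close>. The
  functions obtained by inserting two of these fields all vanish identically, since \<open>Y\<close>
  and \<open>Z\<close> take values in the kernel, so their derivatives may be added freely. The
  assumption \<open>closed\<close> concerns only triples containing both \<open>Y\<close> and
  \<open>Z\<close>.\<close>

lemma pullback_kernel_involutive:
  fixes F :: "'b::euclidean_space \<Rightarrow> 'a::euclidean_space" and \<Omega> :: "'a \<Rightarrow> 'a \<Rightarrow>\<^sub>L 'a \<Rightarrow>\<^sub>L real"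
  assumes R: "open R" "y0 \<in> R" and F: "\<And>y. y \<in> R \<Longrightarrow> (F has_derivative blinfun_apply (G y)) (at y)"
    and G: "(G has_derivative G') (at y0)" and \<Omega>: "(\<Omega> has_derivative \<Omega>') (at (F y0))"
    and Y: "(Y has_derivative Y') (at y0)" and Z: "(Z has_derivative Z') (at y0)"
    and alt: "\<And>y u v. y \<in> R \<Longrightarrow> \<Omega> (F y) u v = - \<Omega> (F y) v u"
    and kY: "\<And>y w. y \<in> R \<Longrightarrow> \<Omega> (F y) (G y (Y y)) (G y w) = 0"
    and kZ: "\<And>y w. y \<in> R \<Longrightarrow> \<Omega> (F y) (G y (Z y)) (G y w) = 0"
    and closed: "\<Omega>' (G y0 w) (G y0 (Y y0)) (G y0 (Z y0)) + \<Omega>' (G y0 (Y y0)) (G y0 (Z y0)) (G y0 w)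
      + \<Omega>' (G y0 (Z y0)) (G y0 w) (G y0 (Y y0)) = 0"
  shows "\<Omega> (F y0) (G y0 (Z' (Y y0) - Y' (Z y0))) (G y0 w) = 0"
proof -
  have G'sym: "blinfun_apply (G' u) v = blinfun_apply (G' v) u" for u v
    by (rule frechet_derivative_commute[OF R, where f = F and f' = "\<lambda>y. blinfun_apply (G y)"
        and A = "\<lambda>u. blinfun_apply (G' u) v" and B = "\<lambda>v. blinfun_apply (G' v) u" and u = v and v = u])
      (use F bounded_linear.has_derivative[OF blinfun.bounded_linear_left G] in auto)
  note app = bounded_bilinear.FDERIV[OF bounded_bilinear_blinfun_apply]
  have \<Omega>F: "((\<lambda>y. \<Omega> (F y)) has_derivative (\<lambda>t. \<Omega>' (G y0 t))) (at y0)"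
    by (rule has_derivative_compose[OF F[OF R(2)] \<Omega>])
  have product: "\<Omega>' (G y0 t) (G y0 (X y0)) (G y0 (W y0))
      + \<Omega> (F y0) (G' t (X y0) + G y0 (X' t)) (G y0 (W y0))
      + \<Omega> (F y0) (G y0 (X y0)) (G' t (W y0) + G y0 (W' t)) = 0"
    if X: "(X has_derivative X') (at y0)" and W: "(W has_derivative W') (at y0)"
      and z: "\<And>y. y \<in> R \<Longrightarrow> \<Omega> (F y) (G y (X y)) (G y (W y)) = 0" for X W X' W' t
  proof -
    have "((\<lambda>y. \<Omega> (F y) (G y (X y)) (G y (W y))) has_derivative
        (\<lambda>t. \<Omega> (F y0) (G y0 (X y0)) (G y0 (W' t) + G' t (W y0))
          + (\<Omega> (F y0) (G y0 (X' t) + G' t (X y0)) + \<Omega>' (G y0 t) (G y0 (X y0))) (G y0 (W y0)))) (at y0)"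
      by (rule app[OF app[OF \<Omega>F app[OF G X]] app[OF G W]])
    moreover have "((\<lambda>y. \<Omega> (F y) (G y (X y)) (G y (W y))) has_derivative (\<lambda>t. 0)) (at y0)"
      by (rule has_derivative_transform_within_open[OF has_derivative_const R]) (simp add: z)
    ultimately have "(\<lambda>t. \<Omega> (F y0) (G y0 (X y0)) (G y0 (W' t) + G' t (W y0))
          + (\<Omega> (F y0) (G y0 (X' t) + G' t (X y0)) + \<Omega>' (G y0 t) (G y0 (X y0))) (G y0 (W y0))) = (\<lambda>t. 0)"
      by (rule has_derivative_unique)
    from fun_cong[OF this, of t] show ?thesis by (simp add: blinfun.bilinear_simps algebra_simps)
  qed
  note k0 = kY[OF R(2)] kZ[OF R(2)]
  have kY': "\<Omega> (F y0) u (G y0 (Y y0)) = - \<Omega> (F y0) (G y0 (Y y0)) u" for u by (rule alt[OF R(2)])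
  have kZ': "\<Omega> (F y0) u (G y0 (Z y0)) = - \<Omega> (F y0) (G y0 (Z y0)) u" for u by (rule alt[OF R(2)])
  have kY2: "\<Omega> (F y) (G y w) (G y (Y y)) = 0" if "y \<in> R" for y
    using alt[OF that, of "G y w" "G y (Y y)"] kY[OF that] by simp
  have 1: "\<Omega>' (G y0 (Z y0)) (G y0 w) (G y0 (Y y0)) + \<Omega> (F y0) (G' (Z y0) w) (G y0 (Y y0))
      + \<Omega> (F y0) (G y0 w) (G' (Z y0) (Y y0) + G y0 (Y' (Z y0))) = 0"
    using product[OF has_derivative_const[of w] Y kY2, of "Z y0"] by (simp add: blinfun.zero_right)
  have 2: "\<Omega>' (G y0 (Y y0)) (G y0 (Z y0)) (G y0 w) + \<Omega> (F y0) (G' (Y y0) (Z y0) + G y0 (Z' (Y y0))) (G y0 w)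
      + \<Omega> (F y0) (G y0 (Z y0)) (G' (Y y0) w) = 0"
    using product[OF Z has_derivative_const[of w] kZ, of "Y y0"] by (simp add: blinfun.zero_right)
  have 3: "\<Omega>' (G y0 w) (G y0 (Y y0)) (G y0 (Z y0)) + \<Omega> (F y0) (G' w (Y y0) + G y0 (Y' w)) (G y0 (Z y0))
      + \<Omega> (F y0) (G y0 (Y y0)) (G' w (Z y0) + G y0 (Z' w)) = 0"
    by (rule product[OF Y Z kY])
  have 4: "\<Omega> (F y0) (G y0 w) u = - \<Omega> (F y0) u (G y0 w)" for u by (rule alt[OF R(2)])
  \<comment> \<open>In the sum of the three identities \<open>closed\<close> removes the derivatives
    of \<open>\<Omega>\<close>, the second derivatives of \<open>F\<close> cancel in pairs by their
    symmetry and alternation, and \<open>Y' w\<close> and \<open>Z' w\<close> disappear because they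
    are paired with kernel vectors. The bracket term remains.\<close>
  show ?thesis
    using 1 2 3 closed k0 G'sym[of "Z y0" "Y y0"] G'sym[of "Z y0" w] G'sym[of "Y y0" w]
    by (simp add: blinfun.bilinear_simps kY' kZ' 4)
qed

section \<open>Paraquaternionic CR-submanifolds\<close>

text \<open>Currying turns the family of coefficient functions into one operator-valued map, which
  can be composed with the coordinate form of the immersion and differentiated as a whole. With the
  identity for \<open>s\<close> it also covers the metric.\<close>

lemma form_blinfun:
  fixes A :: "('m::{t2_space,second_countable_topology}, 'a::euclidean_space) chart set"
  assumes A: "smooth_manifold A" and g: "semi_riemannian_metric A g" and c: "c \<in> A"
    and s: "smooth_endo A U s" "open U"
  obtains \<Omega> :: "'a \<Rightarrow> 'a \<Rightarrow>\<^sub>L 'a \<Rightarrow>\<^sub>L real" where "smooth_on (snd c ` (U \<inter> fst c)) \<Omega>"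
    "\<And>z u v. z \<in> snd c ` (U \<inter> fst c) \<Longrightarrow> blinfun_apply (blinfun_apply (\<Omega> z) u) v
      = g (cinv c z) (coord_vec A c u (cinv c z)) (s (cinv c z) (coord_vec A c v (cinv c z)))"
proof -
  let ?T = "snd c ` (U \<inter> fst c)"
  let ?w = "\<lambda>u v z. g (cinv c z) (coord_vec A c u (cinv c z)) (s (cinv c z) (coord_vec A c v (cinv c z)))"
  have oT: "open ?T"
    by (rule open_image_chart[OF A c]) (use s(2) manifold_chart(1)[OF A c] in auto)
  have lin: "linear (\<lambda>v. ?w u v z)" "linear (\<lambda>u. ?w u v z)" if "z \<in> ?T" for z u v
  proof -
    have q: "cinv c z \<in> fst c" using cinv_chart[OF A c] that by auto
    have bil: "bilinear (g (cinv c z))" using g unfolding semi_riemannian_metric_def by blast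
    have "linear (\<lambda>v. s (cinv c z) (coord_vec A c v (cinv c z)))"
      using linear_compose[OF chart_diff_coord_vec(3)[OF A c q] bounded_linear.linear[OF blinfun.bounded_linear_right]]
      by (simp add: o_def)
    from linear_compose[OF this, of "g (cinv c z) (coord_vec A c u (cinv c z))"]
    show "linear (\<lambda>v. ?w u v z)" using bil by (simp add: bilinear_def o_def)
    from linear_compose[OF chart_diff_coord_vec(3)[OF A c q], of "\<lambda>x. g (cinv c z) x (s (cinv c z) (coord_vec A c v (cinv c z)))"]
    show "linear (\<lambda>u. ?w u v z)" using bil by (simp add: bilinear_def o_def)
  qed
  define I where "I z u = Blinfun (\<lambda>v. ?w u v z)" for z u
  have I: "blinfun_apply (I z u) v = ?w u v z" if "z \<in> ?T" for z u v
    using lin(1)[OF that] by (simp add: I_def bounded_linear_Blinfun_apply linear_conv_bounded_linear)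
  have smI: "smooth_on ?T (\<lambda>z. I z u)" for u
    unfolding I_def
    by (rule smooth_on_linear_fields[OF oT]) (rule lin(1), assumption, rule fundamental_form_smooth[OF A g c s])
  have linI: "linear (I z)" if "z \<in> ?T" for z
  proof (rule linearI)
    show "I z (u + u') = I z u + I z u'" for u u'
      by (rule blinfun_eqI) (simp add: I[OF that] blinfun.add_left linear_add[OF lin(2)[OF that]])
    show "I z (r *\<^sub>R u) = r *\<^sub>R I z u" for r u
      by (rule blinfun_eqI) (simp add: I[OF that] blinfun.scaleR_left linear_scale[OF lin(2)[OF that]])
  qed
  show ?thesis
  proof
    show "smooth_on ?T (\<lambda>z. Blinfun (I z))" by (rule smooth_on_linear_fields[OF oT linI smI])
    show "blinfun_apply (blinfun_apply (Blinfun (I z)) u) v = ?w u v z" if "z \<in> ?T" for z u v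
      using linI[OF that] I[OF that] by (simp add: bounded_linear_Blinfun_apply linear_conv_bounded_linear)
  qed
qed

text \<open>Translates between the coordinate pull-back, which is differentiated, and tangent
  vectors at points of the submanifold, for which the CR conditions are stated.\<close>

lemma pullback_form:
  fixes A :: "('m::{t2_space,second_countable_topology}, 'a::euclidean_space) chart set"
    and B :: "('n::{t2_space,second_countable_topology}, 'b::euclidean_space) chart set"
    and \<Omega> :: "'a \<Rightarrow> 'a \<Rightarrow>\<^sub>L 'a \<Rightarrow>\<^sub>L real" and s :: "'m \<Rightarrow> 'a \<Rightarrow>\<^sub>L 'a"
  assumes A: "smooth_manifold A" and B: "smooth_manifold B" and f: "smooth_map B A f"
    and c: "c \<in> A" and c0: "c0 \<in> B" and y: "y \<in> snd c0 ` (fst c0 \<inter> f -` (U \<inter> fst c))"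
    and \<Omega>: "\<And>z u v. z \<in> snd c ` (U \<inter> fst c) \<Longrightarrow> blinfun_apply (blinfun_apply (\<Omega> z) u) v
      = g (cinv c z) (coord_vec A c u (cinv c z)) (s (cinv c z) (coord_vec A c v (cinv c z)))"
  defines "F \<equiv> snd c \<circ> f \<circ> cinv c0"
  shows "blinfun_apply (blinfun_apply (\<Omega> (F y)) (blinfun_apply (Blinfun (frechet_derivative F (at y))) u))
      (blinfun_apply (Blinfun (frechet_derivative F (at y))) v)
    = g (f (cinv c0 y)) (tangent_map B A f (cinv c0 y) (coord_vec B c0 u (cinv c0 y)))
        (s (f (cinv c0 y)) (tangent_map B A f (cinv c0 y) (coord_vec B c0 v (cinv c0 y))))"
proof -
  let ?q = "cinv c0 y"
  have q: "?q \<in> fst c0" "snd c0 ?q = y" "f ?q \<in> U" "f ?q \<in> fst c"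
    using y cinv_chart(1)[OF B c0] by auto
  have Fy: "F y \<in> snd c ` (U \<inter> fst c)" "cinv c (F y) = f ?q"
    using q cinv_chart(1)[OF A c] by (auto simp: F_def)
  have "F differentiable at y"
    using rep_diff_has_derivative[OF B A f c0 c q(1,4)] by (auto simp: F_def q(2) differentiable_def)
  then have "blinfun_apply (Blinfun (frechet_derivative F (at y))) = rep_diff f c0 c ?q"
    by (simp add: blinfun_apply_Blinfun_derivative) (simp add: F_def rep_diff_def q(2))
  then show ?thesis
    using tangent_map_coord_vec[OF B A f c0 c q(1,4)] by (simp add: \<Omega>[OF Fy(1)] Fy(2))
qed

text \<open>In one direction \<open>J\<close> maps E into the normal space and skewness moves
  \<open>J\<close> to the other factor. In the other, \<open>J\<close> maps D onto itself, so every
  tangent vector in D has the form \<open>J\<close> of a tangent vector and is orthogonal to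
  \<open>v\<close>.\<close>

lemma CR_kernel:
  assumes herm: "almost_paraquaternionic_hermitian A \<sigma> g" and CR: "paraquaternionic_CR_submanifold B A f \<sigma> g D"
    and J: "canonical_local_basis A \<sigma> U J" and q: "f q \<in> U"
  shows "v \<in> orth_distribution (induced_metric B A f g) D q \<longleftrightarrow>
    (\<forall>w. g (f q) (tangent_map B A f q v) (J \<alpha> (f q) (tangent_map B A f q w)) = 0)"
proof
  let ?t = "tangent_map B A f q" and ?E = "orth_distribution (induced_metric B A f g) D q"
  have inc: "J \<alpha> (f q) ` ?t ` D q = ?t ` D q" "J \<alpha> (f q) ` ?t ` ?E \<subseteq> normal_space B A f g q"
    using CR J q unfolding paraquaternionic_CR_submanifold_def by blast+
  show "\<forall>w. g (f q) (?t v) (J \<alpha> (f q) (?t w)) = 0" if "v \<in> ?E"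
  proof
    fix w
    have "J \<alpha> (f q) (?t v) \<in> normal_space B A f g q" using inc(2) that by blast
    then have "g (f q) (J \<alpha> (f q) (?t v)) (?t w) = 0" by (simp add: normal_space_def)
    then show "g (f q) (?t v) (J \<alpha> (f q) (?t w)) = 0"
      using canonical_basis_skew[OF herm J q] by simp
  qed
  show "v \<in> ?E" if "\<forall>w. g (f q) (?t v) (J \<alpha> (f q) (?t w)) = 0"
  proof -
    have "g (f q) (?t v) (?t d) = 0" if "d \<in> D q" for d
    proof -
      have "?t d \<in> J \<alpha> (f q) ` ?t ` D q" using inc(1) that by blast
      then show ?thesis using \<open>\<forall>w. _ w = 0\<close> by auto
    qed
    then show ?thesis by (simp add: orth_distribution_def induced_metric_def)
  qed
qed

text \<open>The covariant derivative of one \<open>J\<close> is some element of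
  \<open>\<sigma>\<close>, so the vanishing on the canonical basis has to be extended to its span,
  with the vector of E in either slot.\<close>

lemma CR_span_vanishing:
  assumes herm: "almost_paraquaternionic_hermitian A \<sigma> g" and CR: "paraquaternionic_CR_submanifold B A f \<sigma> g D"
    and J: "canonical_local_basis A \<sigma> U J" and q: "f q \<in> U" and L: "L \<in> \<sigma> (f q)"
    and v: "v \<in> orth_distribution (induced_metric B A f g) D q"
  shows "g (f q) (tangent_map B A f q v) (blinfun_apply L (tangent_map B A f q w)) = 0"
    "g (f q) (tangent_map B A f q w) (blinfun_apply L (tangent_map B A f q v)) = 0"
proof -
  let ?t = "tangent_map B A f q"
  have bil: "bilinear (g (f q))" and sym: "\<And>u v. g (f q) u v = g (f q) v u"
    using herm unfolding almost_paraquaternionic_hermitian_def semi_riemannian_metric_def by blast+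
  let ?N = "{L. g (f q) (?t v) (blinfun_apply L (?t w)) = 0 \<and> g (f q) (?t w) (blinfun_apply L (?t v)) = 0}"
  have "subspace ?N"
    unfolding subspace_def
    by (simp add: blinfun.bilinear_simps bilinear_rzero[OF bil] bilinear_radd[OF bil] bilinear_rmul[OF bil])
  moreover have "range (\<lambda>\<alpha>. J \<alpha> (f q)) \<subseteq> ?N"
  proof (rule image_subsetI)
    fix \<alpha>
    have "g (f q) (?t v) (J \<alpha> (f q) (?t w)) = 0"
      using CR_kernel[OF herm CR J q, of v] v by blast
    then show "J \<alpha> (f q) \<in> ?N"
      using canonical_basis_skew[OF herm J q, of \<alpha> "?t w" "?t v"] sym[of "?t v"] by simp
  qed
  moreover have "\<sigma> (f q) = span (range (\<lambda>\<alpha>. J \<alpha> (f q)))"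
    using J q unfolding canonical_local_basis_def by blast
  ultimately have "\<sigma> (f q) \<subseteq> ?N" by (simp add: span_minimal)
  then show "g (f q) (?t v) (blinfun_apply L (?t w)) = 0" "g (f q) (?t w) (blinfun_apply L (?t v)) = 0"
    using L by auto
qed

text \<open>\<open>Y\<close> and \<open>Z\<close> are component fields in a fixed chart, so the
  difference of derivatives is their bracket. The form of \<open>J 1\<close> alone decides
  membership in E by \<open>CR_kernel\<close>; its differential involves arbitrary elements of
  \<open>\<sigma>\<close>, which \<open>CR_span_vanishing\<close> handles.\<close>

lemma CR_orth_involutive:
  fixes A :: "('m::{t2_space,second_countable_topology}, 'a::euclidean_space) chart set"
    and B :: "('n::{t2_space,second_countable_topology}, 'b::euclidean_space) chart set"
  assumes A: "smooth_manifold A" and pk: "paraquaternionic_kaehler A \<sigma> g" and B: "smooth_manifold B"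
    and CR: "paraquaternionic_CR_submanifold B A f \<sigma> g D"
    and c0: "c0 \<in> B" and R: "open R" "R \<subseteq> snd c0 ` fst c0" and y0: "y0 \<in> R"
    and Y: "smooth_on R Y" and Z: "smooth_on R Z"
    and YE: "\<And>y. y \<in> R \<Longrightarrow> coord_vec B c0 (Y y) (cinv c0 y) \<in> orth_distribution (induced_metric B A f g) D (cinv c0 y)"
    and ZE: "\<And>y. y \<in> R \<Longrightarrow> coord_vec B c0 (Z y) (cinv c0 y) \<in> orth_distribution (induced_metric B A f g) D (cinv c0 y)"
  shows "coord_vec B c0 (frechet_derivative Z (at y0) (Y y0) - frechet_derivative Y (at y0) (Z y0)) (cinv c0 y0)
    \<in> orth_distribution (induced_metric B A f g) D (cinv c0 y0)"
proof -
  let ?q = "cinv c0 y0"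
  let ?p = "f ?q"
  define c where "c = pref_chart A ?p"
  have herm: "almost_paraquaternionic_hermitian A \<sigma> g" using pk unfolding paraquaternionic_kaehler_def by blast
  then have g: "semi_riemannian_metric A g" unfolding almost_paraquaternionic_hermitian_def by blast
  have f: "smooth_map B A f"
    using CR unfolding paraquaternionic_CR_submanifold_def nondegenerate_submanifold_def immersion_def by blast
  have q: "?q \<in> fst c0" "snd c0 ?q = y0" using cinv_chart(2,3)[OF B c0] y0 R by auto
  have cA: "c \<in> A" and pc: "?p \<in> fst c" using pref_chart[OF A] by (auto simp: c_def)
  obtain U J where J: "canonical_local_basis A \<sigma> U J" and pU: "?p \<in> U"
    using herm unfolding almost_paraquaternionic_hermitian_def almost_paraquaternionic_structure_def by blast
  have oU: "open U" and Jsm: "smooth_endo A U (J 1)" using J unfolding canonical_local_basis_def by blast+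
  let ?T = "snd c ` (U \<inter> fst c)"
  obtain \<Omega> :: "'a \<Rightarrow> 'a \<Rightarrow>\<^sub>L 'a \<Rightarrow>\<^sub>L real" where sm\<Omega>: "smooth_on ?T \<Omega>"
    and \<Omega>: "\<And>z u v. z \<in> ?T \<Longrightarrow> blinfun_apply (blinfun_apply (\<Omega> z) u) v
      = g (cinv c z) (coord_vec A c u (cinv c z)) (J 1 (cinv c z) (coord_vec A c v (cinv c z)))"
    using form_blinfun[OF A g cA Jsm oU] by blast
  have oT: "open ?T"
    by (rule open_image_chart[OF A cA]) (use oU manifold_chart(1)[OF A cA] in auto)
  define F where "F = snd c \<circ> f \<circ> cinv c0"
  let ?G = "\<lambda>y. Blinfun (frechet_derivative F (at y))"
  let ?O = "snd c0 ` (fst c0 \<inter> f -` (U \<inter> fst c))"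
  have "open (f -` (U \<inter> fst c))"
    using f oU manifold_chart(1)[OF A cA] by (auto simp: smooth_map_def intro!: open_vimage)
  then have oO: "open ?O"
    by (intro open_image_chart[OF B c0]) (use manifold_chart(1)[OF B c0] in auto)
  define R1 where "R1 = R \<inter> ?O"
  have oR1: "open R1" using R oO by (auto simp: R1_def)
  have y1: "y0 \<in> R1" using y0 q pU pc by (auto simp: R1_def image_iff intro!: bexI[of _ ?q])
  have smF: "smooth_on R1 F"
    unfolding F_def by (rule smooth_on_subset[OF smooth_map_chart(1)[OF B A f c0 cA]]) (auto simp: R1_def)
  note smG = smooth_on_blinfun_derivative[OF oR1 smF]
  have pull: "blinfun_apply (blinfun_apply (\<Omega> (F y)) (blinfun_apply (?G y) u)) (blinfun_apply (?G y) v)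
    = g (f (cinv c0 y)) (tangent_map B A f (cinv c0 y) (coord_vec B c0 u (cinv c0 y)))
        (J 1 (f (cinv c0 y)) (tangent_map B A f (cinv c0 y) (coord_vec B c0 v (cinv c0 y))))"
    if "y \<in> R1" for y u v
    unfolding F_def
    by (rule pullback_form[where U = U and g = g and s = "J 1" and \<Omega> = \<Omega>, OF A B f cA c0])
      (use that \<Omega> in \<open>auto simp: R1_def\<close>)
  have FT: "F y \<in> ?T" if "y \<in> R1" for y
    using that cinv_chart(1)[OF B c0] by (auto simp: R1_def F_def)
  have fU: "f (cinv c0 y) \<in> U" if "y \<in> R1" for y
    using that cinv_chart(1)[OF B c0] by (auto simp: R1_def)
  have Fy0: "F y0 = snd c ?p" by (simp add: F_def)
  \<comment> \<open>The target chart is the preferred chart at \<open>?p\<close>, so components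
    there are the tangent vectors themselves.\<close>
  have Gt: "blinfun_apply (?G y0) u = tangent_map B A f ?q (coord_vec B c0 u ?q)" for u
  proof -
    have "tangent_map B A f ?q (coord_vec B c0 u ?q) = coord_vec A c (rep_diff f c0 c ?q u) ?p"
      by (rule tangent_map_coord_vec[OF B A f c0 cA q(1) pc])
    also have "\<dots> = rep_diff f c0 c ?q u"
      by (simp add: coord_vec_def c_def chart_diff_pref_chart[OF A])
    also have "\<dots> = blinfun_apply (?G y0) u"
      using blinfun_apply_Blinfun_derivative[OF smooth_on_differentiable[OF smF y1]]
      by (simp add: rep_diff_def F_def q(2))
    finally show ?thesis ..
  qed
  obtain L where L: "\<And>w. L w \<in> \<sigma> ?p" and
    dL: "\<And>u v w. frechet_derivative (\<lambda>z. g (cinv c z) (coord_vec A c u (cinv c z)) (J 1 (cinv c z) (coord_vec A c v (cinv c z)))) (at (snd c ?p)) w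
      + frechet_derivative (\<lambda>z. g (cinv c z) (coord_vec A c v (cinv c z)) (J 1 (cinv c z) (coord_vec A c w (cinv c z)))) (at (snd c ?p)) u
      + frechet_derivative (\<lambda>z. g (cinv c z) (coord_vec A c w (cinv c z)) (J 1 (cinv c z) (coord_vec A c u (cinv c z)))) (at (snd c ?p)) v
      = g ?p u (blinfun_apply (L w) v) + g ?p v (blinfun_apply (L u) w) + g ?p w (blinfun_apply (L v) u)"
    by (rule fundamental_form_differential[OF A pk J pU c_def, where \<alpha> = 1]) blast
  let ?\<Omega>' = "frechet_derivative \<Omega> (at (F y0))"
  have \<Omega>d: "(\<Omega> has_derivative ?\<Omega>') (at (F y0))" by (rule smooth_on_has_derivative[OF sm\<Omega> FT[OF y1]])
  have \<Omega>': "blinfun_apply (blinfun_apply (?\<Omega>' w) u) v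
      = frechet_derivative (\<lambda>z. g (cinv c z) (coord_vec A c u (cinv c z)) (J 1 (cinv c z) (coord_vec A c v (cinv c z)))) (at (snd c ?p)) w" for u v w
  proof -
    have "((\<lambda>z. blinfun_apply (blinfun_apply (\<Omega> z) u) v) has_derivative (\<lambda>w. blinfun_apply (blinfun_apply (?\<Omega>' w) u) v)) (at (F y0))"
      by (rule bounded_linear.has_derivative[OF blinfun.bounded_linear_left
            bounded_linear.has_derivative[OF blinfun.bounded_linear_left \<Omega>d]])
    then have "((\<lambda>z. g (cinv c z) (coord_vec A c u (cinv c z)) (J 1 (cinv c z) (coord_vec A c v (cinv c z))))
        has_derivative (\<lambda>w. blinfun_apply (blinfun_apply (?\<Omega>' w) u) v)) (at (F y0))"
      by (rule has_derivative_transform_within_open[OF _ oT FT[OF y1]]) (rule \<Omega>)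
    then show ?thesis unfolding Fy0 by (simp add: frechet_derivative_eqI)
  qed
  let ?X = "frechet_derivative Z (at y0) (Y y0) - frechet_derivative Y (at y0) (Z y0)"
  note kernel = CR_kernel[OF herm CR J, where \<alpha> = 1]
  have zero: "blinfun_apply (blinfun_apply (\<Omega> (F y0)) (blinfun_apply (?G y0) ?X)) (blinfun_apply (?G y0) w) = 0" for w
  proof (rule pullback_kernel_involutive[OF oR1 y1, where Y = Y and Z = Z])
    show "(F has_derivative blinfun_apply (?G y)) (at y)" if "y \<in> R1" for y
      unfolding blinfun_apply_Blinfun_derivative[OF smooth_on_differentiable[OF smF that]]
      by (rule smooth_on_has_derivative[OF smF that])
    show "(?G has_derivative frechet_derivative ?G (at y0)) (at y0)"
      by (rule smooth_on_has_derivative[OF smG y1])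
    show "(\<Omega> has_derivative ?\<Omega>') (at (F y0))" by (rule \<Omega>d)
    show "(Y has_derivative frechet_derivative Y (at y0)) (at y0)" "(Z has_derivative frechet_derivative Z (at y0)) (at y0)"
      by (rule smooth_on_has_derivative[OF Y y0], rule smooth_on_has_derivative[OF Z y0])
    show "blinfun_apply (blinfun_apply (\<Omega> (F y)) u) v = - blinfun_apply (blinfun_apply (\<Omega> (F y)) v) u" if "y \<in> R1" for y u v
    proof -
      have "cinv c (F y) \<in> U" using FT[OF that] cinv_chart(1)[OF A cA] by auto
      moreover have "g p' u v = g p' v u" for p' u v using g unfolding semi_riemannian_metric_def by blast
      ultimately show ?thesis
        unfolding \<Omega>[OF FT[OF that]] using canonical_basis_skew[OF herm J] by metis
    qed
    show "blinfun_apply (blinfun_apply (\<Omega> (F y)) (blinfun_apply (?G y) (Y y))) (blinfun_apply (?G y) w) = 0" if "y \<in> R1" for y w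
      unfolding pull[OF that] using kernel[OF fU[OF that]] YE[of y] that by (auto simp: R1_def)
    show "blinfun_apply (blinfun_apply (\<Omega> (F y)) (blinfun_apply (?G y) (Z y))) (blinfun_apply (?G y) w) = 0" if "y \<in> R1" for y w
      unfolding pull[OF that] using kernel[OF fU[OF that]] ZE[of y] that by (auto simp: R1_def)
    show "blinfun_apply (blinfun_apply (?\<Omega>' (blinfun_apply (?G y0) w)) (blinfun_apply (?G y0) (Y y0))) (blinfun_apply (?G y0) (Z y0))
      + blinfun_apply (blinfun_apply (?\<Omega>' (blinfun_apply (?G y0) (Y y0))) (blinfun_apply (?G y0) (Z y0))) (blinfun_apply (?G y0) w)
      + blinfun_apply (blinfun_apply (?\<Omega>' (blinfun_apply (?G y0) (Z y0))) (blinfun_apply (?G y0) w)) (blinfun_apply (?G y0) (Y y0)) = 0" for w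
      unfolding \<Omega>' dL Gt
      using CR_span_vanishing[OF herm CR J pU L YE[OF y0]] CR_span_vanishing[OF herm CR J pU L ZE[OF y0]] by simp
  qed
  have "g ?p (tangent_map B A f ?q (coord_vec B c0 ?X ?q)) (J 1 ?p (tangent_map B A f ?q w)) = 0" for w
    using zero[of "chart_diff B c0 ?q w"] unfolding pull[OF y1] chart_diff_coord_vec(2)[OF B c0 q(1)] .
  then show ?thesis using kernel[OF pU] by blast
qed

section \<open>Linear algebra of the splitting along a non-degenerate subspace\<close>

text \<open>A family of \<open>k\<close> vectors spanning dimension \<open>k\<close> has no
  repetitions, so independence of its range as a set can be read off for the indexed
  coefficients.\<close>

lemma spanning_family_independent:
  fixes X :: "nat \<Rightarrow> 'b::euclidean_space"
  assumes "dim (span (X ` {..<k})) = k" and z: "(\<Sum>i<k. a i *\<^sub>R X i) = 0" and i: "i < k"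
  shows "a i = 0"
proof -
  let ?S = "X ` {..<k}"
  have "k \<le> card ?S" using dim_le_card[of "span ?S" ?S] assms(1) by simp
  then have c: "card ?S = k" using card_image_le[of "{..<k}" X] by simp
  then have inj: "inj_on X {..<k}" by (simp add: eq_card_imp_inj_on)
  have ind: "independent ?S"
    by (rule card_le_dim_spanning[of ?S "span ?S"]) (use c assms(1) in \<open>auto intro: span_base\<close>)
  let ?b = "\<lambda>v. a (inv_into {..<k} X v)"
  have "(\<Sum>v\<in>?S. ?b v *\<^sub>R v) = (\<Sum>i<k. a i *\<^sub>R X i)"
    by (simp add: sum.reindex[OF inj] inv_into_f_f[OF inj])
  then have "?b (X i) = 0"
    using independentD[OF ind, of ?S ?b "X i"] z i by simp
  then show ?thesis using inv_into_f_f[OF inj, of i] i by simp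
qed

text \<open>The form may be indefinite, so the projection comes from a Riesz-type map:
  \<open>T v\<close> records the values of \<open>b v\<close> on a basis of W. Its kernel is E,
  non-degeneracy makes it injective on W and hence onto W, and so every vector agrees modulo E with
  a unique vector of W.\<close>

lemma orthogonal_complement_nondegenerate:
  fixes b :: "'b::euclidean_space \<Rightarrow> 'b \<Rightarrow> real"
  assumes bil: "bilinear b" and W: "subspace W" and nd: "nondegenerate_on W b"
  defines "E \<equiv> {v. \<forall>w\<in>W. b v w = 0}"
  obtains P where "linear P" "\<And>v. P v \<in> E" "\<And>v. v \<in> E \<Longrightarrow> P v = v" "\<And>v. v - P v \<in> W"
    "subspace E" "dim E = DIM('b) - dim W"
proof -
  have E: "subspace E"
    unfolding subspace_def E_def
    by (simp add: bilinear_lzero[OF bil] bilinear_ladd[OF bil] bilinear_lmul[OF bil])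
  have int: "W \<inter> E = {0}"
    using nd W E by (auto simp: nondegenerate_on_def E_def subspace_0 bilinear_lzero[OF bil])
  obtain C where C: "C \<subseteq> W" "pairwise orthogonal C" "\<And>x. x \<in> C \<Longrightarrow> norm x = 1"
    "independent C" "card C = dim W" "span C = W"
    using orthonormal_basis_subspace[OF W] by blast
  have fC: "finite C" using C(4) by (rule independent_imp_finite)
  define T where "T v = (\<Sum>c\<in>C. b v c *\<^sub>R c)" for v
  have linT: "linear T"
    by (rule linearI) (simp_all add: T_def bilinear_ladd[OF bil] bilinear_lmul[OF bil] scaleR_left_distrib
        sum.distrib scaleR_sum_right)
  have TW: "T v \<in> W" for v
    unfolding T_def using C(1) W by (auto intro!: subspace_sum subspace_scale)
  have T0: "T v = 0 \<longleftrightarrow> v \<in> E" for v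
  proof
    assume "T v = 0"
    then have bc: "b v c = 0" if "c \<in> C" for c
      using independentD[OF C(4) fC subset_refl, of "b v" c] that by (simp add: T_def)
    have "subspace {w. b v w = 0}"
      unfolding subspace_def
      by (simp add: bilinear_rzero[OF bil] bilinear_radd[OF bil] bilinear_rmul[OF bil])
    then have "span C \<subseteq> {w. b v w = 0}" using bc by (intro span_minimal) auto
    then show "v \<in> E" using C(6) by (auto simp: E_def)
  next
    assume "v \<in> E"
    then have "b v c = 0" if "c \<in> C" for c using that C(1) by (auto simp: E_def)
    then show "T v = 0" by (simp add: T_def)
  qed
  have injT: "inj_on T W"
  proof (rule inj_onI)
    fix v w assume vw: "v \<in> W" "w \<in> W" "T v = T w"
    then have "T (v - w) = 0" by (simp add: linear_diff[OF linT])
    then have "v - w \<in> W \<inter> E" using T0 vw W by (simp add: subspace_diff)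
    then show "v = w" using int by simp
  qed
  have "T ` W = W"
  proof (rule subspace_dim_equal)
    show "subspace (T ` W)" by (rule linear_subspace_image[OF linT W])
    show "dim (T ` W) \<ge> dim W" using dim_image_eq[OF linT, of W] injT span_eq_iff[THEN iffD2, OF W] by simp
  qed (use TW W in auto)
  then have ex: "\<exists>w\<in>W. v - w \<in> E" for v
  proof -
    obtain w where "w \<in> W" "T w = T v" using TW[of v] \<open>T ` W = W\<close> by (metis image_iff)
    then have "T (v - w) = 0" by (simp add: linear_diff[OF linT])
    then show ?thesis using T0 \<open>w \<in> W\<close> by blast
  qed
  then obtain Q where Q: "\<And>v. Q v \<in> W" "\<And>v. v - Q v \<in> E" by metis
  have uniq: "Q v = w" if "w \<in> W" "v - w \<in> E" for v w
  proof -
    have "Q v - w = (v - w) - (v - Q v)" by simp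
    then have "Q v - w \<in> W \<inter> E"
      using Q that W E by (metis IntI subspace_diff)
    then show ?thesis using int by simp
  qed
  have linQ: "linear Q"
  proof (rule linearI)
    show "Q (u + v) = Q u + Q v" for u v
    proof (rule uniq)
      show "Q u + Q v \<in> W" using Q W by (simp add: subspace_add)
      show "u + v - (Q u + Q v) \<in> E" using subspace_add[OF E Q(2)[of u] Q(2)[of v]] by (simp add: algebra_simps)
    qed
    show "Q (r *\<^sub>R u) = r *\<^sub>R Q u" for r u
    proof (rule uniq)
      show "r *\<^sub>R Q u \<in> W" using Q W by (simp add: subspace_scale)
      show "r *\<^sub>R u - r *\<^sub>R Q u \<in> E" using subspace_scale[OF E Q(2)[of u], of r] by (simp add: algebra_simps)
    qed
  qed
  show ?thesis
  proof
    show "linear (\<lambda>v. v - Q v)" by (rule linear_compose_sub[OF linear_ident linQ])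
    show "v - Q v = v" if "v \<in> E" for v using uniq[of 0 v] that W by (simp add: subspace_0)
    show "v - Q v \<in> E" "v - (v - Q v) \<in> W" for v using Q by auto
    show "subspace E" by (rule E)
    have "{x + y |x y. x \<in> W \<and> y \<in> E} = UNIV"
    proof (intro equalityI subsetI UNIV_I)
      fix v have "v = Q v + (v - Q v)" by simp
      then show "v \<in> {x + y |x y. x \<in> W \<and> y \<in> E}" using Q by blast
    qed
    then show "dim E = DIM('b) - dim W"
      using dim_sums_Int[OF W E] int by simp
  qed
qed

section \<open>Graph form of the complement and its leaves\<close>

theorem theorem4p1:
  fixes A :: "('m::{t2_space,second_countable_topology}, 'a::euclidean_space) chart set"
    and B :: "('n::{t2_space,second_countable_topology}, 'b::euclidean_space) chart set"
    and \<sigma> :: "'m \<Rightarrow> ('a \<Rightarrow>\<^sub>L 'a) set"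
    and g :: "'m \<Rightarrow> 'a \<Rightarrow> 'a \<Rightarrow> real"
    and f :: "'n \<Rightarrow> 'm"
    and D :: "'n \<Rightarrow> 'b set"
  assumes "smooth_manifold A" and "paraquaternionic_kaehler A \<sigma> g"
    and "smooth_manifold B" and "paraquaternionic_CR_submanifold B A f \<sigma> g D"
  shows "integrable_distribution B (orth_distribution (induced_metric B A f g) D)"
proof -
  note A = assms(1) and pk = assms(2) and B = assms(3) and CR = assms(4)
  let ?h = "induced_metric B A f g"
  let ?E = "orth_distribution ?h D"
  have herm: "almost_paraquaternionic_hermitian A \<sigma> g" using pk unfolding paraquaternionic_kaehler_def by blast
  then have g: "semi_riemannian_metric A g" unfolding almost_paraquaternionic_hermitian_def by blast
  have f: "smooth_map B A f"
    using CR unfolding paraquaternionic_CR_submanifold_def nondegenerate_submanifold_def immersion_def by blast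
  have dist: "distribution B D" and nd: "\<And>x. nondegenerate_on (D x) (?h x)"
    using CR unfolding paraquaternionic_CR_submanifold_def by blast+
  obtain k where Dk: "\<And>x. subspace (D x) \<and> dim (D x) = k"
    and loc: "\<And>x. \<exists>U X. open U \<and> x \<in> U \<and> (\<forall>i<k. smooth_vf B U (X i)) \<and> (\<forall>y\<in>U. D y = span ((\<lambda>i. X i y) ` {..<k}))"
    using dist unfolding distribution_def by blast
  have bilg: "bilinear (g p)" for p using g unfolding semi_riemannian_metric_def by blast
  have bilh: "bilinear (?h x)" for x
    using linear_tangent_map[OF B A f, of x] bilg[of "f x"]
    unfolding induced_metric_def bilinear_def
    by (auto intro: linear_compose[of "tangent_map B A f x", unfolded o_def])
  have Ek: "subspace (?E x) \<and> dim (?E x) = DIM('b) - k" for x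
    by (rule orthogonal_complement_nondegenerate[OF bilh[of x] conjunct1[OF Dk[of x]] nd[of x]])
      (simp add: orth_distribution_def Dk)
  \<comment> \<open>The graph form of E near \<open>x\<close> over K = E at \<open>x\<close>; it
    feeds both the smooth local frame and the construction of leaves.\<close>
  have chart: "\<exists>c0 S (\<Phi> :: 'b \<Rightarrow> 'b \<Rightarrow>\<^sub>L 'b) P. c0 \<in> B \<and> open S \<and> S \<subseteq> snd c0 ` fst c0 \<and> x \<in> fst c0 \<and> snd c0 x \<in> S \<and>
      smooth_on S \<Phi> \<and> linear P \<and> (\<forall>v. P v \<in> ?E x) \<and> (\<forall>v\<in>?E x. P v = v) \<and>
      (\<forall>p\<in>fst c0. snd c0 p \<in> S \<longrightarrow> ?E p = {v. \<exists>w\<in>?E x. chart_diff B c0 p v = blinfun_apply (\<Phi> (snd c0 p)) w}) \<and>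
      (\<forall>y\<in>S. \<forall>w\<in>?E x. P (blinfun_apply (\<Phi> y) w) = w)" for x
  proof -
    obtain P where P: "linear P" "\<And>v. P v \<in> ?E x" "\<And>v. v \<in> ?E x \<Longrightarrow> P v = v" "\<And>v. v - P v \<in> D x"
      unfolding orth_distribution_def
      by (rule orthogonal_complement_nondegenerate[OF bilh[of x] conjunct1[OF Dk[of x]] nd[of x]]) blast
    obtain U X where U: "open U" "x \<in> U" and X: "\<And>i. i < k \<Longrightarrow> smooth_vf B U (X i)"
      and DX: "\<And>y. y \<in> U \<Longrightarrow> D y = span ((\<lambda>i. X i y) ` {..<k})"
      using loc[of x] by blast
    define c0 where "c0 = pref_chart B x"
    define c where "c = pref_chart A (f x)"
    have c0: "c0 \<in> B" and xc0: "x \<in> fst c0" using pref_chart[OF B] by (auto simp: c0_def)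
    have c: "c \<in> A" and fxc: "f x \<in> fst c" using pref_chart[OF A] by (auto simp: c_def)
    \<comment> \<open>The identity endomorphism lets \<open>form_blinfun\<close> and
      \<open>pullback_form\<close> be reused for the induced metric.\<close>
    have idsm: "smooth_endo A (fst c) (\<lambda>_. id_blinfun)"
      unfolding smooth_endo_def
    proof (intro ballI allI)
      fix d v assume d: "d \<in> A"
      show "smooth_on (snd d ` (fst c \<inter> fst d)) (\<lambda>y. chart_diff A d (cinv d y) (blinfun_apply id_blinfun (coord_vec A d v (cinv d y))))"
      proof (rule smooth_on_cong[OF _ _ smooth_on_const])
        show "open (snd d ` (fst c \<inter> fst d))"
          by (intro open_image_chart[OF A d] open_Int manifold_chart(1)[OF A] c d) simp
        show "chart_diff A d (cinv d y) (blinfun_apply id_blinfun (coord_vec A d v (cinv d y))) = v"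
          if "y \<in> snd d ` (fst c \<inter> fst d)" for y
          using that cinv_chart(1)[OF A d] chart_diff_coord_vec(1)[OF A d] by auto
      qed
    qed
    have oc: "open (fst c)" by (rule manifold_chart(1)[OF A c])
    obtain \<Omega> :: "'a \<Rightarrow> 'a \<Rightarrow>\<^sub>L 'a \<Rightarrow>\<^sub>L real" where sm\<Omega>: "smooth_on (snd c ` (fst c \<inter> fst c)) \<Omega>"
      and \<Omega>: "\<And>z u v. z \<in> snd c ` (fst c \<inter> fst c) \<Longrightarrow> blinfun_apply (blinfun_apply (\<Omega> z) u) v
        = g (cinv c z) (coord_vec A c u (cinv c z)) (blinfun_apply id_blinfun (coord_vec A c v (cinv c z)))"
      using form_blinfun[OF A g c idsm oc] by blast
    define F where "F = snd c \<circ> f \<circ> cinv c0"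
    let ?G = "\<lambda>y. Blinfun (frechet_derivative F (at y))"
    define S0 where "S0 = snd c0 ` (U \<inter> fst c0 \<inter> f -` fst c)"
    have oS0: "open S0"
      unfolding S0_def
      by (rule open_image_chart[OF B c0])
        (use U manifold_chart(1)[OF B c0] oc f in \<open>auto simp: smooth_map_def intro!: open_Int open_vimage\<close>)
    have x0: "snd c0 x \<in> S0" using U xc0 fxc by (auto simp: S0_def)
    have smF: "smooth_on S0 F"
      unfolding F_def by (rule smooth_on_subset[OF smooth_map_chart(1)[OF B A f c0 c]]) (auto simp: S0_def)
    note smG = smooth_on_blinfun_derivative[OF oS0 smF]
    have FT: "F ` S0 \<subseteq> snd c ` (fst c \<inter> fst c)"
      using cinv_chart(1)[OF B c0] by (auto simp: S0_def F_def)
    have sm\<Omega>F: "smooth_on S0 (\<lambda>y. \<Omega> (F y))"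
      by (rule smooth_on_compose[OF oS0 _ FT smF sm\<Omega>]) (use manifold_chart(2)[OF A c] in simp)
    define H where "H y u v = blinfun_apply (blinfun_apply (\<Omega> (F y)) (blinfun_apply (?G y) u)) (blinfun_apply (?G y) v)" for y u v
    have H: "H y u v = ?h (cinv c0 y) (coord_vec B c0 u (cinv c0 y)) (coord_vec B c0 v (cinv c0 y))" if "y \<in> S0" for y u v
      unfolding H_def F_def induced_metric_def
      using pullback_form[where U = "fst c" and g = g and s = "\<lambda>_. id_blinfun" and \<Omega> = \<Omega>, OF A B f c c0 _ \<Omega>, of y u v] that
      by (auto simp: S0_def)
    define \<xi> where "\<xi> i = vf_rep B c0 (X i)" for i
    have \<xi>: "\<xi> i (snd c0 p) = chart_diff B c0 p (X i p)" if "p \<in> fst c0" for i p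
      using cinv_chart(1)[OF B c0 that] by (simp add: \<xi>_def vf_rep_def)
    have sm\<xi>: "smooth_on S0 (\<xi> i)" if "i < k" for i
    proof (rule smooth_on_subset)
      show "smooth_on (snd c0 ` (U \<inter> fst c0)) (\<xi> i)"
        using X[OF that] c0 unfolding smooth_vf_def \<xi>_def by blast
    qed (auto simp: S0_def)
    define a where "a y i v = H y v (\<xi> i y)" for y i v
    \<comment> \<open>\<open>M y\<close> keeps the projection of \<open>v\<close> to E at
      \<open>x\<close> and stores the products of \<open>v\<close> with the frame of D over
      \<open>y\<close> as coefficients of the frame at \<open>x\<close>. The image lies in E at
      \<open>x\<close> exactly when all products vanish, that is when \<open>v\<close> is orthogonal
      to D. The graph map \<open>\<Phi>\<close> is the inverse of \<open>M\<close>.\<close>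
    define M where "M y v = P v + (\<Sum>i<k. a y i v *\<^sub>R X i x)" for y v
    have lina: "linear (a y i)" for y i
      unfolding a_def H_def by (rule linearI) (simp_all add: blinfun.bilinear_simps)
    have linM: "linear (M y)" for y
      unfolding M_def
      by (rule linearI) (simp_all add: linear_add[OF P(1)] linear_scale[OF P(1)] linear_add[OF lina] linear_scale[OF lina]
          scaleR_left_distrib sum.distrib scaleR_sum_right algebra_simps)
    have smM: "smooth_on S0 (\<lambda>y. Blinfun (M y))"
    proof (rule smooth_on_linear_fields[OF oS0 linM])
      show "smooth_on S0 (\<lambda>y. M y v)" for v
        unfolding M_def a_def H_def
        by (intro smooth_on_add smooth_on_sum smooth_on_scaleR smooth_on_blinfun_apply smooth_on_const oS0 sm\<Omega>F smG sm\<xi>) auto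
    qed
    have Mapply: "blinfun_apply (Blinfun (M y)) = M y" for y
      using linM by (simp add: bounded_linear_Blinfun_apply linear_conv_bounded_linear)
    have Dx: "D x = span ((\<lambda>i. X i x) ` {..<k})" by (rule DX[OF U(2)])
    have XD: "X i x \<in> D x" if "i < k" for i unfolding Dx using that by (auto intro: span_base)
    have ED: "v = 0" if "v \<in> ?E x" "v \<in> D x" for v
      using nd[of x] that by (auto simp: nondegenerate_on_def orth_distribution_def)
    have PD: "P v = 0" if "v \<in> D x" for v
    proof (rule ED[OF P(2)])
      have "v - (v - P v) \<in> D x" using Dk[of x] that P(4)[of v] by (blast intro: subspace_diff)
      then show "P v \<in> D x" by simp
    qed
    have sumD: "(\<Sum>i<k. a y i v *\<^sub>R X i x) \<in> D x" for y v
      using Dk[of x] XD by (auto intro!: subspace_sum subspace_scale)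
    have PM: "P (M y v) = P v" for y v
      unfolding M_def using PD[OF sumD] P(3)[OF P(2)] by (simp add: linear_add[OF P(1)])
    have EM: "v \<in> ?E p \<longleftrightarrow> M (snd c0 p) (chart_diff B c0 p v) \<in> ?E x" if p: "p \<in> fst c0" "snd c0 p \<in> S0" for p v
    proof -
      let ?y = "snd c0 p" and ?w = "chart_diff B c0 p v"
      have pU: "p \<in> U" using p manifold_chart(3)[OF B c0] by (auto simp: S0_def dest: inj_onD)
      have ai: "a ?y i ?w = ?h p v (X i p)" for i
        unfolding a_def H[OF p(2)] \<xi>[OF p(1)] cinv_chart(1)[OF B c0 p(1)] chart_diff_coord_vec(2)[OF B c0 p(1)] ..
      have "v \<in> ?E p \<longleftrightarrow> (\<forall>i<k. ?h p v (X i p) = 0)"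
      proof
        assume *: "\<forall>i<k. ?h p v (X i p) = 0"
        have "subspace {w. ?h p v w = 0}"
          unfolding subspace_def
          by (simp add: bilinear_rzero[OF bilh] bilinear_radd[OF bilh] bilinear_rmul[OF bilh])
        then have "D p \<subseteq> {w. ?h p v w = 0}" unfolding DX[OF pU] using * by (intro span_minimal) auto
        then show "v \<in> ?E p" by (auto simp: orth_distribution_def)
      next
        assume "v \<in> ?E p"
        then show "\<forall>i<k. ?h p v (X i p) = 0"
          unfolding orth_distribution_def DX[OF pU] by (auto intro: span_base)
      qed
      also have "\<dots> \<longleftrightarrow> M ?y ?w \<in> ?E x"
      proof
        assume "\<forall>i<k. ?h p v (X i p) = 0"
        then have "M ?y ?w = P ?w" by (simp add: M_def ai)
        then show "M ?y ?w \<in> ?E x" using P(2) by simp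
      next
        assume "M ?y ?w \<in> ?E x"
        then have "M ?y ?w = P ?w" using P(3) PM by metis
        then have z: "(\<Sum>i<k. a ?y i ?w *\<^sub>R X i x) = 0" by (simp add: M_def)
        have "dim (span ((\<lambda>i. X i x) ` {..<k})) = k" using Dk[of x] Dx by simp
        from spanning_family_independent[OF this z] show "\<forall>i<k. ?h p v (X i p) = 0" by (simp add: ai)
      qed
      finally show ?thesis .
    qed
    \<comment> \<open>A kernel vector is mapped into E at \<open>x\<close>, hence lies in E at
      \<open>x\<close> and is fixed by \<open>P\<close>; but \<open>M\<close> preserves the value of
      \<open>P\<close>, which is therefore 0.\<close>
    have injM: "inj (blinfun_apply (Blinfun (M (snd c0 x))))"
      unfolding Mapply
    proof (rule linear_injective_0[THEN iffD2, OF linM], intro allI impI)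
      fix v assume v: "M (snd c0 x) v = 0"
      have id: "chart_diff B c0 x v = v" by (simp add: c0_def chart_diff_pref_chart[OF B])
      have "v \<in> ?E x" using EM[OF xc0 x0, of v] v Ek[of x] by (simp add: id subspace_0)
      then have "P v = v" by (rule P(3))
      moreover have "P v = 0" using PM[of "snd c0 x" v] v linear_0[OF P(1)] by simp
      ultimately show "v = 0" by simp
    qed
    obtain S \<Phi> where S: "open S" "snd c0 x \<in> S" "S \<subseteq> S0"
      and inv1: "\<And>y. y \<in> S \<Longrightarrow> Blinfun (M y) o\<^sub>L \<Phi> y = id_blinfun"
      and inv2: "\<And>y. y \<in> S \<Longrightarrow> \<Phi> y o\<^sub>L Blinfun (M y) = id_blinfun"
      using blinfun_invertible_nhd[OF oS0 x0 smooth_on_imp_continuous_on[OF smM] injM] by metis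
    have M\<Phi>: "M y (blinfun_apply (\<Phi> y) v) = v" "blinfun_apply (\<Phi> y) (M y v) = v" if "y \<in> S" for y v
      using inv1[OF that] inv2[OF that] Mapply
      by (metis blinfun_apply_blinfun_compose blinfun_apply_id_blinfun)+
    have sm\<Phi>: "smooth_on S \<Phi>"
      by (rule smooth_on_blinfun_inverse[OF S(1) smooth_on_subset[OF smM S(3)] inv1 inv2])
    have "?E p = {v. \<exists>w\<in>?E x. chart_diff B c0 p v = blinfun_apply (\<Phi> (snd c0 p)) w}"
      if p: "p \<in> fst c0" "snd c0 p \<in> S" for p
      using EM[OF p(1)] p(2) S(3) M\<Phi>[OF p(2)] by (auto simp: subset_iff) metis
    moreover have "P (blinfun_apply (\<Phi> y) w) = w" if "y \<in> S" "w \<in> ?E x" for y w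
      using PM[of y "blinfun_apply (\<Phi> y) w"] M\<Phi>(1)[OF that(1)] P(3)[OF that(2)] by simp
    moreover have "S \<subseteq> snd c0 ` fst c0" using S(3) by (auto simp: S0_def)
    ultimately show ?thesis
      using c0 S xc0 sm\<Phi> P(1-3) by (intro exI[of _ c0] exI[of _ S] exI[of _ \<Phi>] exI[of _ P]) blast
  qed
  show ?thesis
    unfolding integrable_distribution_def
  proof (intro conjI allI)
    show "distribution B ?E"
    proof (rule distribution_of_local_frame[OF B Ek])
      fix x
      show "\<exists>c S (\<Phi> :: 'b \<Rightarrow> 'b \<Rightarrow>\<^sub>L 'b) K. c \<in> B \<and> open S \<and> S \<subseteq> snd c ` fst c \<and> x \<in> fst c \<and> snd c x \<in> S \<and>
        smooth_on S \<Phi> \<and> subspace K \<and> dim K = DIM('b) - k \<and>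
        (\<forall>p\<in>fst c. snd c p \<in> S \<longrightarrow> ?E p = {v. \<exists>k\<in>K. chart_diff B c p v = blinfun_apply (\<Phi> (snd c p)) k})"
        using chart[of x] Ek[of x] by blast
    qed
    fix x
    obtain c0 S and \<Phi> :: "'b \<Rightarrow> 'b \<Rightarrow>\<^sub>L 'b" and P where c0: "c0 \<in> B" and S: "open S" "S \<subseteq> snd c0 ` fst c0"
      and x: "x \<in> fst c0" "snd c0 x \<in> S" and \<Phi>: "smooth_on S \<Phi>"
      and P: "linear P" "\<And>v. P v \<in> ?E x" "\<And>v. v \<in> ?E x \<Longrightarrow> P v = v"
      and E: "\<And>p. p \<in> fst c0 \<Longrightarrow> snd c0 p \<in> S \<Longrightarrow> ?E p = {v. \<exists>w\<in>?E x. chart_diff B c0 p v = blinfun_apply (\<Phi> (snd c0 p)) w}"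
      and P\<Phi>: "\<And>y w. y \<in> S \<Longrightarrow> w \<in> ?E x \<Longrightarrow> P (blinfun_apply (\<Phi> y) w) = w"
      using chart[of x] by blast
    show "\<exists>Q. x \<in> Q \<and> integral_manifold B ?E Q"
    proof (rule integral_manifold_of_commuting_frame[OF B c0 S x \<Phi> _ P E P\<Phi>])
      show "subspace (?E x)" using Ek by blast
      fix y v w assume y: "y \<in> S" and vw: "v \<in> ?E x" "w \<in> ?E x"
      have memE: "coord_vec B c0 u (cinv c0 y) \<in> ?E (cinv c0 y) \<longleftrightarrow> (\<exists>w\<in>?E x. u = blinfun_apply (\<Phi> y) w)" if "y \<in> S" for y u
      proof -
        have "cinv c0 y \<in> fst c0" "snd c0 (cinv c0 y) = y" using that S cinv_chart[OF B c0] by auto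
        then show ?thesis using E[of "cinv c0 y"] that chart_diff_coord_vec(1)[OF B c0] by simp
      qed
      have sm: "smooth_on S (\<lambda>y. blinfun_apply (\<Phi> y) u)" for u
        by (rule smooth_on_blinfun_apply[OF S(1) \<Phi> smooth_on_const])
      have d: "((\<lambda>y. blinfun_apply (\<Phi> y) u) has_derivative (\<lambda>t. blinfun_apply (frechet_derivative \<Phi> (at y) t) u)) (at y)" for u
        by (rule bounded_linear.has_derivative[OF blinfun.bounded_linear_left smooth_on_has_derivative[OF \<Phi> y]])
      let ?X = "blinfun_apply (frechet_derivative \<Phi> (at y) (blinfun_apply (\<Phi> y) v)) w
        - blinfun_apply (frechet_derivative \<Phi> (at y) (blinfun_apply (\<Phi> y) w)) v"
      have "coord_vec B c0 ?X (cinv c0 y) \<in> ?E (cinv c0 y)"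
        using CR_orth_involutive[OF A pk B CR c0 S y sm[of v] sm[of w]] memE vw
        by (auto simp: frechet_derivative_eqI[OF d])
      then obtain u where u: "u \<in> ?E x" "?X = blinfun_apply (\<Phi> y) u" using memE[OF y] by blast
      \<comment> \<open>\<open>P (\<Phi> y u) = u\<close> does not depend on \<open>y\<close>, so
        \<open>P\<close> annihilates every derivative of \<open>\<Phi>\<close> on such
        \<open>u\<close>.\<close>
      have P0: "P (blinfun_apply (frechet_derivative \<Phi> (at y) t) u) = 0" if "u \<in> ?E x" for t u
      proof -
        have Pbl: "bounded_linear P" using P(1) by (simp add: linear_conv_bounded_linear)
        have "((\<lambda>y. P (blinfun_apply (\<Phi> y) u)) has_derivative (\<lambda>t. 0)) (at y)"
          by (rule has_derivative_transform_within_open[OF has_derivative_const S(1) y]) (simp add: P\<Phi> that)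
        then have "(\<lambda>t. P (blinfun_apply (frechet_derivative \<Phi> (at y) t) u)) = (\<lambda>t. 0)"
          by (rule has_derivative_unique[OF bounded_linear.has_derivative[OF Pbl d]])
        then show ?thesis by (rule fun_cong)
      qed
      \<comment> \<open>The bracket is \<open>\<Phi> y u\<close> for some \<open>u\<close> in K, and
        \<open>P\<close> recovers \<open>u\<close> from it while killing both derivative
        terms.\<close>
      have "u = P ?X" using P\<Phi>[OF y u(1)] u(2) by simp
      also have "\<dots> = 0" by (simp add: linear_diff[OF P(1)] P0 vw)
      finally have "?X = 0" using u(2) by (simp add: blinfun.zero_right)
      then show "blinfun_apply (frechet_derivative \<Phi> (at y) (blinfun_apply (\<Phi> y) v)) w
        = blinfun_apply (frechet_derivative \<Phi> (at y) (blinfun_apply (\<Phi> y) w)) v" by simp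
    qed
  qed
qed

end
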